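(* Let $\lambda$ be a locally finite and diffuse measure on $\mathbb X$, and let $\eta,\eta'$ be independent Poisson processes on $\mathbb X$ with intensity measure $\lambda$. Let $\{Z_t:t\in\mathbb R_+\}$ be a CTDT, $Z:=Z_\infty=\bigcup_{t\in\mathbb R_+}Z_t$, and for $t\ge 0$ set $$\zeta_t:=\eta_{Z(\eta)\setminus Z_t(\eta)}+\eta'_{Z_t(\eta)}+\eta'_{\mathbb X\setminus Z(\eta)} .$$ Let $f:\mathbf N\to\mathbb R$ be measurable with $\mathbb E|f(\eta)|<\infty$. Assume that (1) $f(\mu)=f(\mu_{Z(\mu)})$ for all $\mu\in\mathbf N$; (2) $f(\zeta_t)\to f(\eta')$ in probability as $t\to\infty$; (3) $\lambda(Z_t(\mu)\setminus Z_{t-}(\mu))=0$ for all $\mu\in\mathbf N$ and $t\in\mathbb R_+$; (4) $\mathbb P\big(\eta(Z_t(\eta)\setminus Z_{t-}(\eta))\le 1\text{ for all }t\in\mathbb R_+\big)=1$. Then $$\mathbb E\big[|f(\eta)-f(\eta')|\big]\le 2\int_{\mathbb X} \mathbb P(x\in Z(\eta))\,\mathbb E\big[|D_xf(\eta)|\big]\,\lambda(dx),$$ where $D_xf(\mu):=f(\mu+\delta_x)-f(\mu)$.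
   Context: $(\mathbb X,\mathcal X)$ is a Borel space (measurably isomorphic to a Borel subset of $[0,1]$). Fix an increasing sequence $B_n\in\mathcal X$ with $B_n\uparrow\mathbb X$, and let $\mathcal X_0:=\{B\cap B_n:B\in\mathcal X,n\in\mathbb N\}$. A measure on $\mathbb X$ is locally finite if it is finite on $\mathcal X_0$. $\mathbf N$ is the set of all measures on $\mathbb X$ that take values in $\mathbb N_0=\{0,1,2,\dots\}$ on $\mathcal X_0$, equipped with the smallest $\sigma$-field $\mathcal N$ making $\mu\mapsto\mu(B)$ measurable for all $B\in\mathcal X$. For a measure $\nu$ and $B\in\mathcal X$, $\nu_B:=\nu(\cdot\cap B)$. A Poisson process with intensity measure $\lambda$ is a random element $\eta$ of $\mathbf N$ such that $\eta(B)$ is Poisson distributed with mean $\lambda(B)$ for every $B\in\mathcal X$, and $\eta(C_1),\dots,\eta(C_m)$ are independent for pairwise disjoint $C_1,\dots,C_m\in\mathcal X$. $\delta_x$ is the Dirac measure at $x$. Stopping set: a map $Z:\mathbf N\to\mathcal X$ that is graph-measurable, i.e. $(x,\mu)\mapsto\mathbf 1\{x\in Z(\mu)\}$ is measurable on $\mathbb X\times\mathbf N$, and satisfies $Z(\mu)=Z(\mu_{Z(\mu)}+\psi_{Z(\mu)^c})$ for all $\mu,\psi\in\mathbf N$. Continuous-time decision tree (CTDT): a family $\{Z_t:t\in\mathbb R_+\}$ of stopping sets with values in $\mathcal X_0$ such that $\mathbb E[\lambda(Z_0(\eta))]=0$, $Z_s\subset Z_t$ for $s\le t$, and $Z_t=\bigcap_{s>t}Z_s$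 for $t\in\mathbb R_+$. One writes $Z_{t-}:=\bigcup_{s<t}Z_s$ for $t>0$ and $Z_{0-}:=\emptyset$. *)

theory Defs
  imports "HOL-Probability.Probability"
begin

definition is_borel_space :: "'a measure \<Rightarrow> bool" where
  "is_borel_space M \<longleftrightarrow>
    (\<exists>S::real set. S \<in> sets borel \<and> S \<subseteq> {0..1} \<and>
      (\<exists>f g. f \<in> measurable M (restrict_space borel S) \<and>
             g \<in> measurable (restrict_space borel S) M \<and>
             (\<forall>x\<in>space M. g (f x) = x) \<and> (\<forall>y\<in>S. f (g y) = y)))"

definition localizing_seq :: "'a measure \<Rightarrow> (nat \<Rightarrow> 'a set) \<Rightarrow> bool" where
  "localizing_seq M B \<longleftrightarrow> range B \<subseteq> sets M \<and> incseq B \<and> (\<Union>n. B n) = space M"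

definition local_sets :: "'a measure \<Rightarrow> (nat \<Rightarrow> 'a set) \<Rightarrow> 'a set set" where
  "local_sets M B = {A \<inter> B n | A n. A \<in> sets M}"

text \<open>Below, \<open>M\<close> only contributes its \<open>\<sigma>\<close>-field. A measure on the space is an element of type
  \<^typ>\<open>'a measure\<close> with the same measurable sets as \<open>M\<close>.\<close>

definition locally_finite :: "'a measure \<Rightarrow> (nat \<Rightarrow> 'a set) \<Rightarrow> 'a measure \<Rightarrow> bool" where
  "locally_finite M B \<nu> \<longleftrightarrow> sets \<nu> = sets M \<and> (\<forall>A\<in>local_sets M B. emeasure \<nu> A < \<infinity>)"

definition diffuse :: "'a measure \<Rightarrow> bool" where
  "diffuse \<nu> \<longleftrightarrow> (\<forall>x\<in>space \<nu>. emeasure \<nu> {x} = 0)"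

definition counting_measures :: "'a measure \<Rightarrow> (nat \<Rightarrow> 'a set) \<Rightarrow> 'a measure set" where
  "counting_measures M B =
    {\<mu>. sets \<mu> = sets M \<and> (\<forall>A\<in>local_sets M B. \<exists>k::nat. emeasure \<mu> A = of_nat k)}"

text \<open>The measurable space of counting measures, built in the same way as
  \<^const>\<open>subprob_algebra\<close>: the smallest \<open>\<sigma>\<close>-field making all evaluations measurable.\<close>

definition counting_space :: "'a measure \<Rightarrow> (nat \<Rightarrow> 'a set) \<Rightarrow> 'a measure measure" where
  "counting_space M B =
    (SUP A \<in> sets M. vimage_algebra (counting_measures M B) (\<lambda>\<mu>. emeasure \<mu> A) borel)"

definition restr :: "'a measure \<Rightarrow> 'a set \<Rightarrow> 'a measure" where
  "restr \<nu> A = density \<nu> (indicator A)"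

definition add_measure :: "'a measure \<Rightarrow> 'a measure \<Rightarrow> 'a measure" where
  "add_measure \<mu> \<nu> = measure_of (space \<mu>) (sets \<mu>) (\<lambda>A. emeasure \<mu> A + emeasure \<nu> A)"

lemma sets_restr [simp]: "sets (restr \<nu> A) = sets \<nu>"
  by (simp add: restr_def)

lemma emeasure_restr:
  "A \<in> sets \<nu> \<Longrightarrow> C \<in> sets \<nu> \<Longrightarrow> emeasure (restr \<nu> A) C = emeasure \<nu> (C \<inter> A)"
  by (simp add: restr_def emeasure_restricted Int_commute)

lemma sets_add_measure [simp]: "sets (add_measure \<mu> \<nu>) = sets \<mu>"
  by (simp add: add_measure_def sets.sigma_sets_eq)

lemma emeasure_add_measure:
  assumes "sets \<nu> = sets \<mu>"
  shows "emeasure (add_measure \<mu> \<nu>) A = emeasure \<mu> A + emeasure \<nu> A"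
proof (cases "A \<in> sets \<mu>")
  case True
  show ?thesis
  proof (rule emeasure_measure_of[OF add_measure_def])
    show "sets \<mu> \<subseteq> Pow (space \<mu>)" by (rule sets.space_closed)
    show "positive (sets (add_measure \<mu> \<nu>)) (\<lambda>A. emeasure \<mu> A + emeasure \<nu> A)"
      by (simp add: positive_def)
    show "countably_additive (sets (add_measure \<mu> \<nu>)) (\<lambda>A. emeasure \<mu> A + emeasure \<nu> A)"
      by (auto simp: countably_additive_def assms suminf_add[symmetric] suminf_emeasure)
    show "A \<in> sets (add_measure \<mu> \<nu>)" using True by simp
  qed
next
  case False
  then show ?thesis by (simp add: emeasure_notin_sets assms)
qed

lemma space_counting_space: "space (counting_space M B) = counting_measures M B"
  unfolding counting_space_def by (subst space_Sup_eq_UN) auto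

lemma sets_counting_space:
  "sets (counting_space M B) = sigma_sets (counting_measures M B)
     {{\<mu>\<in>counting_measures M B. emeasure \<mu> A \<in> S} | A S. A \<in> sets M \<and> S \<in> sets borel}"
  unfolding counting_space_def
  apply (subst sets_Sup_eq[where X = "counting_measures M B"])
    apply auto[1]
   apply (use sets.top in blast)
  apply (rule arg_cong2[where f = sigma_sets])
   apply simp
  apply (auto simp: sets_vimage_algebra2 vimage_def Int_def conj_commute; blast)
  done

text \<open>Law of a Poisson variable with mean in \<open>[0, \<infinity>]\<close>; \<^const>\<open>poisson_pmf\<close> requires a positive rate.
  As usual, mean \<open>0\<close> and mean \<open>\<infinity>\<close> give the constants \<open>0\<close> and \<open>\<infinity>\<close>.\<close>

definition poisson_law :: "ennreal \<Rightarrow> ennreal measure" where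
  "poisson_law c =
    (if c = 0 \<or> c = \<infinity> then return borel c
     else distr (measure_pmf (poisson_pmf (enn2real c))) borel of_nat)"

definition poisson_process ::
  "'w measure \<Rightarrow> 'a measure \<Rightarrow> (nat \<Rightarrow> 'a set) \<Rightarrow> 'a measure \<Rightarrow> ('w \<Rightarrow> 'a measure) \<Rightarrow> bool" where
  "poisson_process P M B \<Lambda> \<eta> \<longleftrightarrow>
    \<eta> \<in> measurable P (counting_space M B) \<and>
    (\<forall>A\<in>sets M. distr P borel (\<lambda>\<omega>. emeasure (\<eta> \<omega>) A) = poisson_law (emeasure \<Lambda> A)) \<and>
    (\<forall>(m::nat) C. (\<forall>i<m. C i \<in> sets M) \<longrightarrow> disjoint_family_on C {..<m} \<longrightarrow>
       prob_space.indep_vars P (\<lambda>_. borel) (\<lambda>i \<omega>. emeasure (\<eta> \<omega>) (C i)) {..<m})"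

definition stopping_set ::
  "'a measure \<Rightarrow> (nat \<Rightarrow> 'a set) \<Rightarrow> ('a measure \<Rightarrow> 'a set) \<Rightarrow> bool" where
  "stopping_set M B Z \<longleftrightarrow>
    (\<forall>\<mu>\<in>counting_measures M B. Z \<mu> \<in> sets M) \<and>
    Measurable.pred (M \<Otimes>\<^sub>M counting_space M B) (\<lambda>(x, \<mu>). x \<in> Z \<mu>) \<and>
    (\<forall>\<mu>\<in>counting_measures M B. \<forall>\<psi>\<in>counting_measures M B.
       Z \<mu> = Z (add_measure (restr \<mu> (Z \<mu>)) (restr \<psi> (space M - Z \<mu>))))"

text \<open>The time parameter ranges over the nonnegative reals; values at negative times are irrelevant.\<close>

definition ctdt ::
  "'w measure \<Rightarrow> 'a measure \<Rightarrow> (nat \<Rightarrow> 'a set) \<Rightarrow> 'a measure \<Rightarrow> ('w \<Rightarrow> 'a measure) \<Rightarrow>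
    (real \<Rightarrow> 'a measure \<Rightarrow> 'a set) \<Rightarrow> bool" where
  "ctdt P M B \<Lambda> \<eta> Z \<longleftrightarrow>
    (\<forall>t\<ge>0. stopping_set M B (Z t)) \<and>
    (\<forall>t\<ge>0. \<forall>\<mu>\<in>counting_measures M B. Z t \<mu> \<in> local_sets M B) \<and>
    (\<integral>\<^sup>+\<omega>. emeasure \<Lambda> (Z 0 (\<eta> \<omega>)) \<partial>P) = 0 \<and>
    (\<forall>\<mu>\<in>counting_measures M B. \<forall>s t. 0 \<le> s \<longrightarrow> s \<le> t \<longrightarrow> Z s \<mu> \<subseteq> Z t \<mu>) \<and>
    (\<forall>\<mu>\<in>counting_measures M B. \<forall>t\<ge>0. Z t \<mu> = (\<Inter>s\<in>{t<..}. Z s \<mu>))"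

text \<open>For \<open>t = 0\<close> the union is empty, in accordance with the convention \<open>Z\<^sub>0\<^sub>- = {}\<close>.\<close>

definition left_lim :: "(real \<Rightarrow> 'a measure \<Rightarrow> 'a set) \<Rightarrow> real \<Rightarrow> 'a measure \<Rightarrow> 'a set" where
  "left_lim Z t \<mu> = (\<Union>s\<in>{0..<t}. Z s \<mu>)"

definition Z_infty :: "(real \<Rightarrow> 'a measure \<Rightarrow> 'a set) \<Rightarrow> 'a measure \<Rightarrow> 'a set" where
  "Z_infty Z \<mu> = (\<Union>t\<in>{0..}. Z t \<mu>)"

definition zeta ::
  "'a measure \<Rightarrow> (real \<Rightarrow> 'a measure \<Rightarrow> 'a set) \<Rightarrow> real \<Rightarrow> 'a measure \<Rightarrow> 'a measure \<Rightarrow> 'a measure" where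
  "zeta M Z t \<mu> \<mu>' =
    add_measure (add_measure (restr \<mu> (Z_infty Z \<mu> - Z t \<mu>)) (restr \<mu>' (Z t \<mu>)))
      (restr \<mu>' (space M - Z_infty Z \<mu>))"

definition tendsto_in_prob :: "'w measure \<Rightarrow> (real \<Rightarrow> 'w \<Rightarrow> real) \<Rightarrow> ('w \<Rightarrow> real) \<Rightarrow> bool" where
  "tendsto_in_prob P X Y \<longleftrightarrow>
    (\<forall>\<epsilon>>0. ((\<lambda>t. measure P {\<omega>\<in>space P. \<epsilon> < \<bar>X t \<omega> - Y \<omega>\<bar>}) \<longlongrightarrow> 0) at_top)"

definition diff_op :: "'a measure \<Rightarrow> 'a \<Rightarrow> ('a measure \<Rightarrow> real) \<Rightarrow> 'a measure \<Rightarrow> real" where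
  "diff_op M x f \<mu> = f (add_measure \<mu> (return M x)) - f \<mu>"

end

(*
  Sample eta' on the part of the space explored up to time t, keeping eta on the part of Z that is
  explored later. This path of configurations leads from (a version with the same value of f as) eta
  at time 0 to eta' as t tends to infinity, and by (3) and (4) it changes only at the discovery of a
  single point x of eta (which is then removed) or of eta' (which is then added). Each change of f is
  |D_x f| at a configuration A x, so the Mecke equation turns the expected total variation into twice
  the integral of E[1{x in Z(eta)} |D_x f(A x)|] over lambda. Given what has been explored up to the
  discovery of x, the configuration A x is again a Poisson process, so this expectation factorises.

  The last fact is proved without conditioning. For stopping sets V and U with V inside U let
  zeta_U equal eta on U - V and eta' elsewhere. By the Mecke equation for eta and eta', adding a point
  to zeta_U (on the event x in V) amounts to replacing U by another stopping set that contains V.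
  Hence the factorial moments of zeta_U on this event are, uniformly in U, those of a Poisson process.
*)

theory Submission
  imports Defs
begin

section \<open>Measurability on the space of counting measures\<close>

text \<open>The obstacle is that the exploration depends on the configuration being explored. For a
  point x of eta', the explored regions are those of eta and unaffected by x. For a point x of eta,
  the Mecke equation adds x to eta itself, and the exploration then runs on eta + delta_x. Seen as
  functions of eta, the regions are still stopping sets, but other ones; hence the law of the glued
  process is established for arbitrary nested pairs. The factor 2 is one equal contribution from
  each process. Conditions (3) and (4) have separate tasks. By (3) the region found at the same
  moment as a given point is null, so Mecke and Fubini show that no point of eta' is found together
  with another point of eta or eta'. Two points of eta escape this argument, because the exploration
  may react to both; they are left to (4). The Borel structure turns a unit mass into a single
  measurable point, so that a jump of the path is a difference operator. All expectations are
  extended nonnegative integrals, and the limit in time is taken through truncated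
  differences.\<close>

locale localized_space =
  fixes M :: "'a measure" and B :: "nat \<Rightarrow> 'a set"
  assumes localizing: "localizing_seq M B"
begin

abbreviation N :: "'a measure measure" where "N \<equiv> counting_space M B"
abbreviation L :: "'a set set" where "L \<equiv> local_sets M B"

lemma B_sets [measurable]: "B n \<in> sets M"
  and incseq_B: "incseq B"
  and UN_B: "(\<Union>n. B n) = space M"
  using localizing by (auto simp: localizing_seq_def)

lemma mem_L_iff: "A \<in> L \<longleftrightarrow> A \<in> sets M \<and> (\<exists>n. A \<subseteq> B n)"
  by (auto simp: local_sets_def)

lemma L_sets: "A \<in> L \<Longrightarrow> A \<in> sets M"
  by (simp add: mem_L_iff)

lemma B_in_L: "B n \<in> L"
  by (auto simp: mem_L_iff)

lemma L_subset: "A \<in> L \<Longrightarrow> C \<in> sets M \<Longrightarrow> C \<subseteq> A \<Longrightarrow> C \<in> L"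
  by (auto simp: mem_L_iff)

lemma L_Un: "A \<in> L \<Longrightarrow> C \<in> L \<Longrightarrow> A \<union> C \<in> L"
proof -
  assume "A \<in> L" "C \<in> L"
  then obtain m n where mn: "A \<subseteq> B m" "C \<subseteq> B n" "A \<in> sets M" "C \<in> sets M"
    unfolding mem_L_iff by blast
  have "B m \<subseteq> B (max m n)" "B n \<subseteq> B (max m n)"
    by (simp_all add: incseqD[OF incseq_B])
  with mn show ?thesis
    unfolding mem_L_iff by (intro conjI exI[of _ "max m n"]) auto
qed

lemma L_Union:
  assumes "finite \<C>" "\<C> \<subseteq> L"
  shows "\<Union>\<C> \<in> L"
  using assms
proof (induction rule: finite_induct)
  case empty
  then show ?case by (simp add: mem_L_iff)
next
  case (insert A \<C>)
  then show ?case by (simp add: L_Un)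
qed

lemma N_sets [simp]: "\<mu> \<in> space N \<Longrightarrow> sets \<mu> = sets M"
  by (simp add: space_counting_space counting_measures_def)

lemma N_space [simp]: "\<mu> \<in> space N \<Longrightarrow> space \<mu> = space M"
  by (rule sets_eq_imp_space_eq) simp

lemma N_nat: "\<mu> \<in> space N \<Longrightarrow> A \<in> L \<Longrightarrow> \<exists>k::nat. emeasure \<mu> A = of_nat k"
  unfolding space_counting_space counting_measures_def by blast

lemma N_finite: "\<mu> \<in> space N \<Longrightarrow> A \<in> L \<Longrightarrow> emeasure \<mu> A < \<infinity>"
  using N_nat[of \<mu> A] by (auto simp: of_nat_less_top)

lemma in_N_I:
  assumes "sets \<mu> = sets M" "\<And>A. A \<in> L \<Longrightarrow> \<exists>k::nat. emeasure \<mu> A = of_nat k"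
  shows "\<mu> \<in> space N"
  using assms unfolding space_counting_space counting_measures_def by blast

lemma emeasure_eq_SUP_B:
  assumes "sets \<mu> = sets M" "A \<in> sets M"
  shows "emeasure \<mu> A = (SUP n. emeasure \<mu> (A \<inter> B n))"
proof -
  have "emeasure \<mu> (\<Union>n. A \<inter> B n) = (SUP n. emeasure \<mu> (A \<inter> B n))"
    using assms incseq_B by (intro SUP_emeasure_incseq[symmetric]) (auto simp: incseq_def)
  moreover have "(\<Union>n. A \<inter> B n) = A"
    using UN_B sets.sets_into_space[OF assms(2)] by auto
  ultimately show ?thesis by simp
qed

section \<open>Masses and integrals along a kernel of counting measures\<close>

lemma measurable_emeasure_N [measurable]: "A \<in> sets M \<Longrightarrow> (\<lambda>\<mu>. emeasure \<mu> A) \<in> borel_measurable N"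
  by (rule measurableI) (auto simp: sets_counting_space space_counting_space vimage_def Int_def
      conj_commute intro!: sigma_sets.Basic)

lemma measurable_N_I:
  assumes "\<And>\<omega>. \<omega> \<in> space \<Omega> \<Longrightarrow> K \<omega> \<in> space N"
    and "\<And>A. A \<in> sets M \<Longrightarrow> (\<lambda>\<omega>. emeasure (K \<omega>) A) \<in> borel_measurable \<Omega>"
  shows "K \<in> measurable \<Omega> N"
proof (rule measurable_sigma_sets[OF sets_counting_space])
  show "K \<in> space \<Omega> \<rightarrow> counting_measures M B"
    using assms(1) by (simp add: space_counting_space)
  fix Y assume "Y \<in> {{\<mu>\<in>counting_measures M B. emeasure \<mu> A \<in> S} | A S. A \<in> sets M \<and> S \<in> sets borel}"
  then obtain A S where *: "A \<in> sets M" "S \<in> sets borel" "Y = {\<mu>\<in>counting_measures M B. emeasure \<mu> A \<in> S}"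
    by auto
  have "K -` Y \<inter> space \<Omega> = (\<lambda>\<omega>. emeasure (K \<omega>) A) -` S \<inter> space \<Omega>"
    using assms(1) by (auto simp: * space_counting_space)
  also have "\<dots> \<in> sets \<Omega>"
    using assms(2) * by auto
  finally show "K -` Y \<inter> space \<Omega> \<in> sets \<Omega>" .
qed auto

text \<open>The cut by \<open>B n\<close> keeps all masses finite, so that the complement step of
  the Dynkin argument may subtract. It is removed afterwards by a monotone limit.\<close>

lemma measurable_emeasure_kernel_local:
  assumes K [measurable]: "K \<in> measurable \<Omega> N" and G: "G \<in> sets (\<Omega> \<Otimes>\<^sub>M M)"
  shows "(\<lambda>\<omega>. emeasure (K \<omega>) (Pair \<omega> -` G \<inter> B n)) \<in> borel_measurable \<Omega>"
  using Int_stable_pair_measure_generator pair_measure_closed G unfolding sets_pair_measure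
proof (induct rule: sigma_sets_induct_disjoint)
  case (basic G)
  then obtain X Y where *[measurable]: "X \<in> sets \<Omega>" "Y \<in> sets M" and "G = X \<times> Y" by auto
  then have "emeasure (K \<omega>) (Pair \<omega> -` G \<inter> B n) = indicator X \<omega> * emeasure (K \<omega>) (Y \<inter> B n)" for \<omega>
    by (simp split: split_indicator)
  then show ?case by simp
next
  case (compl G)
  have G: "G \<in> sets (\<Omega> \<Otimes>\<^sub>M M)"
    using compl by (simp add: sets_pair_measure)
  have eq: "emeasure (K \<omega>) (Pair \<omega> -` (space \<Omega> \<times> space M - G) \<inter> B n) =
      emeasure (K \<omega>) (B n) - emeasure (K \<omega>) (Pair \<omega> -` G \<inter> B n)" if \<omega>: "\<omega> \<in> space \<Omega>" for \<omega>
  proof -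
    have K: "K \<omega> \<in> space N" using \<omega> by (rule measurable_space[OF K])
    have S: "Pair \<omega> -` G \<inter> B n \<in> L"
      using sets_Pair1[OF G] by (intro L_subset[OF B_in_L]) auto
    have "Pair \<omega> -` (space \<Omega> \<times> space M - G) \<inter> B n = B n - (Pair \<omega> -` G \<inter> B n)"
      using \<omega> sets.sets_into_space[OF B_sets[of n]] by auto
    then show ?thesis
      using S K N_finite[OF K S] by (simp add: emeasure_Diff L_sets less_top)
  qed
  then show ?case
    using compl by (simp add: measurable_cong[OF eq])
next
  case (union G)
  have G: "G i \<in> sets (\<Omega> \<Otimes>\<^sub>M M)" for i
    using union by (auto simp: sets_pair_measure)
  have eq: "emeasure (K \<omega>) (Pair \<omega> -` (\<Union>i. G i) \<inter> B n) = (\<Sum>i. emeasure (K \<omega>) (Pair \<omega> -` G i \<inter> B n))"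
    if \<omega>: "\<omega> \<in> space \<Omega>" for \<omega>
  proof -
    have K: "K \<omega> \<in> space N" using \<omega> by (rule measurable_space[OF K])
    have "Pair \<omega> -` (\<Union>i. G i) \<inter> B n = (\<Union>i. Pair \<omega> -` G i \<inter> B n)" by auto
    then show ?thesis
      using union(1) sets_Pair1[OF G] K
      by (subst suminf_emeasure) (auto simp: disjoint_family_on_def)
  qed
  then show ?case
    using union by (simp add: measurable_cong[OF eq])
qed simp

lemma measurable_emeasure_kernel:
  assumes K: "K \<in> measurable \<Omega> N" and G: "G \<in> sets (\<Omega> \<Otimes>\<^sub>M M)"
  shows "(\<lambda>\<omega>. emeasure (K \<omega>) (Pair \<omega> -` G)) \<in> borel_measurable \<Omega>"
proof -
  have eq: "emeasure (K \<omega>) (Pair \<omega> -` G) = (SUP n. emeasure (K \<omega>) (Pair \<omega> -` G \<inter> B n))"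
    if "\<omega> \<in> space \<Omega>" for \<omega>
    using measurable_space[OF K that] sets_Pair1[OF G] by (intro emeasure_eq_SUP_B) auto
  then show ?thesis
    using measurable_emeasure_kernel_local[OF K G] by (simp add: measurable_cong[OF eq])
qed

lemma measurable_nn_integral_kernel:
  assumes h: "(\<lambda>(\<omega>, x). h \<omega> x) \<in> borel_measurable (\<Omega> \<Otimes>\<^sub>M M)" and K: "K \<in> measurable \<Omega> N"
  shows "(\<lambda>\<omega>. \<integral>\<^sup>+x. h \<omega> x \<partial>K \<omega>) \<in> borel_measurable \<Omega>"
proof -
  have sp: "space (K \<omega>) = space M" and st: "sets (K \<omega>) = sets M" if "\<omega> \<in> space \<Omega>" for \<omega>
    using measurable_space[OF K that] by auto
  have mb: "(\<lambda>x. u (\<omega>, x)) \<in> borel_measurable (K \<omega>)"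
    if "u \<in> borel_measurable (\<Omega> \<Otimes>\<^sub>M M)" "\<omega> \<in> space \<Omega>" for u \<omega>
    using that st[of \<omega>] by (simp cong: measurable_cong_sets)
  have "(\<lambda>\<omega>. \<integral>\<^sup>+x. case_prod h (\<omega>, x) \<partial>K \<omega>) \<in> borel_measurable \<Omega>"
    using h
  proof (induct rule: borel_measurable_induct)
    case (cong f g)
    have eq: "(\<integral>\<^sup>+x. f (\<omega>, x) \<partial>K \<omega>) = (\<integral>\<^sup>+x. g (\<omega>, x) \<partial>K \<omega>)" if "\<omega> \<in> space \<Omega>" for \<omega>
      using that cong sp[OF that] by (intro nn_integral_cong) (simp add: space_pair_measure)
    then show ?case using cong by (simp add: measurable_cong[OF eq])
  next
    case (set G)
    have eq: "(\<integral>\<^sup>+x. indicator G (\<omega>, x) \<partial>K \<omega>) = emeasure (K \<omega>) (Pair \<omega> -` G)" if "\<omega> \<in> space \<Omega>" for \<omega>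
    proof -
      have "(\<lambda>x. indicator G (\<omega>, x)) = (indicator (Pair \<omega> -` G) :: 'a \<Rightarrow> ennreal)"
        by (auto simp: indicator_def)
      then show ?thesis
        using st[OF that] sets_Pair1[OF set] by simp
    qed
    then show ?case
      using measurable_emeasure_kernel[OF K set] by (simp add: measurable_cong[OF eq])
  next
    case (mult u c)
    have eq: "(\<integral>\<^sup>+x. c * u (\<omega>, x) \<partial>K \<omega>) = c * (\<integral>\<^sup>+x. u (\<omega>, x) \<partial>K \<omega>)" if "\<omega> \<in> space \<Omega>" for \<omega>
      using mb[OF mult(2) that] by (rule nn_integral_cmult)
    show ?case using mult(4) by (simp add: measurable_cong[OF eq])
  next
    case (add u v)
    note eq = nn_integral_add[OF mb[OF add(4)] mb[OF add(1)]]
    show ?case using add(3,7) by (simp add: measurable_cong[OF eq])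
  next
    case (seq U)
    have eq: "(\<integral>\<^sup>+x. (SUP i. U i) (\<omega>, x) \<partial>K \<omega>) = (SUP i. \<integral>\<^sup>+x. U i (\<omega>, x) \<partial>K \<omega>)"
      if "\<omega> \<in> space \<Omega>" for \<omega>
    proof -
      have "(\<integral>\<^sup>+x. (SUP i. U i (\<omega>, x)) \<partial>K \<omega>) = (SUP i. \<integral>\<^sup>+x. U i (\<omega>, x) \<partial>K \<omega>)"
        using mb[OF seq(1) that] \<open>incseq U\<close>
        by (intro nn_integral_monotone_convergence_SUP) (auto simp: incseq_def le_fun_def)
      then show ?thesis by (simp add: SUP_apply image_comp)
    qed
    show ?case using seq(3) by (subst measurable_cong[OF eq]) auto
  qed
  then show ?thesis by simp
qed

section \<open>Restriction, superposition and point masses\<close>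

lemma restr_in_N:
  assumes "\<mu> \<in> space N" "S \<in> sets M" shows "restr \<mu> S \<in> space N"
proof (rule in_N_I)
  fix A assume A: "A \<in> L"
  then have "A \<inter> S \<in> L" using assms(2) by (intro L_subset[OF A]) (auto simp: L_sets)
  from N_nat[OF assms(1) this] show "\<exists>k::nat. emeasure (restr \<mu> S) A = of_nat k"
    using assms A by (simp add: emeasure_restr L_sets)
qed (use assms in simp)

lemma add_in_N:
  assumes "\<mu> \<in> space N" "\<nu> \<in> space N" shows "add_measure \<mu> \<nu> \<in> space N"
proof (rule in_N_I)
  fix A assume A: "A \<in> L"
  obtain k l :: nat where "emeasure \<mu> A = of_nat k" "emeasure \<nu> A = of_nat l"
    using N_nat[OF assms(1) A] N_nat[OF assms(2) A] by auto
  then have "emeasure (add_measure \<mu> \<nu>) A = of_nat (k + l)"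
    using assms by (simp add: emeasure_add_measure)
  then show "\<exists>k::nat. emeasure (add_measure \<mu> \<nu>) A = of_nat k" ..
qed (use assms in simp)

lemma return_in_N: "return M x \<in> space N"
proof (rule in_N_I)
  fix A assume "A \<in> L"
  then have "emeasure (return M x) A = of_nat (if x \<in> A then 1 else 0)"
    by (simp add: L_sets)
  then show "\<exists>k::nat. emeasure (return M x) A = of_nat k" ..
qed simp

lemma measurable_restr:
  assumes K: "K \<in> measurable \<Omega> N" and S: "Measurable.pred (\<Omega> \<Otimes>\<^sub>M M) (\<lambda>(\<omega>, x). x \<in> S \<omega>)"
    and S_sets: "\<And>\<omega>. \<omega> \<in> space \<Omega> \<Longrightarrow> S \<omega> \<in> sets M"
  shows "(\<lambda>\<omega>. restr (K \<omega>) (S \<omega>)) \<in> measurable \<Omega> N"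
proof (rule measurable_N_I)
  fix \<omega> assume "\<omega> \<in> space \<Omega>"
  then show "restr (K \<omega>) (S \<omega>) \<in> space N"
    using measurable_space[OF K] S_sets by (intro restr_in_N) auto
next
  fix A assume A [measurable]: "A \<in> sets M"
  have G: "{z \<in> space (\<Omega> \<Otimes>\<^sub>M M). (case z of (\<omega>, x) \<Rightarrow> x \<in> S \<omega>) \<and> snd z \<in> A} \<in> sets (\<Omega> \<Otimes>\<^sub>M M)"
    using S by measurable
  have eq: "emeasure (restr (K \<omega>) (S \<omega>)) A =
      emeasure (K \<omega>) (Pair \<omega> -` {z \<in> space (\<Omega> \<Otimes>\<^sub>M M). (case z of (\<omega>, x) \<Rightarrow> x \<in> S \<omega>) \<and> snd z \<in> A})"
    if \<omega>: "\<omega> \<in> space \<Omega>" for \<omega>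
  proof -
    have "A \<inter> S \<omega> = Pair \<omega> -` {z \<in> space (\<Omega> \<Otimes>\<^sub>M M). (case z of (\<omega>, x) \<Rightarrow> x \<in> S \<omega>) \<and> snd z \<in> A}"
      using \<omega> sets.sets_into_space[OF A] by (auto simp: space_pair_measure)
    then show ?thesis
      using measurable_space[OF K \<omega>] S_sets[OF \<omega>] by (simp add: emeasure_restr)
  qed
  then show "(\<lambda>\<omega>. emeasure (restr (K \<omega>) (S \<omega>)) A) \<in> borel_measurable \<Omega>"
    using measurable_emeasure_kernel[OF K G] by (simp add: measurable_cong[OF eq])
qed

lemma measurable_add_measure [measurable (raw)]:
  assumes K: "K \<in> measurable \<Omega> N" "K' \<in> measurable \<Omega> N"
  shows "(\<lambda>\<omega>. add_measure (K \<omega>) (K' \<omega>)) \<in> measurable \<Omega> N"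
proof (rule measurable_N_I)
  fix \<omega> assume "\<omega> \<in> space \<Omega>"
  then show "add_measure (K \<omega>) (K' \<omega>) \<in> space N"
    using K[THEN measurable_space] by (intro add_in_N)
next
  fix A assume A: "A \<in> sets M"
  have eq: "emeasure (add_measure (K \<omega>) (K' \<omega>)) A = emeasure (K \<omega>) A + emeasure (K' \<omega>) A"
    if \<omega>: "\<omega> \<in> space \<Omega>" for \<omega>
    using K[THEN measurable_space, OF \<omega>] by (simp add: emeasure_add_measure)
  moreover have "(\<lambda>\<omega>. emeasure (K \<omega>) A + emeasure (K' \<omega>) A) \<in> borel_measurable \<Omega>"
    using K[THEN measurable_compose, OF measurable_emeasure_N[OF A]] by simp
  ultimately show "(\<lambda>\<omega>. emeasure (add_measure (K \<omega>) (K' \<omega>)) A) \<in> borel_measurable \<Omega>"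
    by (simp add: measurable_cong[OF eq])
qed

lemma measurable_return_N: "return M \<in> measurable M N"
  by (rule measurable_N_I) (auto simp: return_in_N measurable_cong[OF emeasure_return])

lemma measurable_return_N' [measurable (raw)]:
  "g \<in> measurable \<Omega> M \<Longrightarrow> (\<lambda>\<omega>. return M (g \<omega>)) \<in> measurable \<Omega> N"
  by (rule measurable_compose[OF _ measurable_return_N])

lemma nn_integral_add_measure:
  assumes "sets \<mu> = sets M" "sets \<nu> = sets M" "h \<in> borel_measurable M"
  shows "(\<integral>\<^sup>+x. h x \<partial>add_measure \<mu> \<nu>) = (\<integral>\<^sup>+x. h x \<partial>\<mu>) + (\<integral>\<^sup>+x. h x \<partial>\<nu>)"
proof -
  have sp: "space \<mu> = space M" "space \<nu> = space M" "space (add_measure \<mu> \<nu>) = space M"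
    using assms by (auto intro!: sets_eq_imp_space_eq)
  have mb: "u \<in> borel_measurable \<mu>" "u \<in> borel_measurable \<nu>" "u \<in> borel_measurable (add_measure \<mu> \<nu>)"
    if "u \<in> borel_measurable M" for u :: "'a \<Rightarrow> ennreal"
    using that assms by (simp_all cong: measurable_cong_sets)
  show ?thesis
    using assms(3)
  proof (induct rule: borel_measurable_induct)
    case (cong f g)
    then have "(\<integral>\<^sup>+x. f x \<partial>\<kappa>) = (\<integral>\<^sup>+x. g x \<partial>\<kappa>)" if "space \<kappa> = space M" for \<kappa>
      using that by (intro nn_integral_cong) simp
    with cong sp show ?case by simp
  next
    case (set A)
    then show ?case using assms by (simp add: emeasure_add_measure)
  next
    case (mult u c)
    then show ?case by (simp add: nn_integral_cmult mb distrib_left)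
  next
    case (add u v)
    then show ?case by (simp add: nn_integral_add mb ac_simps)
  next
    case (seq U)
    have inc: "incseq (\<lambda>i. \<integral>\<^sup>+x. U i x \<partial>\<kappa>)" for \<kappa>
      using \<open>incseq U\<close> by (auto simp: incseq_def le_fun_def intro!: nn_integral_mono)
    have *: "(\<integral>\<^sup>+x. (SUP i. U i) x \<partial>\<kappa>) = (SUP i. \<integral>\<^sup>+x. U i x \<partial>\<kappa>)"
      if "\<And>i. U i \<in> borel_measurable \<kappa>" for \<kappa>
      using nn_integral_monotone_convergence_SUP[OF \<open>incseq U\<close> that] by (simp add: SUP_apply image_comp)
    have "(\<integral>\<^sup>+x. (SUP i. U i) x \<partial>add_measure \<mu> \<nu>) = (SUP i. \<integral>\<^sup>+x. U i x \<partial>add_measure \<mu> \<nu>)"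
      by (rule *) (simp add: mb seq(1))
    also have "\<dots> = (SUP i. (\<integral>\<^sup>+x. U i x \<partial>\<mu>) + (\<integral>\<^sup>+x. U i x \<partial>\<nu>))"
      by (simp only: seq(3))
    also have "\<dots> = (SUP i. \<integral>\<^sup>+x. U i x \<partial>\<mu>) + (SUP i. \<integral>\<^sup>+x. U i x \<partial>\<nu>)"
      by (rule ennreal_SUP_add[OF inc inc])
    also have "\<dots> = (\<integral>\<^sup>+x. (SUP i. U i) x \<partial>\<mu>) + (\<integral>\<^sup>+x. (SUP i. U i) x \<partial>\<nu>)"
      by (subst (1 2) *) (simp_all add: mb seq(1))
    finally show ?case .
  qed
qed

lemma nn_integral_restr:
  assumes "sets \<mu> = sets M" "S \<in> sets M" "h \<in> borel_measurable M"
  shows "(\<integral>\<^sup>+x. h x \<partial>restr \<mu> S) = (\<integral>\<^sup>+x. indicator S x * h x \<partial>\<mu>)"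
  unfolding restr_def using assms
  by (subst nn_integral_density) (auto cong: measurable_cong_sets)

end

section \<open>Uniqueness of laws of point processes\<close>

context localized_space
begin

text \<open>Two families of events are needed. Over disjoint cells, a Poisson process gives
  \<open>cyl\<close> a product probability; stability under intersection, however, requires
  overlapping sets, which \<open>constrained\<close> admits.\<close>

definition cyl :: "'a set set \<Rightarrow> ('a set \<Rightarrow> nat) \<Rightarrow> 'a measure set" where
  "cyl \<C> n = {\<mu>\<in>space N. \<forall>C\<in>\<C>. emeasure \<mu> C = of_nat (n C)}"

text \<open>\<open>R\<close> is a relation and not a function: a set may carry two different counts,
  and the event is then empty. In this way the intersection of two events corresponds to the union
  of their relations.\<close>

definition constrained :: "('a set \<times> nat) set \<Rightarrow> 'a measure set" where
  "constrained R = {\<mu>\<in>space N. \<forall>(F, k)\<in>R. emeasure \<mu> F = of_nat k}"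

lemma cyl_sets [measurable]:
  assumes "finite \<C>" "\<C> \<subseteq> L" shows "cyl \<C> n \<in> sets N"
  unfolding cyl_def
proof (rule sets.sets_Collect_finite_All[OF _ assms(1)])
  fix C assume "C \<in> \<C>"
  then have [measurable]: "C \<in> sets M" using assms L_sets by auto
  show "{\<mu>\<in>space N. emeasure \<mu> C = of_nat (n C)} \<in> sets N"
    by measurable
qed

lemma constrained_sets:
  assumes "finite R" "fst ` R \<subseteq> L" shows "constrained R \<in> sets N"
  unfolding constrained_def
proof (rule sets.sets_Collect_finite_All[OF _ assms(1)])
  fix Fk assume "Fk \<in> R"
  then have [measurable]: "fst Fk \<in> sets M" using assms L_sets by auto
  show "{\<mu>\<in>space N. case Fk of (F, k) \<Rightarrow> emeasure \<mu> F = of_nat k} \<in> sets N"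
    unfolding case_prod_beta by measurable
qed

text \<open>Counts on local sets are natural numbers, so the preimage of any set of values is a
  countable union of count events; all other masses are suprema of local ones.\<close>

lemma sets_N_eq_constrained:
  "sets N = sigma_sets (space N) {constrained R | R. finite R \<and> fst ` R \<subseteq> L}" (is "_ = sigma_sets _ ?G")
proof
  have G: "?G \<subseteq> Pow (space N)" by (auto simp: constrained_def)
  let ?N = "sigma (space N) ?G"
  have local: "(\<lambda>\<mu>. emeasure \<mu> A) \<in> borel_measurable ?N" if A: "A \<in> L" for A
  proof (rule measurableI)
    fix S :: "ennreal set"
    have "(\<lambda>\<mu>. emeasure \<mu> A) -` S \<inter> space ?N = (\<Union>k\<in>{k. of_nat k \<in> S}. constrained {(A, k)})"
    proof safe
      fix \<mu> assume \<mu>: "\<mu> \<in> space ?N" "emeasure \<mu> A \<in> S"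
      then have \<mu>N: "\<mu> \<in> space N" by (simp only: space_measure_of_conv)
      obtain k :: nat where k: "emeasure \<mu> A = of_nat k"
        using N_nat[OF \<mu>N A] by blast
      have "\<mu> \<in> constrained {(A, k)}"
        using \<mu>N k by (simp add: constrained_def)
      with \<mu>(2) k show "\<mu> \<in> (\<Union>k\<in>{k. of_nat k \<in> S}. constrained {(A, k)})"
        by (intro UN_I[of k]) simp_all
    qed (simp_all add: constrained_def space_measure_of_conv)
    also have "\<dots> \<in> sets ?N"
    proof (rule sets.countable_UN'')
      fix k
      have "constrained {(A, k)} \<in> ?G"
        using A by (intro CollectI exI[of _ "{(A, k)}"]) simp
      with G show "constrained {(A, k)} \<in> sets ?N" by (rule in_measure_of)
    qed simp
    finally show "(\<lambda>\<mu>. emeasure \<mu> A) -` S \<inter> space ?N \<in> sets ?N" .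
  qed simp
  have "(\<lambda>\<mu>. \<mu>) \<in> measurable ?N N"
  proof (rule measurable_N_I)
    fix A assume A: "A \<in> sets M"
    have eq: "emeasure \<mu> A = (SUP n. emeasure \<mu> (A \<inter> B n))" if "\<mu> \<in> space ?N" for \<mu>
      using that A by (intro emeasure_eq_SUP_B) (auto simp: space_measure_of_conv)
    have "A \<inter> B n \<in> L" for n using A by (intro L_subset[OF B_in_L]) auto
    from local[OF this] show "(\<lambda>\<mu>. emeasure \<mu> A) \<in> borel_measurable ?N"
      by (subst measurable_cong[OF eq]) auto
  qed (simp only: space_measure_of_conv)
  then have "sets N \<subseteq> sets ?N"
    using G measurable_sets[of "\<lambda>\<mu>. \<mu>" ?N N] sets.Int_space_eq2[of _ N]
    by (auto simp only: space_measure_of_conv vimage_ident)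
  then show "sets N \<subseteq> sigma_sets (space N) ?G"
    by (simp only: sets_measure_of[OF G])
  show "sigma_sets (space N) ?G \<subseteq> sets N"
    by (rule sets.sigma_sets_subset) (use constrained_sets in blast)
qed

lemma finite_partition:
  assumes "finite \<A>" "\<A> \<subseteq> L"
  obtains \<C> where "finite \<C>" "\<C> \<subseteq> L" "disjoint \<C>" "\<And>F. F \<in> \<A> \<Longrightarrow> \<Union>{C\<in>\<C>. C \<subseteq> F} = F"
proof
  \<comment> \<open>\<open>atom J\<close> collects the points that lie in exactly the members of
    \<open>J\<close>. Staying inside the union of \<open>\<A>\<close> keeps the atoms local and
    makes the atom of the empty family empty.\<close>
  define atom where "atom J = {x\<in>\<Union>\<A>. {F\<in>\<A>. x \<in> F} = J}" for J
  let ?\<C> = "atom ` Pow \<A>"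
  show "finite ?\<C>" using assms by simp
  have U: "\<Union>\<A> \<in> L" using assms by (rule L_Union)
  have "atom J \<in> sets M" if "J \<subseteq> \<A>" for J
  proof (cases "J = {}")
    case False
    have "atom J = (\<Inter>F\<in>J. F) - \<Union>(\<A> - J)" using that False by (auto simp: atom_def)
    also have "\<dots> \<in> sets M"
    proof (intro sets.Diff sets.finite_INT sets.finite_Union)
      show "finite J" "finite (\<A> - J)" using that assms by (auto intro: finite_subset)
    qed (use that assms L_sets False in auto)
    finally show ?thesis .
  next
    case True
    then have "atom J = {}" by (auto simp: atom_def)
    then show ?thesis by simp
  qed
  then show "?\<C> \<subseteq> L" by (auto simp: atom_def intro!: L_subset[OF U])
  show "disjoint ?\<C>" by (auto simp: disjoint_def atom_def)
  fix F assume F: "F \<in> \<A>"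
  show "\<Union>{C\<in>?\<C>. C \<subseteq> F} = F"
  proof safe
    fix x assume x: "x \<in> F"
    show "x \<in> \<Union>{C\<in>?\<C>. C \<subseteq> F}"
      using x F by (intro UnionI[of "atom {F\<in>\<A>. x \<in> F}"]) (auto simp: atom_def)
  qed blast
qed

lemma emeasure_partition:
  assumes \<mu>: "sets \<mu> = sets M" and \<C>: "finite \<C>" "\<C> \<subseteq> L" "disjoint \<C>" and F: "\<Union>{C\<in>\<C>. C \<subseteq> F} = F"
  shows "emeasure \<mu> F = (\<Sum>C | C \<in> \<C> \<and> C \<subseteq> F. emeasure \<mu> C)"
proof -
  have "(\<Sum>C\<in>{C\<in>\<C>. C \<subseteq> F}. emeasure \<mu> C) = emeasure \<mu> (\<Union>C\<in>{C\<in>\<C>. C \<subseteq> F}. C)"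
    using \<C> \<mu> L_sets by (intro sum_emeasure) (auto simp: disjoint_family_on_def disjoint_def)
  then show ?thesis using F by simp
qed

text \<open>Each prescribed mass is a sum of cell counts, so constraints become linear equations for
  these counts. The count functions are taken in \<open>PiE\<close>: distinct ones then differ on a
  cell, and there are only countably many.\<close>

lemma constrained_eq_UN_cyl:
  assumes \<C>: "finite \<C>" "\<C> \<subseteq> L" "disjoint \<C>" and R: "\<And>F k. (F, k) \<in> R \<Longrightarrow> \<Union>{C\<in>\<C>. C \<subseteq> F} = F"
  shows "constrained R = (\<Union>n\<in>{n\<in>PiE \<C> (\<lambda>_. UNIV). \<forall>(F, k)\<in>R. (\<Sum>C | C \<in> \<C> \<and> C \<subseteq> F. n C) = k}. cyl \<C> n)"
proof -
  have *: "\<mu> \<in> constrained R \<longleftrightarrow> (\<forall>(F, k)\<in>R. (\<Sum>C | C \<in> \<C> \<and> C \<subseteq> F. n C) = k)"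
    if "\<mu> \<in> cyl \<C> n" for \<mu> n
  proof -
    have "emeasure \<mu> F = of_nat (\<Sum>C | C \<in> \<C> \<and> C \<subseteq> F. n C)" if "(F, k) \<in> R" for F k
    proof -
      have "emeasure \<mu> F = (\<Sum>C | C \<in> \<C> \<and> C \<subseteq> F. emeasure \<mu> C)"
        using \<open>\<mu> \<in> cyl \<C> n\<close> by (intro emeasure_partition \<C> R[OF that]) (auto simp: cyl_def)
      also have "\<dots> = (\<Sum>C | C \<in> \<C> \<and> C \<subseteq> F. of_nat (n C))"
        using \<open>\<mu> \<in> cyl \<C> n\<close> by (intro sum.cong) (auto simp: cyl_def)
      finally show ?thesis by simp
    qed
    moreover have "\<mu> \<in> space N" using that by (simp add: cyl_def)
    ultimately show ?thesis
      unfolding constrained_def by (auto simp del: of_nat_sum)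
  qed
  have ex: "\<exists>n\<in>PiE \<C> (\<lambda>_. UNIV). \<mu> \<in> cyl \<C> n" if "\<mu> \<in> space N" for \<mu>
  proof -
    have "\<forall>C\<in>\<C>. \<exists>k::nat. emeasure \<mu> C = of_nat k" using N_nat[OF that] \<C> by auto
    then obtain n where "\<forall>C\<in>\<C>. emeasure \<mu> C = of_nat (n C :: nat)" by metis
    then show ?thesis
      using that by (intro bexI[of _ "restrict n \<C>"]) (auto simp: cyl_def)
  qed
  show ?thesis
  proof (intro set_eqI iffI)
    fix \<mu> assume \<mu>: "\<mu> \<in> constrained R"
    then have "\<mu> \<in> space N" by (simp add: constrained_def)
    then obtain n where n: "n \<in> PiE \<C> (\<lambda>_. UNIV)" "\<mu> \<in> cyl \<C> n" using ex by auto
    with \<mu> *[OF n(2)] show "\<mu> \<in> (\<Union>n\<in>{n\<in>PiE \<C> (\<lambda>_. UNIV). \<forall>(F, k)\<in>R. (\<Sum>C | C \<in> \<C> \<and> C \<subseteq> F. n C) = k}. cyl \<C> n)"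
      by (intro UN_I[of n]) simp_all
  next
    fix \<mu> assume "\<mu> \<in> (\<Union>n\<in>{n\<in>PiE \<C> (\<lambda>_. UNIV). \<forall>(F, k)\<in>R. (\<Sum>C | C \<in> \<C> \<and> C \<subseteq> F. n C) = k}. cyl \<C> n)"
    then show "\<mu> \<in> constrained R" using * by (elim UN_E) simp
  qed
qed

lemma disjoint_cyl: "disjoint_family_on (cyl \<C>) (PiE \<C> (\<lambda>_. UNIV))"
unfolding disjoint_family_on_def
proof (intro ballI impI, rule ccontr)
  fix n n' assume n: "n \<in> PiE \<C> (\<lambda>_. UNIV)" "n' \<in> PiE \<C> (\<lambda>_. UNIV)" "n \<noteq> n'" "cyl \<C> n \<inter> cyl \<C> n' \<noteq> {}"
  then obtain \<mu> where \<mu>: "\<mu> \<in> cyl \<C> n" "\<mu> \<in> cyl \<C> n'" by auto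
  have "n C = n' C" if "C \<in> \<C>" for C
  proof -
    have "(of_nat (n C) :: ennreal) = of_nat (n' C)" using \<mu> that by (simp add: cyl_def)
    then show ?thesis by simp
  qed
  with n show False by (auto intro: PiE_ext)
qed

text \<open>The set \<open>A\<close> lets the partitions be refined by a prescribed set; \<open>A = {}\<close> imposes nothing.\<close>

lemma counting_measure_eqI:
  assumes sets: "sets m = sets N" "sets m' = sets N" and fin: "emeasure m (space N) < \<infinity>" and A: "A \<in> L"
    and eq: "\<And>\<C> n. finite \<C> \<Longrightarrow> \<C> \<subseteq> L \<Longrightarrow> disjoint \<C> \<Longrightarrow> \<Union>{C\<in>\<C>. C \<subseteq> A} = A \<Longrightarrow>
      emeasure m (cyl \<C> n) = emeasure m' (cyl \<C> n)"
  shows "m = m'"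
proof (rule measure_eqI_generator_eq[where E = "{constrained R | R. finite R \<and> fst ` R \<subseteq> L}"
      and \<Omega> = "space N" and A = "\<lambda>_. space N"])
  show "Int_stable {constrained R | R. finite R \<and> fst ` R \<subseteq> L}"
  proof (rule Int_stableI, safe)
    fix R R' :: "('a set \<times> nat) set" assume "finite R" "fst ` R \<subseteq> L" "finite R'" "fst ` R' \<subseteq> L"
    then show "\<exists>R''. constrained R \<inter> constrained R' = constrained R'' \<and> finite R'' \<and> fst ` R'' \<subseteq> L"
      by (intro exI[of _ "R \<union> R'"]) (auto simp: constrained_def)
  qed
  fix X assume "X \<in> {constrained R | R. finite R \<and> fst ` R \<subseteq> L}"
  then obtain R where R: "finite R" "fst ` R \<subseteq> L" "X = constrained R" by auto
  \<comment> \<open>One partition resolves all constrained sets together with \<open>A\<close>, as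
    the hypothesis on cylinders requires.\<close>
  obtain \<C> where \<C>: "finite \<C>" "\<C> \<subseteq> L" "disjoint \<C>"
    and F: "\<And>F. F \<in> insert A (fst ` R) \<Longrightarrow> \<Union>{C\<in>\<C>. C \<subseteq> F} = F"
    using finite_partition[of "insert A (fst ` R)"] A R by auto
  define I where "I = {n\<in>PiE \<C> (\<lambda>_. UNIV). \<forall>(F, k)\<in>R. (\<Sum>C | C \<in> \<C> \<and> C \<subseteq> F. n C) = k}"
  have X: "X = (\<Union>n\<in>I. cyl \<C> n)"
    unfolding R(3) I_def
  proof (rule constrained_eq_UN_cyl[OF \<C>])
    fix F k assume "(F, k) \<in> R"
    then have "F \<in> insert A (fst ` R)" by (auto intro: rev_image_eqI)
    then show "\<Union>{C\<in>\<C>. C \<subseteq> F} = F" by (rule F)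
  qed
  have I_sub: "I \<subseteq> PiE \<C> (\<lambda>_. UNIV)" by (auto simp: I_def)
  have "countable (PiE \<C> (\<lambda>_. UNIV :: nat set))"
    using \<C>(1) by (intro countable_PiE) auto
  then have I: "countable I" "disjoint_family_on (cyl \<C>) I"
    using I_sub by (auto intro: countable_subset disjoint_family_on_mono[OF I_sub disjoint_cyl])
  have "emeasure m' X = (\<integral>\<^sup>+n. emeasure m' (cyl \<C> n) \<partial>count_space I)"
    unfolding X by (rule emeasure_UN_countable[OF _ I]) (simp add: sets cyl_sets[OF \<C>(1,2)])
  also have "\<dots> = (\<integral>\<^sup>+n. emeasure m (cyl \<C> n) \<partial>count_space I)"
    by (intro nn_integral_cong eq[symmetric] \<C> F) simp
  also have "\<dots> = emeasure m X"
    unfolding X by (rule emeasure_UN_countable[symmetric, OF _ I]) (simp add: sets cyl_sets[OF \<C>(1,2)])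
  finally show "emeasure m X = emeasure m' X" ..
next
  have "space N = constrained {}" by (simp add: constrained_def)
  then show "range (\<lambda>_. space N) \<subseteq> {constrained R | R. finite R \<and> fst ` R \<subseteq> L}"
    by (intro image_subsetI CollectI exI[of _ "{}"]) simp
  show "{constrained R | R. finite R \<and> fst ` R \<subseteq> L} \<subseteq> Pow (space N)"
    by (auto simp: constrained_def)
  show "sets m = sigma_sets (space N) {constrained R | R. finite R \<and> fst ` R \<subseteq> L}"
    "sets m' = sigma_sets (space N) {constrained R | R. finite R \<and> fst ` R \<subseteq> L}"
    using sets sets_N_eq_constrained by simp_all
qed (use fin in simp_all)

end

section \<open>Poisson processes and the Mecke equation\<close>

text \<open>The explicit formula also covers rate 0, where \<open>0 ^ 0 = 1\<close> gives unit mass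
  at 0.\<close>

definition pois :: "real \<Rightarrow> nat \<Rightarrow> real" where
  "pois l n = exp (- l) * l ^ n / fact n"

lemma pois_nonneg: "0 \<le> l \<Longrightarrow> 0 \<le> pois l n"
  by (simp add: pois_def)

lemma pois_Suc: "real (Suc n) * pois l (Suc n) = l * pois l n"
  unfolding pois_def by (simp add: field_simps del: of_nat_Suc)

lemma measure_poisson_law:
  assumes "c < \<infinity>"
  shows "measure (poisson_law c) {of_nat k} = pois (enn2real c) k"
proof (cases "c = 0")
  case True
  have "(0::ennreal) = of_nat k \<longleftrightarrow> k = 0"
    using of_nat_eq_0_iff[where ?'a = ennreal, of k] by auto
  then have "measure (return borel (0::ennreal)) {of_nat k} = (if k = 0 then 1 else 0)"
    by (simp add: measure_def emeasure_return indicator_def)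
  then show ?thesis using True by (simp add: poisson_law_def pois_def)
next
  case False
  then have c: "0 < enn2real c" using assms by (simp add: enn2real_positive_iff less_top zero_less_iff_neq_zero)
  have "(of_nat :: nat \<Rightarrow> ennreal) -` {of_nat k} = {k}" by auto
  then have "measure (distr (measure_pmf (poisson_pmf (enn2real c))) borel (of_nat :: nat \<Rightarrow> ennreal)) {of_nat k}
      = pmf (poisson_pmf (enn2real c)) k"
    by (subst measure_distr) (simp_all add: measure_pmf_single)
  then show ?thesis using False assms c by (auto simp: poisson_law_def pois_def)
qed

locale intensity_space = localized_space +
  fixes \<Lambda> :: "'a measure"
  assumes loc_fin: "locally_finite M B \<Lambda>"
begin

lemma sets_\<Lambda> [simp, measurable_cong]: "sets \<Lambda> = sets M"
  using loc_fin by (simp add: locally_finite_def)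

lemma space_\<Lambda> [simp]: "space \<Lambda> = space M"
  by (rule sets_eq_imp_space_eq) simp

lemma \<Lambda>_finite: "A \<in> L \<Longrightarrow> emeasure \<Lambda> A < \<infinity>"
  using loc_fin by (auto simp: locally_finite_def)

lemma emeasure_\<Lambda>: "A \<in> L \<Longrightarrow> emeasure \<Lambda> A = ennreal (measure \<Lambda> A)"
  using \<Lambda>_finite[of A] by (simp add: emeasure_eq_ennreal_measure less_top)

lemma sigma_finite_\<Lambda>: "sigma_finite_measure \<Lambda>"
proof
  show "\<exists>A. countable A \<and> A \<subseteq> sets \<Lambda> \<and> \<Union>A = space \<Lambda> \<and> (\<forall>a\<in>A. emeasure \<Lambda> a \<noteq> \<infinity>)"
    using UN_B \<Lambda>_finite[OF B_in_L] by (intro exI[of _ "range B"]) (auto simp: less_top)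
qed

sublocale \<Lambda>: sigma_finite_measure \<Lambda>
  by (rule sigma_finite_\<Lambda>)

definition pois_cyl :: "'a set set \<Rightarrow> ('a set \<Rightarrow> nat) \<Rightarrow> ennreal" where
  "pois_cyl \<C> n = (\<Prod>C\<in>\<C>. ennreal (pois (measure \<Lambda> C) (n C)))"

text \<open>The recursion of the Poisson weights in one factor: dropping a point from
  \<open>C\<close> trades the factor \<open>n C\<close> for the mass of \<open>C\<close>. This is
  the Mecke equation in elementary form.\<close>

lemma pois_cyl_step:
  assumes \<C>: "finite \<C>" "\<C> \<subseteq> L" and C: "C \<in> \<C>" and n: "0 < n C"
  shows "of_nat (n C) * pois_cyl \<C> n = emeasure \<Lambda> C * pois_cyl \<C> (n(C := n C - 1))"
proof -
  let ?rest = "\<Prod>D\<in>\<C> - {C}. ennreal (pois (measure \<Lambda> D) (n D))"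
  obtain k where k: "n C = Suc k" using n by (cases "n C") auto
  have "of_nat (n C) * pois_cyl \<C> n = ennreal (real (n C) * pois (measure \<Lambda> C) (n C)) * ?rest"
    using \<C> C by (simp add: pois_cyl_def prod.remove[of \<C> C] ennreal_mult' mult.assoc ennreal_of_nat_eq_real_of_nat)
  also have "\<dots> = ennreal (measure \<Lambda> C * pois (measure \<Lambda> C) k) * ?rest"
    by (simp only: k pois_Suc)
  also have "\<dots> = emeasure \<Lambda> C * (ennreal (pois (measure \<Lambda> C) k) * ?rest)"
    using \<C> C by (simp add: emeasure_\<Lambda> subset_eq ennreal_mult' mult.assoc)
  also have "ennreal (pois (measure \<Lambda> C) k) * ?rest = pois_cyl \<C> (n(C := n C - 1))"
  proof -
    have "(\<Prod>D\<in>\<C> - {C}. ennreal (pois (measure \<Lambda> D) ((n(C := n C - 1)) D))) = ?rest"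
      by (rule prod.cong) auto
    then show ?thesis
      using \<C> C k unfolding pois_cyl_def by (subst prod.remove[of \<C> C]) simp_all
  qed
  finally show ?thesis .
qed

lemma prob_poisson_process_cyl:
  assumes P: "prob_space P" and pp: "poisson_process P M B \<Lambda> \<eta>"
    and \<C>: "finite \<C>" "\<C> \<subseteq> L" "disjoint \<C>"
  shows "emeasure (distr P N \<eta>) (cyl \<C> n) = pois_cyl \<C> n"
proof -
  interpret P: prob_space P by fact
  have \<eta> [measurable]: "\<eta> \<in> measurable P N" using pp by (simp add: poisson_process_def)
  have one: "P.prob ((\<lambda>\<omega>. emeasure (\<eta> \<omega>) C) -` {of_nat k} \<inter> space P) = pois (measure \<Lambda> C) k"
    if "C \<in> \<C>" for C k
  proof -
    have C: "C \<in> L" "C \<in> sets M" using that \<C> L_sets by auto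
    note [measurable] = C(2)
    have "P.prob ((\<lambda>\<omega>. emeasure (\<eta> \<omega>) C) -` {of_nat k} \<inter> space P) =
        measure (distr P borel (\<lambda>\<omega>. emeasure (\<eta> \<omega>) C)) {of_nat k}"
      by (subst measure_distr) auto
    also have "\<dots> = measure (poisson_law (emeasure \<Lambda> C)) {of_nat k}"
      using pp C by (simp add: poisson_process_def)
    also have "\<dots> = pois (measure \<Lambda> C) k"
      using \<Lambda>_finite[OF C(1)] by (subst measure_poisson_law) (auto simp: measure_def)
    finally show ?thesis .
  qed
  \<comment> \<open>Independence is given for families indexed by an initial segment, so the cells
    are enumerated. The empty family is separated because an intersection over no indices is not the
    event space.\<close>
  obtain g and m :: nat where g: "bij_betw g {..<m} \<C>"
    using ex_bij_betw_nat_finite[OF \<C>(1)] by (auto simp: atLeast0LessThan)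
  have inj: "inj_on g {..<m}" and img: "g ` {..<m} = \<C>" using g by (auto simp: bij_betw_def)
  have eq: "\<eta> -` cyl \<C> n \<inter> space P = {\<omega>\<in>space P. \<forall>C\<in>\<C>. emeasure (\<eta> \<omega>) C = of_nat (n C)}"
    using measurable_space[OF \<eta>] by (auto simp: cyl_def)
  have prob: "P.prob (\<eta> -` cyl \<C> n \<inter> space P) = (\<Prod>C\<in>\<C>. pois (measure \<Lambda> C) (n C))"
  proof (cases "\<C> = {}")
    case True
    then show ?thesis using eq by (simp add: P.prob_space)
  next
    case False
    then have m: "{..<m} \<noteq> {}" using img by blast
    have "disjoint_family_on g {..<m}"
      unfolding disjoint_family_on_def
    proof (intro ballI impI)
      fix i j assume "i \<in> {..<m}" "j \<in> {..<m}" "i \<noteq> j"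
      then have "g i \<in> \<C>" "g j \<in> \<C>" "g i \<noteq> g j"
        using img inj_on_eq_iff[OF inj] by auto
      then show "g i \<inter> g j = {}" by (rule disjointD[OF \<C>(3)])
    qed
    moreover have "\<forall>i<m. g i \<in> sets M" using img \<C>(2) L_sets by auto
    ultimately have indep: "P.indep_vars (\<lambda>_. borel) (\<lambda>i \<omega>. emeasure (\<eta> \<omega>) (g i)) {..<m}"
      using pp by (simp add: poisson_process_def)
    have "\<eta> -` cyl \<C> n \<inter> space P = (\<Inter>i\<in>{..<m}. (\<lambda>\<omega>. emeasure (\<eta> \<omega>) (g i)) -` {of_nat (n (g i))} \<inter> space P)"
      unfolding eq unfolding img[symmetric] using m by auto
    then have "P.prob (\<eta> -` cyl \<C> n \<inter> space P) =
        (\<Prod>i<m. P.prob ((\<lambda>\<omega>. emeasure (\<eta> \<omega>) (g i)) -` {of_nat (n (g i))} \<inter> space P))"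
      using P.indep_varsD_finite[OF indep m] by simp
    also have "\<dots> = (\<Prod>i<m. pois (measure \<Lambda> (g i)) (n (g i)))"
      using img by (intro prod.cong refl one) auto
    also have "\<dots> = (\<Prod>C\<in>\<C>. pois (measure \<Lambda> C) (n C))"
      by (rule prod.reindex_bij_betw[OF g])
    finally show ?thesis .
  qed
  have "emeasure (distr P N \<eta>) (cyl \<C> n) = ennreal (P.prob (\<eta> -` cyl \<C> n \<inter> space P))"
    using cyl_sets[OF \<C>(1,2)] by (simp add: emeasure_distr P.emeasure_eq_measure)
  also have "\<dots> = pois_cyl \<C> n"
    unfolding prob pois_cyl_def by (rule prod_ennreal[symmetric]) (simp add: pois_nonneg)
  finally show ?thesis .
qed

end

abbreviation (in localized_space) add_point :: "'a measure \<Rightarrow> 'a \<Rightarrow> 'a measure" where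
  "add_point \<mu> x \<equiv> add_measure \<mu> (return M x)"

text \<open>Since the cells are disjoint, a new point changes the count of its own cell only. The
  condition \<open>0 < n C\<close> guards the truncated subtraction: for \<open>n C = 0\<close> the
  left side is impossible, although \<open>n C - 1\<close> is still 0.\<close>

lemma (in localized_space) add_point_in_cyl_iff:
  assumes \<mu>: "\<mu> \<in> space N" and \<C>: "\<C> \<subseteq> L" "disjoint \<C>" "C \<in> \<C>" and x: "x \<in> C"
  shows "add_point \<mu> x \<in> cyl \<C> n \<longleftrightarrow> 0 < n C \<and> \<mu> \<in> cyl \<C> (n(C := n C - 1))"
proof -
  have e: "emeasure (add_point \<mu> x) D = emeasure \<mu> D + (if D = C then 1 else 0)"
    if D: "D \<in> \<C>" for D
  proof -
    have "x \<in> D \<longleftrightarrow> D = C" using disjointD[OF \<C>(2) D \<C>(3)] x by auto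
    moreover have "D \<in> sets M" using D \<C> L_sets by auto
    ultimately show ?thesis
      using \<mu> by (simp add: emeasure_add_measure indicator_def)
  qed
  obtain k :: nat where k: "emeasure \<mu> C = of_nat k" using N_nat[OF \<mu>, of C] \<C> by auto
  have C: "emeasure \<mu> C + 1 = of_nat (n C) \<longleftrightarrow> 0 < n C \<and> emeasure \<mu> C = of_nat (n C - 1)"
  proof -
    have "emeasure \<mu> C + 1 = of_nat (Suc k)" using k by simp
    then have "emeasure \<mu> C + 1 = of_nat (n C) \<longleftrightarrow> Suc k = n C"
      by (simp only: of_nat_eq_iff)
    also have "\<dots> \<longleftrightarrow> 0 < n C \<and> k = n C - 1" by auto
    finally show ?thesis by (simp add: k)
  qed
  have sp: "add_point \<mu> x \<in> space N" using \<mu> return_in_N by (rule add_in_N)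
  have "add_point \<mu> x \<in> cyl \<C> n \<longleftrightarrow>
      (\<forall>D\<in>\<C>. emeasure \<mu> D + (if D = C then 1 else 0) = of_nat (n D))"
    using sp by (simp add: cyl_def e)
  also have "\<dots> \<longleftrightarrow> emeasure \<mu> C + 1 = of_nat (n C) \<and> (\<forall>D\<in>\<C> - {C}. emeasure \<mu> D = of_nat (n D))"
    using \<C>(3) by auto
  also have "\<dots> \<longleftrightarrow> 0 < n C \<and> \<mu> \<in> cyl \<C> (n(C := n C - 1))"
    using \<C>(3) \<mu> unfolding C cyl_def by auto
  finally show ?thesis .
qed

section \<open>The Mecke equation from Poisson cylinder probabilities\<close>

context intensity_space
begin

definition mecke :: "'a measure measure \<Rightarrow> bool" where
  "mecke Q \<longleftrightarrow> (\<forall>h. (\<lambda>(\<mu>, x). h \<mu> x) \<in> borel_measurable (N \<Otimes>\<^sub>M M) \<longrightarrow>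
    (\<integral>\<^sup>+\<mu>. \<integral>\<^sup>+x. h \<mu> x \<partial>\<mu> \<partial>Q) = (\<integral>\<^sup>+x. \<integral>\<^sup>+\<mu>. h (add_point \<mu> x) x \<partial>Q \<partial>\<Lambda>))"

text \<open>\<open>palm Q\<close> and \<open>campbell Q\<close> are the two sides of the Mecke
  equation as measures on pairs of a configuration and a point. The equation becomes an equality of
  measures, which may be checked on rectangles.\<close>

definition palm :: "'a measure measure \<Rightarrow> ('a measure \<times> 'a) measure" where
  "palm Q = distr (\<Lambda> \<Otimes>\<^sub>M Q) (N \<Otimes>\<^sub>M M) (\<lambda>z. (add_point (snd z) (fst z), fst z))"

definition campbell :: "'a measure measure \<Rightarrow> ('a measure \<times> 'a) measure" where
  "campbell Q = measure_of (space (N \<Otimes>\<^sub>M M)) (sets (N \<Otimes>\<^sub>M M)) (\<lambda>G. \<integral>\<^sup>+\<mu>. emeasure \<mu> (Pair \<mu> -` G) \<partial>Q)"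

context
  fixes Q :: "'a measure measure"
  assumes Q: "prob_space Q" and sets_Q [simp, measurable_cong]: "sets Q = sets N"
    and Q_cyl: "\<And>\<C> n. finite \<C> \<Longrightarrow> \<C> \<subseteq> L \<Longrightarrow> disjoint \<C> \<Longrightarrow> emeasure Q (cyl \<C> n) = pois_cyl \<C> n"
begin

interpretation Q: prob_space Q by (rule Q)
interpretation \<Lambda>Q: pair_sigma_finite \<Lambda> Q ..

lemma space_Q': "space Q = space N"
  by (rule sets_eq_imp_space_eq) simp

lemma nn_integral_add_point_cyl:
  assumes \<C>: "finite \<C>" "\<C> \<subseteq> L" "disjoint \<C>" and C: "C \<in> \<C>"
  shows "(\<integral>\<^sup>+x. \<integral>\<^sup>+\<mu>. indicator C x * indicator (cyl \<C> n) (add_point \<mu> x) \<partial>Q \<partial>\<Lambda>)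
    = of_nat (n C) * pois_cyl \<C> n"
proof -
  have CM: "C \<in> sets M" using C \<C> L_sets by auto
  have "(\<integral>\<^sup>+\<mu>. indicator C x * indicator (cyl \<C> n) (add_point \<mu> x) \<partial>Q) =
      indicator C x * (if 0 < n C then pois_cyl \<C> (n(C := n C - 1)) else 0)" for x
  proof (cases "x \<in> C")
    case True
    have "(\<integral>\<^sup>+\<mu>. indicator (cyl \<C> n) (add_point \<mu> x) \<partial>Q) =
        (\<integral>\<^sup>+\<mu>. (if 0 < n C then 1 else 0) * indicator (cyl \<C> (n(C := n C - 1))) \<mu> \<partial>Q)"
      using add_point_in_cyl_iff[OF _ \<C>(2,3) C True]
      by (intro nn_integral_cong) (auto simp: indicator_def space_Q')
    also have "\<dots> = (if 0 < n C then pois_cyl \<C> (n(C := n C - 1)) else 0)"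
      using cyl_sets[OF \<C>(1,2)] Q_cyl[OF \<C>] by (simp add: nn_integral_cmult)
    finally show ?thesis using True by simp
  qed simp
  then have "(\<integral>\<^sup>+x. \<integral>\<^sup>+\<mu>. indicator C x * indicator (cyl \<C> n) (add_point \<mu> x) \<partial>Q \<partial>\<Lambda>)
      = emeasure \<Lambda> C * (if 0 < n C then pois_cyl \<C> (n(C := n C - 1)) else 0)"
    using CM by (simp add: nn_integral_multc)
  also have "\<dots> = of_nat (n C) * pois_cyl \<C> n"
    using pois_cyl_step[where n = n, OF \<C>(1,2) C] by simp
  finally show ?thesis .
qed

lemma nn_integral_palm:
  assumes [measurable]: "h \<in> borel_measurable (N \<Otimes>\<^sub>M M)"
  shows "(\<integral>\<^sup>+z. h z \<partial>palm Q) = (\<integral>\<^sup>+x. \<integral>\<^sup>+\<mu>. h (add_point \<mu> x, x) \<partial>Q \<partial>\<Lambda>)"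
proof -
  have "(\<integral>\<^sup>+z. h z \<partial>palm Q) = (\<integral>\<^sup>+z. h (add_point (snd z) (fst z), fst z) \<partial>(\<Lambda> \<Otimes>\<^sub>M Q))"
    unfolding palm_def by (rule nn_integral_distr) measurable
  also have "\<dots> = (\<integral>\<^sup>+x. \<integral>\<^sup>+\<mu>. h (add_point \<mu> x, x) \<partial>Q \<partial>\<Lambda>)"
    by (subst Q.nn_integral_fst[symmetric]) simp_all
  finally show ?thesis .
qed

lemma sets_palm [simp, measurable_cong]: "sets (palm Q) = sets (N \<Otimes>\<^sub>M M)"
  by (simp add: palm_def)

text \<open>For fixed \<open>A\<close> both sides are measures in \<open>E\<close>, finite because
  \<open>A\<close> is local, so cylinders suffice. On cells that resolve \<open>A\<close>, the
  number of points in \<open>A\<close> is constant on a cylinder, and each cell contributes by the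
  recursion of the Poisson weights.\<close>

lemma mecke_rectangle:
  assumes A: "A \<in> L" and E: "E \<in> sets N"
  shows "(\<integral>\<^sup>+\<mu>. emeasure \<mu> A * indicator E \<mu> \<partial>Q) =
    (\<integral>\<^sup>+x. \<integral>\<^sup>+\<mu>. indicator A x * indicator E (add_point \<mu> x) \<partial>Q \<partial>\<Lambda>)"
proof -
  have AM [measurable]: "A \<in> sets M" using A by (rule L_sets)
  define m where "m = distr (density (palm Q) (\<lambda>z. indicator A (snd z))) N fst"
  have m: "emeasure m E = (\<integral>\<^sup>+x. \<integral>\<^sup>+\<mu>. indicator A x * indicator E (add_point \<mu> x) \<partial>Q \<partial>\<Lambda>)"
    if [measurable]: "E \<in> sets N" for E
  proof -
    have "emeasure m E = (\<integral>\<^sup>+z. indicator E z \<partial>m)" using that by (simp add: m_def)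
    also have "\<dots> = (\<integral>\<^sup>+z. indicator A (snd z) * indicator E (fst z) \<partial>palm Q)"
      unfolding m_def by (subst nn_integral_distr, measurable) (subst nn_integral_density, measurable)
    finally show ?thesis by (subst (asm) nn_integral_palm) simp_all
  qed
  have "m = density Q (\<lambda>\<mu>. emeasure \<mu> A)"
  proof (rule counting_measure_eqI[OF _ _ _ A])
    have sp: "add_point \<mu> x \<in> space N" if "\<mu> \<in> space Q" for \<mu> x
      using that return_in_N by (simp add: add_in_N space_Q')
    have "emeasure m (space N) = (\<integral>\<^sup>+x. \<integral>\<^sup>+\<mu>. indicator A x \<partial>Q \<partial>\<Lambda>)"
      by (subst m) (simp, intro nn_integral_cong, simp add: sp)
    also have "\<dots> = emeasure \<Lambda> A" by (simp add: Q.emeasure_space_1)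
    finally show "emeasure m (space N) < \<infinity>" using \<Lambda>_finite[OF A] by simp
  next
    fix \<C> n assume \<C>: "finite \<C>" "\<C> \<subseteq> L" "disjoint \<C>" and P: "\<Union>{C\<in>\<C>. C \<subseteq> A} = A"
    note [measurable] = cyl_sets[OF \<C>(1,2)]
    let ?\<C> = "{C\<in>\<C>. C \<subseteq> A}"
    have ind: "(indicator A x :: ennreal) = (\<Sum>C\<in>?\<C>. indicator C x)" for x
    proof -
      have "disjoint_family_on (\<lambda>C. C) ?\<C>" using \<C>(3) by (auto simp: disjoint_family_on_def disjoint_def)
      from indicator_UN_disjoint[OF _ this, of x] \<C>(1) show ?thesis using P by simp
    qed
    have CM [measurable]: "C \<in> sets M" if "C \<in> ?\<C>" for C using that \<C> L_sets by auto
    have "emeasure m (cyl \<C> n) =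
        (\<integral>\<^sup>+x. \<integral>\<^sup>+\<mu>. (\<Sum>C\<in>?\<C>. indicator C x * indicator (cyl \<C> n) (add_point \<mu> x)) \<partial>Q \<partial>\<Lambda>)"
      by (subst m) (simp_all add: ind sum_distrib_right)
    also have "\<dots> = (\<integral>\<^sup>+x. (\<Sum>C\<in>?\<C>. \<integral>\<^sup>+\<mu>. indicator C x * indicator (cyl \<C> n) (add_point \<mu> x) \<partial>Q) \<partial>\<Lambda>)"
      by (intro nn_integral_cong nn_integral_sum) measurable
    also have "\<dots> = (\<Sum>C\<in>?\<C>. \<integral>\<^sup>+x. \<integral>\<^sup>+\<mu>. indicator C x * indicator (cyl \<C> n) (add_point \<mu> x) \<partial>Q \<partial>\<Lambda>)"
      by (intro nn_integral_sum) measurable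
    also have "\<dots> = (\<Sum>C\<in>?\<C>. of_nat (n C) * pois_cyl \<C> n)"
      by (intro sum.cong refl nn_integral_add_point_cyl \<C>) auto
    also have "\<dots> = (\<integral>\<^sup>+\<mu>. (\<Sum>C\<in>?\<C>. of_nat (n C)) * indicator (cyl \<C> n) \<mu> \<partial>Q)"
      by (subst nn_integral_cmult) (simp_all add: Q_cyl[OF \<C>] sum_distrib_right)
    also have "\<dots> = (\<integral>\<^sup>+\<mu>. emeasure \<mu> A * indicator (cyl \<C> n) \<mu> \<partial>Q)"
    proof (intro nn_integral_cong)
      fix \<mu> assume "\<mu> \<in> space Q"
      show "(\<Sum>C\<in>?\<C>. of_nat (n C)) * indicator (cyl \<C> n) \<mu> = emeasure \<mu> A * indicator (cyl \<C> n) \<mu>"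
      proof (cases "\<mu> \<in> cyl \<C> n")
        case True
        then have "emeasure \<mu> A = (\<Sum>C\<in>?\<C>. emeasure \<mu> C)"
          by (intro emeasure_partition \<C> P) (auto simp: cyl_def)
        also have "\<dots> = (\<Sum>C\<in>?\<C>. of_nat (n C))"
          using True by (intro sum.cong) (auto simp: cyl_def)
        finally show ?thesis by simp
      qed simp
    qed
    also have "\<dots> = emeasure (density Q (\<lambda>\<mu>. emeasure \<mu> A)) (cyl \<C> n)"
      by (subst emeasure_density) auto
    finally show "emeasure m (cyl \<C> n) = emeasure (density Q (\<lambda>\<mu>. emeasure \<mu> A)) (cyl \<C> n)" .
  qed (simp_all add: m_def)
  then have "emeasure m E = (\<integral>\<^sup>+\<mu>. emeasure \<mu> A * indicator E \<mu> \<partial>Q)"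
    using E by (simp add: emeasure_density)
  then show ?thesis using m[OF E] by simp
qed

lemma emeasure_campbell:
  assumes "G \<in> sets (N \<Otimes>\<^sub>M M)"
  shows "emeasure (campbell Q) G = (\<integral>\<^sup>+\<mu>. emeasure \<mu> (Pair \<mu> -` G) \<partial>Q)"
proof (rule emeasure_measure_of[OF campbell_def])
  show "sets (N \<Otimes>\<^sub>M M) \<subseteq> Pow (space (N \<Otimes>\<^sub>M M))" by (rule sets.space_closed)
  show "G \<in> sets (campbell Q)" using assms by (simp add: campbell_def sets.sigma_sets_eq)
  show "positive (sets (campbell Q)) (\<lambda>G. \<integral>\<^sup>+\<mu>. emeasure \<mu> (Pair \<mu> -` G) \<partial>Q)"
    by (simp add: positive_def)
  show "countably_additive (sets (campbell Q)) (\<lambda>G. \<integral>\<^sup>+\<mu>. emeasure \<mu> (Pair \<mu> -` G) \<partial>Q)"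
  proof (rule countably_additiveI)
    fix G :: "nat \<Rightarrow> ('a measure \<times> 'a) set"
    assume "range G \<subseteq> sets (campbell Q)" and dis: "disjoint_family G"
    then have G: "G i \<in> sets (N \<Otimes>\<^sub>M M)" for i
      by (auto simp: campbell_def sets.sigma_sets_eq)
    have "(\<integral>\<^sup>+\<mu>. emeasure \<mu> (Pair \<mu> -` (\<Union>i. G i)) \<partial>Q) = (\<integral>\<^sup>+\<mu>. (\<Sum>i. emeasure \<mu> (Pair \<mu> -` G i)) \<partial>Q)"
      using dis sets_Pair1[OF G] unfolding vimage_UN
      by (intro nn_integral_cong suminf_emeasure[symmetric]) (auto simp: space_Q' disjoint_family_on_def)
    also have "\<dots> = (\<Sum>i. \<integral>\<^sup>+\<mu>. emeasure \<mu> (Pair \<mu> -` G i) \<partial>Q)"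
      by (intro nn_integral_suminf measurable_emeasure_kernel[OF measurable_ident_sets[OF sets_Q]])
        (simp add: G sets_pair_measure_cong[OF sets_Q refl])
    finally show "(\<Sum>i. \<integral>\<^sup>+\<mu>. emeasure \<mu> (Pair \<mu> -` G i) \<partial>Q) = (\<integral>\<^sup>+\<mu>. emeasure \<mu> (Pair \<mu> -` (\<Union>i. G i)) \<partial>Q)" ..
  qed
qed

text \<open>Rectangles with a local side are already settled. The sets \<open>B n\<close> serve
  twice: they exhaust a general side, and they supply the finite masses needed for
  uniqueness.\<close>

lemma campbell_eq_palm: "campbell Q = palm Q"
proof (rule measure_eqI_generator_eq[where A = "\<lambda>n. space N \<times> B n"])
  let ?E = "{a \<times> b | a b. a \<in> sets N \<and> b \<in> sets M}"
  show "Int_stable ?E" by (rule Int_stable_pair_measure_generator)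
  show "?E \<subseteq> Pow (space N \<times> space M)" by (rule pair_measure_closed)
  have sC: "sets (campbell Q) = sets (N \<Otimes>\<^sub>M M)" by (simp add: campbell_def sets.sigma_sets_eq)
  then show "sets (campbell Q) = sigma_sets (space N \<times> space M) ?E"
    "sets (palm Q) = sigma_sets (space N \<times> space M) ?E" by (simp_all add: sets_pair_measure)
  have local: "emeasure (campbell Q) (X \<times> Y) = (\<integral>\<^sup>+x. \<integral>\<^sup>+\<mu>. indicator Y x * indicator X (add_point \<mu> x) \<partial>Q \<partial>\<Lambda>)"
    if XY: "X \<in> sets N" "Y \<in> L" for X Y
  proof -
    have "emeasure (campbell Q) (X \<times> Y) = (\<integral>\<^sup>+\<mu>. emeasure \<mu> Y * indicator X \<mu> \<partial>Q)"
      using XY L_sets by (subst emeasure_campbell) (auto intro!: nn_integral_cong split: split_indicator)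
    then show ?thesis by (simp only: mecke_rectangle[OF XY(2,1)])
  qed
  have local_palm: "emeasure (palm Q) (X \<times> Y) = (\<integral>\<^sup>+x. \<integral>\<^sup>+\<mu>. indicator Y x * indicator X (add_point \<mu> x) \<partial>Q \<partial>\<Lambda>)"
    if [measurable]: "X \<in> sets N" "Y \<in> sets M" for X Y
  proof -
    have "emeasure (palm Q) (X \<times> Y) = (\<integral>\<^sup>+z. indicator (X \<times> Y) z \<partial>palm Q)" by simp
    also have "\<dots> = (\<integral>\<^sup>+x. \<integral>\<^sup>+\<mu>. indicator (X \<times> Y) (add_point \<mu> x, x) \<partial>Q \<partial>\<Lambda>)"
      by (rule nn_integral_palm) measurable
    finally show ?thesis by (simp add: indicator_times mult.commute)
  qed
  show "range (\<lambda>n. space N \<times> B n) \<subseteq> ?E"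
  proof (rule image_subsetI)
    fix n show "space N \<times> B n \<in> ?E"
      by (rule CollectI, rule exI[of _ "space N"], rule exI[of _ "B n"]) simp
  qed
  show "(\<Union>n. space N \<times> B n) = space N \<times> space M" using UN_B by auto
  show "emeasure (campbell Q) (space N \<times> B n) \<noteq> \<infinity>" for n
  proof -
    have "emeasure (campbell Q) (space N \<times> B n) \<le> (\<integral>\<^sup>+x. \<integral>\<^sup>+\<mu>. indicator (B n) x \<partial>Q \<partial>\<Lambda>)"
      unfolding local[OF sets.top B_in_L] by (intro nn_integral_mono) (simp split: split_indicator)
    also have "\<dots> = emeasure \<Lambda> (B n)" by (simp add: Q.emeasure_space_1)
    finally show ?thesis using \<Lambda>_finite[OF B_in_L, of n] by (auto simp: top_unique)
  qed
  fix G assume "G \<in> ?E"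
  then obtain X Y where XY [measurable]: "X \<in> sets N" "Y \<in> sets M" and G: "G = X \<times> Y" by auto
  have SUP: "emeasure K G = (SUP n. emeasure K (X \<times> (Y \<inter> B n)))"
    if K: "sets K = sets (N \<Otimes>\<^sub>M M)" for K :: "('a measure \<times> 'a) measure"
  proof -
    have "G = (\<Union>n. X \<times> (Y \<inter> B n))" using UN_B sets.sets_into_space[OF XY(2)] by (auto simp: G)
    then show ?thesis
      using incseq_B by (subst SUP_emeasure_incseq) (auto simp: K incseq_def)
  qed
  have "Y \<inter> B n \<in> L" for n by (rule L_subset[OF B_in_L]) auto
  then show "emeasure (campbell Q) G = emeasure (palm Q) G"
    unfolding SUP[OF sC] SUP[OF sets_palm] by (simp add: local local_palm)
qed

lemma nn_integral_campbell:
  assumes h: "h \<in> borel_measurable (N \<Otimes>\<^sub>M M)"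
  shows "(\<integral>\<^sup>+\<mu>. \<integral>\<^sup>+x. h (\<mu>, x) \<partial>\<mu> \<partial>Q) = (\<integral>\<^sup>+z. h z \<partial>campbell Q)"
proof -
  have sC: "sets (campbell Q) = sets (N \<Otimes>\<^sub>M M)" by (simp add: campbell_def sets.sigma_sets_eq)
  then have spC: "space (campbell Q) = space (N \<Otimes>\<^sub>M M)" by (rule sets_eq_imp_space_eq)
  note [measurable_cong] = sC
  have mb: "(\<lambda>x. u (\<mu>, x)) \<in> borel_measurable \<mu>"
    if "u \<in> borel_measurable (N \<Otimes>\<^sub>M M)" "\<mu> \<in> space Q" for u :: "'a measure \<times> 'a \<Rightarrow> ennreal" and \<mu>
    using that by (simp add: space_Q' cong: measurable_cong_sets)
  have mK: "(\<lambda>\<mu>. \<integral>\<^sup>+x. u (\<mu>, x) \<partial>\<mu>) \<in> borel_measurable Q"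
    if "u \<in> borel_measurable (N \<Otimes>\<^sub>M M)" for u :: "'a measure \<times> 'a \<Rightarrow> ennreal"
    using measurable_nn_integral_kernel[of "\<lambda>\<mu> x. u (\<mu>, x)" N "\<lambda>\<mu>. \<mu>"] that
    by (simp add: case_prod_beta' cong: measurable_cong_sets)
  show ?thesis
    using h
  proof (induct rule: borel_measurable_induct)
    case (cong f g)
    have "(\<integral>\<^sup>+\<mu>. \<integral>\<^sup>+x. f (\<mu>, x) \<partial>\<mu> \<partial>Q) = (\<integral>\<^sup>+\<mu>. \<integral>\<^sup>+x. g (\<mu>, x) \<partial>\<mu> \<partial>Q)"
      using cong(3) by (intro nn_integral_cong) (simp add: space_pair_measure space_Q')
    moreover have "(\<integral>\<^sup>+z. f z \<partial>campbell Q) = (\<integral>\<^sup>+z. g z \<partial>campbell Q)"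
      using cong(3) by (intro nn_integral_cong) (simp add: spC)
    ultimately show ?case using cong(4) by simp
  next
    case (set G)
    have "(\<integral>\<^sup>+x. indicator G (\<mu>, x) \<partial>\<mu>) = emeasure \<mu> (Pair \<mu> -` G)" if "\<mu> \<in> space Q" for \<mu>
    proof -
      have "(\<lambda>x. indicator G (\<mu>, x)) = (indicator (Pair \<mu> -` G) :: 'a \<Rightarrow> ennreal)"
        by (auto simp: indicator_def)
      then show ?thesis using that sets_Pair1[OF set] by (simp add: space_Q')
    qed
    then show ?case
      using set by (simp add: sC emeasure_campbell cong: nn_integral_cong)
  next
    case (mult u c)
    then show ?case
      using mb[OF mult(2)] mK[OF mult(2)] by (simp add: nn_integral_cmult cong: nn_integral_cong)
  next
    case (add u v)
    then show ?case
      using mb[OF add(1)] mb[OF add(4)] mK[OF add(1)] mK[OF add(4)]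
      by (simp add: nn_integral_add cong: nn_integral_cong)
  next
    case (seq U)
    note [measurable] = seq(1)
    have inc: "U i z \<le> U (Suc i) z" for i z
      using incseq_SucD[OF \<open>incseq U\<close>] by (rule le_funD)
    have "(\<integral>\<^sup>+\<mu>. \<integral>\<^sup>+x. (SUP i. U i (\<mu>, x)) \<partial>\<mu> \<partial>Q) = (\<integral>\<^sup>+\<mu>. (SUP i. \<integral>\<^sup>+x. U i (\<mu>, x) \<partial>\<mu>) \<partial>Q)"
      using mb[OF seq(1)] inc
      by (intro nn_integral_cong nn_integral_monotone_convergence_SUP) (auto simp: incseq_Suc_iff le_fun_def)
    also have "\<dots> = (SUP i. \<integral>\<^sup>+\<mu>. \<integral>\<^sup>+x. U i (\<mu>, x) \<partial>\<mu> \<partial>Q)"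
      using mK[OF seq(1)] inc
      by (intro nn_integral_monotone_convergence_SUP) (auto simp: incseq_Suc_iff le_fun_def intro!: nn_integral_mono)
    also have "\<dots> = (\<integral>\<^sup>+z. (SUP i. U i z) \<partial>campbell Q)"
      unfolding seq(3) by (rule nn_integral_monotone_convergence_SUP[OF \<open>incseq U\<close>, symmetric]) measurable
    finally show ?case by (simp add: SUP_apply image_comp)
  qed
qed

lemma mecke_of_poisson: "mecke Q"
  unfolding mecke_def
proof (intro allI impI)
  fix h :: "'a measure \<Rightarrow> 'a \<Rightarrow> ennreal" assume h: "(\<lambda>(\<mu>, x). h \<mu> x) \<in> borel_measurable (N \<Otimes>\<^sub>M M)"
  show "(\<integral>\<^sup>+\<mu>. \<integral>\<^sup>+x. h \<mu> x \<partial>\<mu> \<partial>Q) = (\<integral>\<^sup>+x. \<integral>\<^sup>+\<mu>. h (add_point \<mu> x) x \<partial>Q \<partial>\<Lambda>)"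
    using trans[OF nn_integral_campbell[OF h, unfolded campbell_eq_palm] nn_integral_palm[OF h]]
    by (simp only: prod.case)
qed

end

end

section \<open>Families of measures linked by the Mecke equation\<close>

context localized_space
begin

text \<open>Binomial coefficients need natural counts. An infinite mass would be read as 0, so the
  identities below are confined to local sets.\<close>

definition cnt :: "'a measure \<Rightarrow> 'a set \<Rightarrow> nat" where
  "cnt \<mu> A = nat \<lfloor>enn2real (emeasure \<mu> A)\<rfloor>"

lemma emeasure_eq_cnt:
  assumes "\<mu> \<in> space N" "A \<in> L" shows "emeasure \<mu> A = of_nat (cnt \<mu> A)"
proof -
  obtain k :: nat where k: "emeasure \<mu> A = of_nat k" using N_nat[OF assms] by blast
  then have "cnt \<mu> A = k" by (simp add: cnt_def ennreal_of_nat_eq_real_of_nat)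
  with k show ?thesis by simp
qed

lemma measurable_cnt [measurable]: "A \<in> sets M \<Longrightarrow> (\<lambda>\<mu>. cnt \<mu> A) \<in> measurable N (count_space UNIV)"
  unfolding cnt_def by measurable

lemma cnt_add_point:
  assumes \<mu>: "\<mu> \<in> space N" and A: "A \<in> L" "x \<in> A"
  shows "cnt (add_point \<mu> x) A = Suc (cnt \<mu> A)"
proof -
  have "emeasure (add_point \<mu> x) A = emeasure \<mu> A + 1"
    using \<mu> A L_sets by (simp add: emeasure_add_measure)
  then have "of_nat (cnt (add_point \<mu> x) A) = (of_nat (Suc (cnt \<mu> A)) :: ennreal)"
    using emeasure_eq_cnt[OF add_in_N[OF \<mu> return_in_N] A(1)] emeasure_eq_cnt[OF \<mu> A(1)] by simp
  then show ?thesis by (simp only: of_nat_eq_iff)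
qed

end

lemma ennreal_of_nat_mult_cancel:
  fixes a b :: ennreal
  assumes "of_nat k * a = of_nat k * b" "0 < k"
  shows "a = b"
  using assms by (auto simp: ennreal_mult_cancel_left)

text \<open>Inclusion-exclusion: with \<open>n\<close> the number of points in a set, this writes
  the indicator of the void event through factorial moments.\<close>

lemma suminf_alternating_choose:
  "(\<Sum>k. (- 1) ^ k * real (n choose k)) = (if n = 0 then 1 else 0)"
proof -
  have "(\<Sum>k. (- 1) ^ k * real (n choose k)) = (\<Sum>k\<le>n. (- 1) ^ k * real (n choose k))"
    by (rule suminf_finite) (auto simp: binomial_eq_0)
  also have "\<dots> = (if n = 0 then 1 else 0)"
    using choose_alternating_sum[of n, where ?'a = real] by auto
  finally show ?thesis .
qed

context intensity_space
begin

text \<open>The measures \<open>m i\<close> are not assumed to satisfy the Mecke equation individually: adding a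
  point may change the index. The common total mass replaces the missing initial condition.\<close>

context
  fixes m :: "'i \<Rightarrow> 'a measure measure" and I :: "'i set" and \<sigma> :: "'i \<Rightarrow> 'a \<Rightarrow> 'i" and c :: real
  assumes c: "0 \<le> c"
    and sets_m: "\<And>i. i \<in> I \<Longrightarrow> sets (m i) = sets N"
    and mass: "\<And>i. i \<in> I \<Longrightarrow> emeasure (m i) (space N) = ennreal c"
    and \<sigma>: "\<And>i x. i \<in> I \<Longrightarrow> x \<in> space M \<Longrightarrow> \<sigma> i x \<in> I"
    and mecke_m: "\<And>i h. i \<in> I \<Longrightarrow> (\<lambda>(\<mu>, x). h \<mu> x) \<in> borel_measurable (N \<Otimes>\<^sub>M M) \<Longrightarrow>
      (\<integral>\<^sup>+\<mu>. \<integral>\<^sup>+x. h \<mu> x \<partial>\<mu> \<partial>m i) = (\<integral>\<^sup>+x. \<integral>\<^sup>+\<mu>. h (add_point \<mu> x) x \<partial>m (\<sigma> i x) \<partial>\<Lambda>)"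
begin

lemma space_m: "i \<in> I \<Longrightarrow> space (m i) = space N"
  by (rule sets_eq_imp_space_eq) (rule sets_m)

text \<open>Marking one of k + 1 chosen points and removing it by the Mecke equation lowers the
  order by one. The index may change, but the induction hypothesis does not depend on it; the common
  mass \<open>c\<close> starts the induction.\<close>

lemma factorial_moment:
  assumes A: "A \<in> L" and "i \<in> I"
  shows "(\<integral>\<^sup>+\<mu>. of_nat (cnt \<mu> A choose k) \<partial>m i) = ennreal (c * measure \<Lambda> A ^ k / fact k)"
  using \<open>i \<in> I\<close>
proof (induction k arbitrary: i)
  case 0
  then show ?case using mass[of i] by (simp add: space_m)
next
  case (Suc k)
  note [measurable] = L_sets[OF A]
  note [measurable_cong] = sets_m[OF Suc.prems]
  let ?l = "measure \<Lambda> A"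
  have "of_nat (Suc k) * (\<integral>\<^sup>+\<mu>. of_nat (cnt \<mu> A choose Suc k) \<partial>m i) =
      (\<integral>\<^sup>+\<mu>. of_nat (Suc k) * of_nat (cnt \<mu> A choose Suc k) \<partial>m i)"
    by (rule nn_integral_cmult[symmetric]) measurable
  also have "\<dots> = (\<integral>\<^sup>+\<mu>. \<integral>\<^sup>+x. of_nat ((cnt \<mu> A - 1) choose k) * indicator A x \<partial>\<mu> \<partial>m i)"
  proof (rule nn_integral_cong)
    fix \<mu> assume "\<mu> \<in> space (m i)"
    then have \<mu>: "\<mu> \<in> space N" using Suc.prems by (simp add: space_m)
    \<comment> \<open>Both sides count the choices of k + 1 points with one of them marked. For
      count 0 the truncated \<open>cnt \<mu> A - 1\<close> does no harm, since it is multiplied by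
      \<open>cnt \<mu> A\<close>.\<close>
    have "Suc k * (cnt \<mu> A choose Suc k) = ((cnt \<mu> A - 1) choose k) * cnt \<mu> A"
      by (cases "cnt \<mu> A") (simp_all only: Suc_times_binomial diff_Suc_1 mult.commute binomial_0_Suc mult_0)
    then have "of_nat (Suc k) * of_nat (cnt \<mu> A choose Suc k) =
        (of_nat ((cnt \<mu> A - 1) choose k) * of_nat (cnt \<mu> A) :: ennreal)"
      by (simp only: of_nat_mult[symmetric])
    also have "\<dots> = (\<integral>\<^sup>+x. of_nat ((cnt \<mu> A - 1) choose k) * indicator A x \<partial>\<mu>)"
      using \<mu> A by (subst nn_integral_cmult_indicator) (simp_all add: L_sets emeasure_eq_cnt)
    finally show "of_nat (Suc k) * of_nat (cnt \<mu> A choose Suc k) =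
        (\<integral>\<^sup>+x. of_nat ((cnt \<mu> A - 1) choose k) * indicator A x \<partial>\<mu>)" .
  qed
  also have "\<dots> = (\<integral>\<^sup>+x. \<integral>\<^sup>+\<mu>. of_nat ((cnt (add_point \<mu> x) A - 1) choose k) * indicator A x \<partial>m (\<sigma> i x) \<partial>\<Lambda>)"
    by (rule mecke_m[OF Suc.prems]) measurable
  also have "\<dots> = (\<integral>\<^sup>+x. ennreal (c * ?l ^ k / fact k) * indicator A x \<partial>\<Lambda>)"
  proof (rule nn_integral_cong)
    fix x assume "x \<in> space \<Lambda>"
    then have s: "\<sigma> i x \<in> I" using \<sigma> Suc.prems by simp
    show "(\<integral>\<^sup>+\<mu>. of_nat ((cnt (add_point \<mu> x) A - 1) choose k) * indicator A x \<partial>m (\<sigma> i x))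
        = ennreal (c * ?l ^ k / fact k) * indicator A x"
    proof (cases "x \<in> A")
      case True
      have "(\<integral>\<^sup>+\<mu>. of_nat ((cnt (add_point \<mu> x) A - 1) choose k) * indicator A x \<partial>m (\<sigma> i x))
          = (\<integral>\<^sup>+\<mu>. of_nat (cnt \<mu> A choose k) \<partial>m (\<sigma> i x))"
        using True A s by (intro nn_integral_cong) (simp add: cnt_add_point space_m)
      then show ?thesis using True Suc.IH[OF s] by simp
    qed simp
  qed
  also have "\<dots> = ennreal (c * ?l ^ k / fact k) * ennreal ?l"
    using emeasure_\<Lambda>[OF A] by (simp add: nn_integral_cmult_indicator)
  also have "\<dots> = of_nat (Suc k) * ennreal (c * ?l ^ Suc k / fact (Suc k))"
    unfolding ennreal_of_nat_eq_real_of_nat using c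
    by (subst (1 2) ennreal_mult[symmetric]) (auto simp: field_simps simp del: of_nat_Suc)
  finally show ?case by (rule ennreal_of_nat_mult_cancel) simp
qed

text \<open>The alternating binomial series is integrated term by term. Absolute convergence holds
  because the factorial moments sum to \<open>c * exp (measure \<Lambda> A)\<close>; with
  alternating signs the same series has the asserted value.\<close>

lemma void_mass:
  assumes A: "A \<in> L" and i: "i \<in> I"
  shows "emeasure (m i) {\<mu>\<in>space N. emeasure \<mu> A = 0} = ennreal (c * exp (- measure \<Lambda> A))"
proof -
  let ?l = "measure \<Lambda> A"
  note [measurable] = L_sets[OF A]
  note [measurable_cong] = sets_m[OF i]
  interpret m: finite_measure "m i"
    by standard (simp add: space_m[OF i] mass[OF i])
  define g where "g k \<mu> = (- 1) ^ k * real (cnt \<mu> A choose k)" for k \<mu>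
  have [measurable]: "g k \<in> borel_measurable (m i)" for k
    unfolding g_def by measurable
  have norm_g: "norm (g k \<mu>) = real (cnt \<mu> A choose k)" for k \<mu>
    by (simp add: g_def abs_mult power_abs)
  have nn: "(\<integral>\<^sup>+\<mu>. ennreal (real (cnt \<mu> A choose k)) \<partial>m i) = ennreal (c * ?l ^ k / fact k)" for k
    using factorial_moment[OF A i] by (simp add: ennreal_of_nat_eq_real_of_nat)
  have int: "integrable (m i) (g k)" for k
  proof (rule integrableI_bounded)
    show "(\<integral>\<^sup>+\<mu>. ennreal (norm (g k \<mu>)) \<partial>m i) < \<infinity>"
      unfolding norm_g nn by simp
  qed simp
  have int_choose: "(LINT \<mu>|m i. real (cnt \<mu> A choose k)) = c * ?l ^ k / fact k" for k
    by (subst integral_eq_nn_integral) (simp_all add: nn c)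
  have exp: "(\<lambda>k. c * y ^ k / fact k) sums (c * exp y)" for y :: real
    using sums_mult[OF exp_converges[of y], of c] by (simp add: scaleR_conv_of_real field_simps)
  have pt: "(\<Sum>k. g k \<mu>) = indicator {\<mu>\<in>space N. emeasure \<mu> A = 0} \<mu>" if "\<mu> \<in> space (m i)" for \<mu>
    using emeasure_eq_cnt[OF _ A, of \<mu>] that
    by (simp add: g_def suminf_alternating_choose space_m[OF i] indicator_def)
  have "(LINT \<mu>|m i. (\<Sum>k. g k \<mu>)) = (\<Sum>k. LINT \<mu>|m i. g k \<mu>)"
  proof (rule integral_suminf[OF int])
    show "AE \<mu> in m i. summable (\<lambda>k. norm (g k \<mu>))"
    proof (rule AE_I2)
      fix \<mu> show "summable (\<lambda>k. norm (g k \<mu>))"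
        unfolding norm_g by (rule summable_finite[of "{..cnt \<mu> A}"]) (auto simp: binomial_eq_0)
    qed
    show "summable (\<lambda>k. LINT \<mu>|m i. norm (g k \<mu>))"
      unfolding norm_g int_choose using exp[of ?l] by (rule sums_summable)
  qed
  also have "\<dots> = (\<Sum>k. c * (- ?l) ^ k / fact k)"
  proof (rule suminf_cong)
    fix k show "(LINT \<mu>|m i. g k \<mu>) = c * (- ?l) ^ k / fact k"
      using int_choose[of k] power_minus[of ?l k] by (simp add: g_def)
  qed
  also have "\<dots> = c * exp (- ?l)"
    using exp[of "- ?l"] by (rule sums_unique[symmetric])
  finally have "(LINT \<mu>|m i. (\<Sum>k. g k \<mu>)) = c * exp (- ?l)" .
  moreover have "(LINT \<mu>|m i. (\<Sum>k. g k \<mu>)) = (LINT \<mu>|m i. indicator {\<mu>\<in>space N. emeasure \<mu> A = 0} \<mu>)"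
    by (intro Bochner_Integration.integral_cong refl pt)
  moreover have "\<dots> = measure (m i) {\<mu>\<in>space N. emeasure \<mu> A = 0}"
    by (simp add: space_m[OF i])
  ultimately show ?thesis by (simp add: m.emeasure_eq_measure)
qed

text \<open>Induction on the total count. With no points the event says that the union of the cells
  is void. Otherwise a point of an occupied cell is removed by the Mecke equation, and the change of
  index is absorbed because the claim is the same for all indices.\<close>

lemma cyl_mass:
  assumes \<C>: "finite \<C>" "\<C> \<subseteq> L" "disjoint \<C>" and "i \<in> I"
  shows "emeasure (m i) (cyl \<C> n) = ennreal c * pois_cyl \<C> n"
  using \<open>i \<in> I\<close>
proof (induction "\<Sum>C\<in>\<C>. n C" arbitrary: i n)
  case 0
  then have n0: "n C = 0" if "C \<in> \<C>" for C using that \<C>(1) by simp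
  have U: "\<Union>\<C> \<in> L" using \<C> by (intro L_Union)
  have sum: "emeasure \<mu> (\<Union>\<C>) = (\<Sum>C\<in>\<C>. emeasure \<mu> C)" if "sets \<mu> = sets M" for \<mu>
  proof -
    have "(\<Sum>C\<in>\<C>. emeasure \<mu> C) = emeasure \<mu> (\<Union>C\<in>\<C>. C)"
      using \<C> that L_sets by (intro sum_emeasure) (auto simp: disjoint_family_on_def disjoint_def)
    then show ?thesis by simp
  qed
  have "cyl \<C> n = {\<mu>\<in>space N. emeasure \<mu> (\<Union>\<C>) = 0}"
    using n0 \<C>(1) by (auto simp: cyl_def sum)
  then have "emeasure (m i) (cyl \<C> n) = ennreal (c * exp (- measure \<Lambda> (\<Union>\<C>)))"
    using void_mass[OF U 0(2)] by simp
  also have "measure \<Lambda> (\<Union>\<C>) = (\<Sum>C\<in>\<C>. measure \<Lambda> C)"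
  proof -
    have "ennreal (measure \<Lambda> (\<Union>\<C>)) = (\<Sum>C\<in>\<C>. ennreal (measure \<Lambda> C))"
      using sum[OF sets_\<Lambda>] emeasure_\<Lambda>[OF U] emeasure_\<Lambda> \<C>(2) by (simp add: subset_eq cong: sum.cong)
    then show ?thesis by (simp add: sum_nonneg)
  qed
  also have "ennreal (c * exp (- (\<Sum>C\<in>\<C>. measure \<Lambda> C))) = ennreal c * (\<Prod>C\<in>\<C>. ennreal (exp (- measure \<Lambda> C)))"
    using c \<C>(1) by (simp add: ennreal_mult' prod_ennreal exp_sum sum_negf[symmetric])
  also have "(\<Prod>C\<in>\<C>. ennreal (exp (- measure \<Lambda> C))) = pois_cyl \<C> n"
    unfolding pois_cyl_def by (intro prod.cong refl) (simp add: n0 pois_def)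
  finally show ?case .
next
  case (Suc s)
  note [measurable] = cyl_sets[OF \<C>(1,2)]
  note [measurable_cong] = sets_m[OF Suc.prems]
  have "(\<Sum>C\<in>\<C>. n C) \<noteq> 0" using Suc.hyps(2) by simp
  then obtain C where C: "C \<in> \<C>" "0 < n C" using \<C>(1) by auto
  have CM [measurable]: "C \<in> sets M" using C \<C> L_sets by auto
  let ?n = "n(C := n C - 1)"
  have s: "s = (\<Sum>D\<in>\<C>. ?n D)"
  proof -
    have "(\<Sum>D\<in>\<C> - {C}. ?n D) = (\<Sum>D\<in>\<C> - {C}. n D)" by (rule sum.cong) auto
    then show ?thesis using Suc.hyps(2) C \<C>(1) by (simp add: sum.remove[of \<C> C])
  qed
  have "of_nat (n C) * emeasure (m i) (cyl \<C> n) = (\<integral>\<^sup>+\<mu>. of_nat (n C) * indicator (cyl \<C> n) \<mu> \<partial>m i)"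
    by (subst nn_integral_cmult_indicator) (simp_all add: sets_m[OF Suc.prems])
  also have "\<dots> = (\<integral>\<^sup>+\<mu>. \<integral>\<^sup>+x. indicator (cyl \<C> n) \<mu> * indicator C x \<partial>\<mu> \<partial>m i)"
  proof (rule nn_integral_cong)
    fix \<mu> assume "\<mu> \<in> space (m i)"
    then have "sets \<mu> = sets M" by (simp add: space_m[OF Suc.prems])
    then have "(\<integral>\<^sup>+x. indicator (cyl \<C> n) \<mu> * indicator C x \<partial>\<mu>) = indicator (cyl \<C> n) \<mu> * emeasure \<mu> C"
      by (subst nn_integral_cmult_indicator) auto
    then show "of_nat (n C) * indicator (cyl \<C> n) \<mu> = (\<integral>\<^sup>+x. indicator (cyl \<C> n) \<mu> * indicator C x \<partial>\<mu>)"
      using C(1) by (auto simp: indicator_def cyl_def)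
  qed
  also have "\<dots> = (\<integral>\<^sup>+x. \<integral>\<^sup>+\<mu>. indicator (cyl \<C> n) (add_point \<mu> x) * indicator C x \<partial>m (\<sigma> i x) \<partial>\<Lambda>)"
    by (rule mecke_m[OF Suc.prems]) measurable
  also have "\<dots> = (\<integral>\<^sup>+x. (ennreal c * pois_cyl \<C> ?n) * indicator C x \<partial>\<Lambda>)"
  proof (rule nn_integral_cong)
    fix x assume "x \<in> space \<Lambda>"
    then have \<sigma>I: "\<sigma> i x \<in> I" using \<sigma> Suc.prems by simp
    show "(\<integral>\<^sup>+\<mu>. indicator (cyl \<C> n) (add_point \<mu> x) * indicator C x \<partial>m (\<sigma> i x))
        = (ennreal c * pois_cyl \<C> ?n) * indicator C x"
    proof (cases "x \<in> C")
      case True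
      have "(\<integral>\<^sup>+\<mu>. indicator (cyl \<C> n) (add_point \<mu> x) * indicator C x \<partial>m (\<sigma> i x))
          = (\<integral>\<^sup>+\<mu>. indicator (cyl \<C> ?n) \<mu> \<partial>m (\<sigma> i x))"
        using True C(2) add_point_in_cyl_iff[OF _ \<C>(2,3) C(1) True]
        by (intro nn_integral_cong) (simp add: indicator_def space_m[OF \<sigma>I])
      also have "\<dots> = emeasure (m (\<sigma> i x)) (cyl \<C> ?n)"
        by (rule nn_integral_indicator) (simp add: sets_m[OF \<sigma>I])
      also have "\<dots> = ennreal c * pois_cyl \<C> ?n"
        by (rule Suc.hyps(1)[OF s \<sigma>I])
      finally show ?thesis using True by simp
    qed simp
  qed
  also have "\<dots> = ennreal c * (emeasure \<Lambda> C * pois_cyl \<C> ?n)"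
    by (subst nn_integral_cmult_indicator) (simp_all add: ac_simps)
  also have "\<dots> = of_nat (n C) * (ennreal c * pois_cyl \<C> n)"
    unfolding pois_cyl_step[where n = n, OF \<C>(1,2) C, symmetric] by (simp only: ac_simps)
  finally show ?case by (rule ennreal_of_nat_mult_cancel) (rule C(2))
qed

end

end

section \<open>Stopping sets\<close>

context localized_space
begin

definition agree :: "'a measure \<Rightarrow> 'a measure \<Rightarrow> 'a set \<Rightarrow> bool" where
  "agree \<mu> \<nu> S \<longleftrightarrow> (\<forall>A\<in>sets M. A \<subseteq> S \<longrightarrow> emeasure \<mu> A = emeasure \<nu> A)"

text \<open>The pointwise form of the stopping property: agreement on the explored set forces the
  same explored set. The configuration comes first in the product, as in the Mecke equation.\<close>

definition stops :: "('a measure \<Rightarrow> 'a set) \<Rightarrow> bool" where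
  "stops Z \<longleftrightarrow> (\<forall>\<mu>\<in>space N. Z \<mu> \<in> sets M) \<and> Measurable.pred (N \<Otimes>\<^sub>M M) (\<lambda>(\<mu>, x). x \<in> Z \<mu>) \<and>
    (\<forall>\<mu>\<in>space N. \<forall>\<nu>\<in>space N. agree \<mu> \<nu> (Z \<mu>) \<longrightarrow> Z \<nu> = Z \<mu>)"

definition glue :: "'a set \<Rightarrow> 'a measure \<Rightarrow> 'a measure \<Rightarrow> 'a measure" where
  "glue S \<mu> \<nu> = add_measure (restr \<mu> S) (restr \<nu> (space M - S))"

lemma add_point_in_N: "\<mu> \<in> space N \<Longrightarrow> add_point \<mu> x \<in> space N"
  by (rule add_in_N[OF _ return_in_N])

lemma emeasure_add_point:
  "\<mu> \<in> space N \<Longrightarrow> A \<in> sets M \<Longrightarrow> emeasure (add_point \<mu> x) A = emeasure \<mu> A + indicator A x"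
  by (simp add: emeasure_add_measure)

lemma glue_in_N: "\<mu> \<in> space N \<Longrightarrow> \<nu> \<in> space N \<Longrightarrow> S \<in> sets M \<Longrightarrow> glue S \<mu> \<nu> \<in> space N"
  unfolding glue_def by (intro add_in_N restr_in_N) auto

lemma emeasure_glue:
  assumes "\<mu> \<in> space N" "\<nu> \<in> space N" "S \<in> sets M" "A \<in> sets M"
  shows "emeasure (glue S \<mu> \<nu>) A = emeasure \<mu> (A \<inter> S) + emeasure \<nu> (A - S)"
proof -
  have "A \<inter> (space M - S) = A - S" using sets.sets_into_space[OF assms(4)] by auto
  then show ?thesis
    using assms by (simp add: glue_def emeasure_add_measure emeasure_restr)
qed

lemma N_eqI:
  assumes "\<mu> \<in> space N" "\<nu> \<in> space N" "\<And>A. A \<in> sets M \<Longrightarrow> emeasure \<mu> A = emeasure \<nu> A"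
  shows "\<mu> = \<nu>"
  using assms by (intro measure_eqI) auto

lemma glue_agree:
  assumes "\<mu> \<in> space N" "\<nu> \<in> space N" "S \<in> sets M" "agree \<mu> \<nu> S"
  shows "glue S \<mu> \<nu> = \<nu>"
proof (rule N_eqI[OF glue_in_N[OF assms(1-3)] assms(2)])
  fix A assume A: "A \<in> sets M"
  have "emeasure (glue S \<mu> \<nu>) A = emeasure \<nu> (A \<inter> S) + emeasure \<nu> (A - S)"
    using assms A by (simp add: emeasure_glue agree_def)
  also have "\<dots> = emeasure \<nu> ((A \<inter> S) \<union> (A - S))"
    using assms A by (intro plus_emeasure) auto
  also have "(A \<inter> S) \<union> (A - S) = A" by auto
  finally show "emeasure (glue S \<mu> \<nu>) A = emeasure \<nu> A" .
qed

text \<open>If \<mu> and \<nu> agree on \<open>Z \<mu>\<close>, then gluing \<mu> on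
  \<open>Z \<mu>\<close> with \<nu> elsewhere returns \<nu>; the stopping identity is applied to
  this pair.\<close>

lemma stops_of_stopping_set:
  assumes "stopping_set M B Z" shows "stops Z"
  unfolding stops_def
proof (intro conjI ballI impI)
  show "\<mu> \<in> space N \<Longrightarrow> Z \<mu> \<in> sets M" for \<mu>
    using assms by (simp add: stopping_set_def space_counting_space)
  have [measurable]: "Measurable.pred (M \<Otimes>\<^sub>M N) (\<lambda>(x, \<mu>). x \<in> Z \<mu>)"
    using assms by (simp add: stopping_set_def)
  have "Measurable.pred (N \<Otimes>\<^sub>M M) (\<lambda>z. (\<lambda>(x, \<mu>). x \<in> Z \<mu>) (snd z, fst z))"
    by measurable
  then show "Measurable.pred (N \<Otimes>\<^sub>M M) (\<lambda>(\<mu>, x). x \<in> Z \<mu>)"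
    by (simp add: case_prod_beta')
  fix \<mu> \<nu> assume "\<mu> \<in> space N" "\<nu> \<in> space N" "agree \<mu> \<nu> (Z \<mu>)"
  moreover have "Z \<mu> \<in> sets M"
    using assms \<open>\<mu> \<in> space N\<close> by (simp add: stopping_set_def space_counting_space)
  ultimately have "glue (Z \<mu>) \<mu> \<nu> = \<nu>" by (intro glue_agree)
  moreover have "Z \<mu> = Z (glue (Z \<mu>) \<mu> \<nu>)"
    using assms \<open>\<mu> \<in> space N\<close> \<open>\<nu> \<in> space N\<close>
    unfolding glue_def stopping_set_def space_counting_space by blast
  ultimately show "Z \<nu> = Z \<mu>" by simp
qed

lemma stops_sets: "stops Z \<Longrightarrow> \<mu> \<in> space N \<Longrightarrow> Z \<mu> \<in> sets M"
  by (simp add: stops_def)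

lemma stops_agree: "stops Z \<Longrightarrow> \<mu> \<in> space N \<Longrightarrow> \<nu> \<in> space N \<Longrightarrow> agree \<mu> \<nu> (Z \<mu>) \<Longrightarrow> Z \<nu> = Z \<mu>"
  unfolding stops_def by blast

lemma stops_pred:
  assumes "stops Z" "f \<in> measurable \<Omega> N" "g \<in> measurable \<Omega> M"
  shows "Measurable.pred \<Omega> (\<lambda>\<omega>. g \<omega> \<in> Z (f \<omega>))"
proof -
  have [measurable]: "Measurable.pred (N \<Otimes>\<^sub>M M) (\<lambda>(\<mu>, x). x \<in> Z \<mu>)"
    using assms(1) by (simp add: stops_def)
  note [measurable] = assms(2,3)
  have "Measurable.pred \<Omega> (\<lambda>\<omega>. (\<lambda>(\<mu>, x). x \<in> Z \<mu>) (f \<omega>, g \<omega>))"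
    by measurable
  then show ?thesis by simp
qed

lemma agree_sym: "agree \<mu> \<nu> S \<Longrightarrow> agree \<nu> \<mu> S"
  by (simp add: agree_def)

lemma agree_mono: "agree \<mu> \<nu> S \<Longrightarrow> T \<subseteq> S \<Longrightarrow> agree \<mu> \<nu> T"
  by (auto simp: agree_def)

section \<open>Stopping sets under the addition of a point\<close>

lemma agree_add_point: "\<mu> \<in> space N \<Longrightarrow> y \<notin> S \<Longrightarrow> agree \<mu> (add_point \<mu> y) S"
  by (auto simp: agree_def emeasure_add_point indicator_def)

text \<open>A point outside the explored set is not seen. Used in both directions, this shows that
  adding a point at y never changes whether y is explored, so events of discovery survive the shift
  in the Mecke equation.\<close>

lemma stops_add_point:
  assumes Z: "stops Z" and \<mu>: "\<mu> \<in> space N"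
  shows "y \<notin> Z \<mu> \<Longrightarrow> Z (add_point \<mu> y) = Z \<mu>"
    and "y \<in> Z (add_point \<mu> y) \<longleftrightarrow> y \<in> Z \<mu>"
proof -
  note \<mu>y = add_point_in_N[OF \<mu>, of y]
  show *: "Z (add_point \<mu> y) = Z \<mu>" if "y \<notin> Z \<mu>"
    using Z \<mu> \<mu>y agree_add_point[OF \<mu> that] by (rule stops_agree)
  have "Z \<mu> = Z (add_point \<mu> y)" if "y \<notin> Z (add_point \<mu> y)"
    using Z \<mu>y \<mu> agree_sym[OF agree_add_point[OF \<mu> that]] by (rule stops_agree)
  with * show "y \<in> Z (add_point \<mu> y) \<longleftrightarrow> y \<in> Z \<mu>" by blast
qed

lemma stopsI:
  assumes "\<And>\<mu>. \<mu> \<in> space N \<Longrightarrow> Z \<mu> \<in> sets M"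
    and "Measurable.pred (N \<Otimes>\<^sub>M M) (\<lambda>z. snd z \<in> Z (fst z))"
    and "\<And>\<mu> \<nu>. \<mu> \<in> space N \<Longrightarrow> \<nu> \<in> space N \<Longrightarrow> agree \<mu> \<nu> (Z \<mu>) \<Longrightarrow> Z \<nu> = Z \<mu>"
  shows "stops Z"
  unfolding stops_def case_prod_beta' using assms by blast

text \<open>Adding the same point to two configurations preserves their agreement. Hence an
  exploration run on the shifted configuration still stops as a function of the original
  one.\<close>

lemma stops_shift:
  assumes Z: "stops Z" and y: "y \<in> space M"
  shows "stops (\<lambda>\<mu>. Z (add_point \<mu> y))"
proof (rule stopsI)
  fix \<mu> \<nu> assume \<mu>\<nu>: "\<mu> \<in> space N" "\<nu> \<in> space N" and a: "agree \<mu> \<nu> (Z (add_point \<mu> y))"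
  have "agree (add_point \<mu> y) (add_point \<nu> y) (Z (add_point \<mu> y))"
    unfolding agree_def
  proof (intro ballI impI)
    fix A assume "A \<in> sets M" "A \<subseteq> Z (add_point \<mu> y)"
    with a have "emeasure \<mu> A = emeasure \<nu> A" by (simp add: agree_def)
    with \<mu>\<nu> \<open>A \<in> sets M\<close> show "emeasure (add_point \<mu> y) A = emeasure (add_point \<nu> y) A"
      by (simp add: emeasure_add_point)
  qed
  then show "Z (add_point \<nu> y) = Z (add_point \<mu> y)"
    using \<mu>\<nu> by (intro stops_agree[OF Z] add_point_in_N)
next
  note [measurable] = y and [measurable (raw)] = stops_pred[OF Z]
  show "Measurable.pred (N \<Otimes>\<^sub>M M) (\<lambda>z. snd z \<in> Z (add_point (fst z) y))"
    by measurable
qed (simp add: stops_sets[OF Z] add_point_in_N)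

text \<open>This is the outer set that replaces \<open>U\<close> when y is added to the glued
  process. The case is decided by \<open>V \<mu>\<close>, which lies inside the new set and is
  therefore determined by agreement there. If y is outside \<open>V \<mu>\<close>, the inclusion
  persists because \<open>V\<close> does not see y.\<close>

lemma stops_switch:
  assumes V: "stops V" and U: "stops U" and VU: "\<And>\<mu>. \<mu> \<in> space N \<Longrightarrow> V \<mu> \<subseteq> U \<mu>" and y: "y \<in> space M"
  shows "stops (\<lambda>\<mu>. if y \<in> V \<mu> then U \<mu> else U (add_point \<mu> y))"
    and "\<mu> \<in> space N \<Longrightarrow> V \<mu> \<subseteq> (if y \<in> V \<mu> then U \<mu> else U (add_point \<mu> y))"
proof -
  show sub: "V \<mu> \<subseteq> (if y \<in> V \<mu> then U \<mu> else U (add_point \<mu> y))" if "\<mu> \<in> space N" for \<mu>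
    using VU[OF that] VU[OF add_point_in_N[OF that], of y] stops_add_point(1)[OF V that, of y]
    by (cases "y \<in> V \<mu>") simp_all
  show "stops (\<lambda>\<mu>. if y \<in> V \<mu> then U \<mu> else U (add_point \<mu> y))"
  proof (rule stopsI)
    fix \<mu> \<nu> assume \<mu>\<nu>: "\<mu> \<in> space N" "\<nu> \<in> space N"
      and a: "agree \<mu> \<nu> (if y \<in> V \<mu> then U \<mu> else U (add_point \<mu> y))"
    have "V \<nu> = V \<mu>"
      using V \<mu>\<nu> agree_mono[OF a sub[OF \<mu>\<nu>(1)]] by (rule stops_agree)
    moreover have "y \<in> V \<mu> \<Longrightarrow> U \<nu> = U \<mu>"
      using a by (intro stops_agree[OF U \<mu>\<nu>]) simp
    moreover have "y \<notin> V \<mu> \<Longrightarrow> U (add_point \<nu> y) = U (add_point \<mu> y)"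
      using a by (intro stops_agree[OF stops_shift[OF U y] \<mu>\<nu>]) simp
    ultimately show "(if y \<in> V \<nu> then U \<nu> else U (add_point \<nu> y)) = (if y \<in> V \<mu> then U \<mu> else U (add_point \<mu> y))"
      by simp
  next
    note [measurable] = y and [measurable (raw)] = stops_pred[OF V] stops_pred[OF U]
    have "Measurable.pred (N \<Otimes>\<^sub>M M) (\<lambda>z. (y \<in> V (fst z) \<and> snd z \<in> U (fst z)) \<or>
        (y \<notin> V (fst z) \<and> snd z \<in> U (add_point (fst z) y)))"
      by measurable
    then show "Measurable.pred (N \<Otimes>\<^sub>M M) (\<lambda>z. snd z \<in> (if y \<in> V (fst z) then U (fst z) else U (add_point (fst z) y)))"
      by (rule measurable_cong[THEN iffD1, rotated]) auto
  qed (simp add: stops_sets[OF U] add_point_in_N)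
qed

section \<open>Gluing two configurations along a set\<close>

lemma measurable_glue:
  assumes K [measurable]: "K \<in> measurable \<Omega> N" "K' \<in> measurable \<Omega> N"
    and S [measurable]: "Measurable.pred (\<Omega> \<Otimes>\<^sub>M M) (\<lambda>z. snd z \<in> S (fst z))"
    and S_sets: "\<And>\<omega>. \<omega> \<in> space \<Omega> \<Longrightarrow> S \<omega> \<in> sets M"
  shows "(\<lambda>\<omega>. glue (S \<omega>) (K \<omega>) (K' \<omega>)) \<in> measurable \<Omega> N"
  unfolding glue_def
proof (intro measurable_add_measure measurable_restr K)
  show "Measurable.pred (\<Omega> \<Otimes>\<^sub>M M) (\<lambda>(\<omega>, x). x \<in> S \<omega>)"
    using S by (simp add: case_prod_beta')
  have "Measurable.pred (\<Omega> \<Otimes>\<^sub>M M) (\<lambda>z. \<not> snd z \<in> S (fst z))"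
    by measurable
  then show "Measurable.pred (\<Omega> \<Otimes>\<^sub>M M) (\<lambda>(\<omega>, x). x \<in> space M - S \<omega>)"
    by (rule measurable_cong[THEN iffD1, rotated]) (auto simp: space_pair_measure)
qed (auto intro: S_sets)

lemma glue_add_point:
  assumes "\<mu> \<in> space N" "\<nu> \<in> space N" "S \<in> sets M"
  shows "y \<in> S \<Longrightarrow> glue S (add_point \<mu> y) \<nu> = add_point (glue S \<mu> \<nu>) y"
    and "y \<notin> S \<Longrightarrow> glue S (add_point \<mu> y) \<nu> = glue S \<mu> \<nu>"
    and "y \<notin> S \<Longrightarrow> glue S \<mu> (add_point \<nu> y) = add_point (glue S \<mu> \<nu>) y"
    and "y \<in> S \<Longrightarrow> glue S \<mu> (add_point \<nu> y) = glue S \<mu> \<nu>"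
  using assms
  by (auto intro!: N_eqI glue_in_N add_point_in_N
      simp: emeasure_glue emeasure_add_point glue_in_N add_point_in_N indicator_def ac_simps)

lemma nn_integral_glue:
  assumes "\<mu> \<in> space N" "\<nu> \<in> space N" "S \<in> sets M" "h \<in> borel_measurable M"
  shows "(\<integral>\<^sup>+x. h x \<partial>glue S \<mu> \<nu>) =
    (\<integral>\<^sup>+x. indicator S x * h x \<partial>\<mu>) + (\<integral>\<^sup>+x. indicator (space M - S) x * h x \<partial>\<nu>)"
  using assms unfolding glue_def by (simp add: nn_integral_add_measure nn_integral_restr)

end

section \<open>Resampling a Poisson process\<close>

lemma (in localized_space) measurable_comp3:
  assumes "(\<lambda>z. k (fst (fst z)) (snd (fst z)) (snd z)) \<in> borel_measurable ((N \<Otimes>\<^sub>M N) \<Otimes>\<^sub>M M)"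
    and "f \<in> measurable \<Omega> N" "g \<in> measurable \<Omega> N" "h \<in> measurable \<Omega> M"
  shows "(\<lambda>\<omega>. k (f \<omega>) (g \<omega>) (h \<omega>)) \<in> borel_measurable \<Omega>"
  using measurable_compose[OF measurable_Pair[OF measurable_Pair[OF assms(2,3)] assms(4)] assms(1)] by simp

locale poisson_space = intensity_space +
  fixes Q :: "'a measure measure"
  assumes prob_Q: "prob_space Q" and sets_Q [simp, measurable_cong]: "sets Q = sets (counting_space M B)"
    and Q_cyl: "\<And>\<C> n. finite \<C> \<Longrightarrow> \<C> \<subseteq> local_sets M B \<Longrightarrow> disjoint \<C> \<Longrightarrow> emeasure Q (cyl \<C> n) = pois_cyl \<C> n"
begin

sublocale Q: prob_space Q by (rule prob_Q)
sublocale QQ: pair_prob_space Q Q ..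
sublocale \<Lambda>Q: pair_sigma_finite \<Lambda> Q ..

abbreviation EE :: "('a measure \<Rightarrow> 'a measure \<Rightarrow> ennreal) \<Rightarrow> ennreal" where
  "EE h \<equiv> (\<integral>\<^sup>+\<mu>. \<integral>\<^sup>+\<nu>. h \<mu> \<nu> \<partial>Q \<partial>Q)"

lemma space_Q [simp]: "space Q = space N"
  by (rule sets_eq_imp_space_eq) simp

lemma emeasure_Q_space [simp]: "emeasure Q (space N) = 1"
  using Q.emeasure_space_1 by simp

lemma mecke_Q:
  assumes "(\<lambda>z. h (fst z) (snd z)) \<in> borel_measurable (N \<Otimes>\<^sub>M M)"
  shows "(\<integral>\<^sup>+\<mu>. \<integral>\<^sup>+x. h \<mu> x \<partial>\<mu> \<partial>Q) = (\<integral>\<^sup>+x. \<integral>\<^sup>+\<mu>. h (add_point \<mu> x) x \<partial>Q \<partial>\<Lambda>)"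
  using mecke_of_poisson[OF prob_Q sets_Q Q_cyl] assms by (simp add: mecke_def case_prod_beta')

lemma
  assumes k: "(\<lambda>z. k (fst (fst z)) (snd (fst z)) (snd z)) \<in> borel_measurable ((N \<Otimes>\<^sub>M N) \<Otimes>\<^sub>M M)"
  shows mecke_fst: "EE (\<lambda>\<mu> \<nu>. \<integral>\<^sup>+x. k \<mu> \<nu> x \<partial>\<mu>) = (\<integral>\<^sup>+x. EE (\<lambda>\<mu> \<nu>. k (add_point \<mu> x) \<nu> x) \<partial>\<Lambda>)"
    and mecke_snd: "EE (\<lambda>\<mu> \<nu>. \<integral>\<^sup>+x. k \<mu> \<nu> x \<partial>\<nu>) = (\<integral>\<^sup>+x. EE (\<lambda>\<mu> \<nu>. k \<mu> (add_point \<nu> x) x) \<partial>\<Lambda>)"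
proof -
  note [measurable (raw)] = measurable_comp3[OF k]
  have m: "(\<lambda>\<omega>. \<integral>\<^sup>+x. k (fst \<omega>) (snd \<omega>) x \<partial>fst \<omega>) \<in> borel_measurable (N \<Otimes>\<^sub>M N)"
    using measurable_nn_integral_kernel[of "\<lambda>\<omega> x. k (fst \<omega>) (snd \<omega>) x" "N \<Otimes>\<^sub>M N" fst] k
    by (simp add: case_prod_beta')
  have "EE (\<lambda>\<mu> \<nu>. \<integral>\<^sup>+x. k \<mu> \<nu> x \<partial>\<mu>) = (\<integral>\<^sup>+\<nu>. \<integral>\<^sup>+\<mu>. \<integral>\<^sup>+x. k \<mu> \<nu> x \<partial>\<mu> \<partial>Q \<partial>Q)"
    using m by (intro QQ.Fubini'[symmetric]) (simp add: case_prod_beta' cong: measurable_cong_sets)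
  also have "\<dots> = (\<integral>\<^sup>+\<nu>. \<integral>\<^sup>+x. \<integral>\<^sup>+\<mu>. k (add_point \<mu> x) \<nu> x \<partial>Q \<partial>\<Lambda> \<partial>Q)"
    by (intro nn_integral_cong mecke_Q) measurable
  also have "\<dots> = (\<integral>\<^sup>+x. \<integral>\<^sup>+\<nu>. \<integral>\<^sup>+\<mu>. k (add_point \<mu> x) \<nu> x \<partial>Q \<partial>Q \<partial>\<Lambda>)"
    by (intro \<Lambda>Q.Fubini') measurable
  also have "\<dots> = (\<integral>\<^sup>+x. EE (\<lambda>\<mu> \<nu>. k (add_point \<mu> x) \<nu> x) \<partial>\<Lambda>)"
  proof (rule nn_integral_cong)
    fix x assume "x \<in> space \<Lambda>"
    then have [measurable]: "x \<in> space M" by simp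
    show "(\<integral>\<^sup>+\<nu>. \<integral>\<^sup>+\<mu>. k (add_point \<mu> x) \<nu> x \<partial>Q \<partial>Q) = EE (\<lambda>\<mu> \<nu>. k (add_point \<mu> x) \<nu> x)"
      by (rule QQ.Fubini') measurable
  qed
  finally show "EE (\<lambda>\<mu> \<nu>. \<integral>\<^sup>+x. k \<mu> \<nu> x \<partial>\<mu>) = (\<integral>\<^sup>+x. EE (\<lambda>\<mu> \<nu>. k (add_point \<mu> x) \<nu> x) \<partial>\<Lambda>)" .
  have "EE (\<lambda>\<mu> \<nu>. \<integral>\<^sup>+x. k \<mu> \<nu> x \<partial>\<nu>) = (\<integral>\<^sup>+\<mu>. \<integral>\<^sup>+x. \<integral>\<^sup>+\<nu>. k \<mu> (add_point \<nu> x) x \<partial>Q \<partial>\<Lambda> \<partial>Q)"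
    by (intro nn_integral_cong mecke_Q) measurable
  also have "\<dots> = (\<integral>\<^sup>+x. EE (\<lambda>\<mu> \<nu>. k \<mu> (add_point \<nu> x) x) \<partial>\<Lambda>)"
    by (intro \<Lambda>Q.Fubini') measurable
  finally show "EE (\<lambda>\<mu> \<nu>. \<integral>\<^sup>+x. k \<mu> \<nu> x \<partial>\<nu>) = (\<integral>\<^sup>+x. EE (\<lambda>\<mu> \<nu>. k \<mu> (add_point \<nu> x) x) \<partial>\<Lambda>)" .
qed

lemma nn_integral_add_QQ:
  assumes "(\<lambda>z. f (fst z) (snd z)) \<in> borel_measurable (N \<Otimes>\<^sub>M N)" "(\<lambda>z. g (fst z) (snd z)) \<in> borel_measurable (N \<Otimes>\<^sub>M N)"
  shows "EE (\<lambda>\<mu> \<nu>. f \<mu> \<nu> + g \<mu> \<nu>) = EE (\<lambda>\<mu> \<nu>. f \<mu> \<nu>) + EE (\<lambda>\<mu> \<nu>. g \<mu> \<nu>)"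
proof -
  have *: "EE (\<lambda>\<mu> \<nu>. u \<mu> \<nu>) = (\<integral>\<^sup>+z. u (fst z) (snd z) \<partial>(Q \<Otimes>\<^sub>M Q))"
    if "(\<lambda>z. u (fst z) (snd z)) \<in> borel_measurable (N \<Otimes>\<^sub>M N)" for u :: "'a measure \<Rightarrow> 'a measure \<Rightarrow> ennreal"
    using Q.nn_integral_fst[of "\<lambda>z. u (fst z) (snd z)" Q] that by (simp cong: measurable_cong_sets)
  note [measurable] = assms
  show ?thesis
    by (subst (1 2 3) *, measurable) (rule nn_integral_add, measurable)
qed

lemma nn_integral_kernels_add:
  assumes k: "(\<lambda>z. k (fst (fst z)) (snd (fst z)) (snd z)) \<in> borel_measurable ((N \<Otimes>\<^sub>M N) \<Otimes>\<^sub>M M)"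
    and k': "(\<lambda>z. k' (fst (fst z)) (snd (fst z)) (snd z)) \<in> borel_measurable ((N \<Otimes>\<^sub>M N) \<Otimes>\<^sub>M M)"
  shows "EE (\<lambda>\<mu> \<nu>. (\<integral>\<^sup>+x. k \<mu> \<nu> x \<partial>\<mu>) + (\<integral>\<^sup>+x. k' \<mu> \<nu> x \<partial>\<nu>)) =
    EE (\<lambda>\<mu> \<nu>. \<integral>\<^sup>+x. k \<mu> \<nu> x \<partial>\<mu>) + EE (\<lambda>\<mu> \<nu>. \<integral>\<^sup>+x. k' \<mu> \<nu> x \<partial>\<nu>)"
proof -
  have "(\<lambda>\<omega>. \<integral>\<^sup>+x. k (fst \<omega>) (snd \<omega>) x \<partial>fst \<omega>) \<in> borel_measurable (N \<Otimes>\<^sub>M N)"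
    "(\<lambda>\<omega>. \<integral>\<^sup>+x. k' (fst \<omega>) (snd \<omega>) x \<partial>snd \<omega>) \<in> borel_measurable (N \<Otimes>\<^sub>M N)"
    using measurable_nn_integral_kernel[of "\<lambda>\<omega> x. k (fst \<omega>) (snd \<omega>) x" "N \<Otimes>\<^sub>M N" fst] k
      measurable_nn_integral_kernel[of "\<lambda>\<omega> x. k' (fst \<omega>) (snd \<omega>) x" "N \<Otimes>\<^sub>M N" snd] k'
    by (simp_all add: case_prod_beta')
  then show ?thesis
    by (rule nn_integral_add_QQ)
qed

lemma mecke_both:
  assumes k: "(\<lambda>z. k (fst (fst z)) (snd (fst z)) (snd z)) \<in> borel_measurable ((N \<Otimes>\<^sub>M N) \<Otimes>\<^sub>M M)"
    and k': "(\<lambda>z. k' (fst (fst z)) (snd (fst z)) (snd z)) \<in> borel_measurable ((N \<Otimes>\<^sub>M N) \<Otimes>\<^sub>M M)"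
  shows "EE (\<lambda>\<mu> \<nu>. (\<integral>\<^sup>+x. k \<mu> \<nu> x \<partial>\<mu>) + (\<integral>\<^sup>+x. k' \<mu> \<nu> x \<partial>\<nu>)) =
    (\<integral>\<^sup>+x. EE (\<lambda>\<mu> \<nu>. k (add_point \<mu> x) \<nu> x + k' \<mu> (add_point \<nu> x) x) \<partial>\<Lambda>)"
proof -
  note [measurable (raw)] = measurable_comp3[OF k] measurable_comp3[OF k']
  have "EE (\<lambda>\<mu> \<nu>. (\<integral>\<^sup>+x. k \<mu> \<nu> x \<partial>\<mu>) + (\<integral>\<^sup>+x. k' \<mu> \<nu> x \<partial>\<nu>)) =
      EE (\<lambda>\<mu> \<nu>. \<integral>\<^sup>+x. k \<mu> \<nu> x \<partial>\<mu>) + EE (\<lambda>\<mu> \<nu>. \<integral>\<^sup>+x. k' \<mu> \<nu> x \<partial>\<nu>)"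
    using k k' by (rule nn_integral_kernels_add)
  also have "\<dots> = (\<integral>\<^sup>+x. EE (\<lambda>\<mu> \<nu>. k (add_point \<mu> x) \<nu> x) \<partial>\<Lambda>) + (\<integral>\<^sup>+x. EE (\<lambda>\<mu> \<nu>. k' \<mu> (add_point \<nu> x) x) \<partial>\<Lambda>)"
    by (simp only: mecke_fst[OF k] mecke_snd[OF k'])
  also have "\<dots> = (\<integral>\<^sup>+x. EE (\<lambda>\<mu> \<nu>. k (add_point \<mu> x) \<nu> x) + EE (\<lambda>\<mu> \<nu>. k' \<mu> (add_point \<nu> x) x) \<partial>\<Lambda>)"
    by (rule nn_integral_add[symmetric]) measurable
  also have "\<dots> = (\<integral>\<^sup>+x. EE (\<lambda>\<mu> \<nu>. k (add_point \<mu> x) \<nu> x + k' \<mu> (add_point \<nu> x) x) \<partial>\<Lambda>)"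
  proof (rule nn_integral_cong)
    fix x assume "x \<in> space \<Lambda>"
    then have [measurable]: "x \<in> space M" by simp
    show "EE (\<lambda>\<mu> \<nu>. k (add_point \<mu> x) \<nu> x) + EE (\<lambda>\<mu> \<nu>. k' \<mu> (add_point \<nu> x) x) =
        EE (\<lambda>\<mu> \<nu>. k (add_point \<mu> x) \<nu> x + k' \<mu> (add_point \<nu> x) x)"
      by (rule nn_integral_add_QQ[symmetric]) measurable
  qed
  finally show ?thesis .
qed

text \<open>Given the configuration explored by \<open>V\<close>, the rest of a Poisson process is still Poisson,
  also when it is resampled outside a larger stopping set \<open>U\<close>. Adding a point \<open>y\<close> to the glued
  process amounts to replacing \<open>U\<close> by another stopping set containing \<open>V\<close>.\<close>

lemma glue_law:
  assumes V: "stops V" and U: "stops U" and VU: "\<And>\<mu>. \<mu> \<in> space N \<Longrightarrow> V \<mu> \<subseteq> U \<mu>" and x: "x \<in> space M"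
    and F: "F \<in> borel_measurable N"
  shows "EE (\<lambda>\<mu> \<nu>. indicator (V \<mu>) x * F (glue (U \<mu> - V \<mu>) \<mu> \<nu>)) =
    emeasure Q {\<mu>\<in>space N. x \<in> V \<mu>} * (\<integral>\<^sup>+\<mu>. F \<mu> \<partial>Q)"
proof -
  note [measurable] = x and [measurable (raw)] = stops_pred[OF V]
  define I where "I = {U. stops U \<and> (\<forall>\<mu>\<in>space N. V \<mu> \<subseteq> U \<mu>)}"
  define \<sigma> where "\<sigma> U y \<mu> = (if y \<in> V \<mu> then U \<mu> else U (add_point \<mu> y))" for U :: "'a measure \<Rightarrow> 'a set" and y \<mu>
  \<comment> \<open>The event that x is in \<open>V\<close> enters as a density and not by
    conditioning. The resulting measure has total mass \<open>c\<close> for every \<open>U\<close>,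
    which is the common mass asked for by \<open>cyl_mass\<close>.\<close>
  define m where "m U = distr (density (Q \<Otimes>\<^sub>M Q) (\<lambda>z. indicator (V (fst z)) x)) N
    (\<lambda>z. glue (U (fst z) - V (fst z)) (fst z) (snd z))" for U
  define c where "c = measure Q {\<mu>\<in>space N. x \<in> V \<mu>}"
  have c: "emeasure Q {\<mu>\<in>space N. x \<in> V \<mu>} = ennreal c"
    unfolding c_def by (rule Q.emeasure_eq_measure)
  have ind [measurable (raw)]: "(\<lambda>\<omega>. indicator (V (f \<omega>)) x :: ennreal) \<in> borel_measurable \<Omega>"
    if [measurable]: "f \<in> measurable \<Omega> N" for f and \<Omega> :: "('a measure \<times> 'a measure) measure"
    by (rule borel_measurable_indicator') measurable
  have glue_m: "(\<lambda>z. glue (U (fst z) - V (fst z)) (fst z) (snd z)) \<in> measurable (N \<Otimes>\<^sub>M N) N" if "U \<in> I" for U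
  proof (rule measurable_glue)
    have U: "stops U" using that by (simp add: I_def)
    note [measurable (raw)] = stops_pred[OF U]
    show "Measurable.pred ((N \<Otimes>\<^sub>M N) \<Otimes>\<^sub>M M) (\<lambda>z. snd z \<in> U (fst (fst z)) - V (fst (fst z)))"
      unfolding Diff_iff by measurable
    show "U (fst z) - V (fst z) \<in> sets M" if "z \<in> space (N \<Otimes>\<^sub>M N)" for z
      using that stops_sets[OF U] stops_sets[OF V] by (auto simp: space_pair_measure)
  qed measurable
  have nn_m: "(\<integral>\<^sup>+\<mu>. h \<mu> \<partial>m U) = EE (\<lambda>\<mu> \<nu>. indicator (V \<mu>) x * h (glue (U \<mu> - V \<mu>) \<mu> \<nu>))"
    if U: "U \<in> I" and [measurable]: "h \<in> borel_measurable N" for U h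
  proof -
    note [measurable] = glue_m[OF U]
    have "(\<integral>\<^sup>+\<mu>. h \<mu> \<partial>m U) = (\<integral>\<^sup>+z. indicator (V (fst z)) x * h (glue (U (fst z) - V (fst z)) (fst z) (snd z)) \<partial>(Q \<Otimes>\<^sub>M Q))"
      unfolding m_def by (subst nn_integral_distr, measurable) (subst nn_integral_density, measurable)
    also have "\<dots> = EE (\<lambda>\<mu> \<nu>. indicator (V \<mu>) x * h (glue (U \<mu> - V \<mu>) \<mu> \<nu>))"
      by (subst Q.nn_integral_fst[symmetric]) simp_all
    finally show ?thesis .
  qed
  have total: "EE (\<lambda>\<mu> \<nu>. indicator (V \<mu>) x) = ennreal c"
  proof -
    have "EE (\<lambda>\<mu> \<nu>. indicator (V \<mu>) x) = (\<integral>\<^sup>+\<mu>. indicator {\<mu>\<in>space N. x \<in> V \<mu>} \<mu> \<partial>Q)"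
      by (intro nn_integral_cong) (simp add: indicator_def)
    then show ?thesis by (simp add: c)
  qed
  have gI: "glue (U \<mu> - V \<mu>) \<mu> \<nu> \<in> space N" if "U \<in> I" "\<mu> \<in> space N" "\<nu> \<in> space N" for U \<mu> \<nu>
    using that stops_sets[OF V] stops_sets[of U] by (intro glue_in_N) (auto simp: I_def)
  have "m U = scale_measure (ennreal c) Q"
  proof (rule counting_measure_eqI[where A = "{}"])
    show "{} \<in> L" by (simp add: mem_L_iff)
    have mass: "emeasure (m U) (space N) = ennreal c" if "U \<in> I" for U
    proof -
      have "emeasure (m U) (space N) = (\<integral>\<^sup>+\<mu>. indicator (space N) \<mu> \<partial>m U)"
        by (simp add: m_def)
      also have "\<dots> = EE (\<lambda>\<mu> \<nu>. indicator (V \<mu>) x)"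
        by (subst nn_m[OF that]) (simp, intro nn_integral_cong, simp add: gI[OF that])
      finally show ?thesis using total by simp
    qed
    have UI: "U \<in> I" using U VU by (simp add: I_def)
    then show "emeasure (m U) (space N) < \<infinity>" by (simp add: mass)
    fix \<C> n assume \<C>: "finite \<C>" "\<C> \<subseteq> L" "disjoint \<C>"
    have "emeasure (m U) (cyl \<C> n) = ennreal c * pois_cyl \<C> n"
    proof (rule cyl_mass[where I = I and \<sigma> = \<sigma>, OF _ _ mass _ _ \<C> UI])
      show "0 \<le> c" by (simp add: c_def)
      show "sets (m U) = sets N" for U by (simp add: m_def)
      show "\<sigma> U y \<in> I" if "U \<in> I" "y \<in> space M" for U y
        using stops_switch[OF V _ _ that(2), of U] that(1) unfolding I_def \<sigma>_def by simp
      fix U and h :: "'a measure \<Rightarrow> 'a \<Rightarrow> ennreal"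
      assume UI: "U \<in> I" and h0: "(\<lambda>(\<mu>, x). h \<mu> x) \<in> borel_measurable (N \<Otimes>\<^sub>M M)"
      then have U: "stops U" and VU: "\<And>\<mu>. \<mu> \<in> space N \<Longrightarrow> V \<mu> \<subseteq> U \<mu>" by (auto simp: I_def)
      note [measurable (raw)] = stops_pred[OF U]
      note [measurable] = glue_m[OF UI]
      have h [measurable (raw)]: "(\<lambda>\<omega>. h (f \<omega>) (g \<omega>)) \<in> borel_measurable \<Omega>"
        if "f \<in> measurable \<Omega> N" "g \<in> measurable \<Omega> M" for f g and \<Omega> :: "(('a measure \<times> 'a measure) \<times> 'a) measure"
        using measurable_compose[OF measurable_Pair[OF that] h0] by simp
      let ?g = "\<lambda>\<mu> \<nu>. glue (U \<mu> - V \<mu>) \<mu> \<nu>"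
      let ?k1 = "\<lambda>\<mu> \<nu> y. indicator (V \<mu>) x * (indicator (U \<mu> - V \<mu>) y * h (?g \<mu> \<nu>) y)"
      let ?k2 = "\<lambda>\<mu> \<nu> y. indicator (V \<mu>) x * (indicator (space M - (U \<mu> - V \<mu>)) y * h (?g \<mu> \<nu>) y)"
      have ind1: "(\<lambda>z. indicator (V (fst (fst z))) x :: ennreal) \<in> borel_measurable ((N \<Otimes>\<^sub>M N) \<Otimes>\<^sub>M M)"
        by (rule borel_measurable_indicator') measurable
      have ind2: "(\<lambda>z. indicator (U (fst (fst z)) - V (fst (fst z))) (snd z) :: ennreal) \<in> borel_measurable ((N \<Otimes>\<^sub>M N) \<Otimes>\<^sub>M M)"
        by (rule borel_measurable_indicator') (unfold Diff_iff, measurable)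
      have ind3: "(\<lambda>z. indicator (space M - (U (fst (fst z)) - V (fst (fst z)))) (snd z) :: ennreal) \<in> borel_measurable ((N \<Otimes>\<^sub>M N) \<Otimes>\<^sub>M M)"
        by (rule borel_measurable_indicator') (unfold Diff_iff, measurable)
      have k1: "(\<lambda>z. ?k1 (fst (fst z)) (snd (fst z)) (snd z)) \<in> borel_measurable ((N \<Otimes>\<^sub>M N) \<Otimes>\<^sub>M M)"
        and k2: "(\<lambda>z. ?k2 (fst (fst z)) (snd (fst z)) (snd z)) \<in> borel_measurable ((N \<Otimes>\<^sub>M N) \<Otimes>\<^sub>M M)"
        using ind1 ind2 ind3 by measurable
      have hm: "(\<lambda>\<mu>. \<integral>\<^sup>+y. h \<mu> y \<partial>\<mu>) \<in> borel_measurable N"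
        using measurable_nn_integral_kernel[OF h0, of "\<lambda>\<mu>. \<mu>"] by simp
      have S: "U \<mu> - V \<mu> \<in> sets M" if "\<mu> \<in> space N" for \<mu>
        using that stops_sets[OF V] stops_sets[OF U] by auto
      have hs: "(\<lambda>y. h \<mu> y) \<in> borel_measurable M" if "\<mu> \<in> space N" for \<mu>
        using measurable_compose[OF measurable_Pair1'[OF that] h0] by simp
      have "(\<integral>\<^sup>+\<mu>. \<integral>\<^sup>+y. h \<mu> y \<partial>\<mu> \<partial>m U) = EE (\<lambda>\<mu> \<nu>. indicator (V \<mu>) x * (\<integral>\<^sup>+y. h (?g \<mu> \<nu>) y \<partial>?g \<mu> \<nu>))"
        by (rule nn_m[OF UI hm])
      also have "\<dots> = EE (\<lambda>\<mu> \<nu>. (\<integral>\<^sup>+y. ?k1 \<mu> \<nu> y \<partial>\<mu>) + (\<integral>\<^sup>+y. ?k2 \<mu> \<nu> y \<partial>\<nu>))"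
      proof (intro nn_integral_cong)
        fix \<mu> \<nu> assume "\<mu> \<in> space Q" "\<nu> \<in> space Q"
        then have \<mu>\<nu>: "\<mu> \<in> space N" "\<nu> \<in> space N" by auto
        note hs' = hs[OF gI[OF UI \<mu>\<nu>]]
        have "(\<integral>\<^sup>+y. ?k1 \<mu> \<nu> y \<partial>\<mu>) = indicator (V \<mu>) x * (\<integral>\<^sup>+y. indicator (U \<mu> - V \<mu>) y * h (?g \<mu> \<nu>) y \<partial>\<mu>)"
          using hs' S[OF \<mu>\<nu>(1)] \<mu>\<nu> by (intro nn_integral_cmult) (simp cong: measurable_cong_sets)
        moreover have "(\<integral>\<^sup>+y. ?k2 \<mu> \<nu> y \<partial>\<nu>) = indicator (V \<mu>) x * (\<integral>\<^sup>+y. indicator (space M - (U \<mu> - V \<mu>)) y * h (?g \<mu> \<nu>) y \<partial>\<nu>)"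
          using hs' S[OF \<mu>\<nu>(1)] \<mu>\<nu> by (intro nn_integral_cmult) (simp cong: measurable_cong_sets)
        ultimately show "indicator (V \<mu>) x * (\<integral>\<^sup>+y. h (?g \<mu> \<nu>) y \<partial>?g \<mu> \<nu>) = (\<integral>\<^sup>+y. ?k1 \<mu> \<nu> y \<partial>\<mu>) + (\<integral>\<^sup>+y. ?k2 \<mu> \<nu> y \<partial>\<nu>)"
          by (simp only: nn_integral_glue[OF \<mu>\<nu> S[OF \<mu>\<nu>(1)] hs'] distrib_left)
      qed
      also have "\<dots> = (\<integral>\<^sup>+y. EE (\<lambda>\<mu> \<nu>. ?k1 (add_point \<mu> y) \<nu> y + ?k2 \<mu> (add_point \<nu> y) y) \<partial>\<Lambda>)"
        by (rule mecke_both[OF k1 k2])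
      also have "\<dots> = (\<integral>\<^sup>+y. EE (\<lambda>\<mu> \<nu>. indicator (V \<mu>) x * h (add_point (glue (\<sigma> U y \<mu> - V \<mu>) \<mu> \<nu>) y) y) \<partial>\<Lambda>)"
      proof (intro nn_integral_cong)
        fix y \<mu> \<nu> assume "y \<in> space \<Lambda>" "\<mu> \<in> space Q" "\<nu> \<in> space Q"
        then have \<mu>\<nu>: "\<mu> \<in> space N" "\<nu> \<in> space N" and y: "y \<in> space M" by auto
        note \<mu>y = add_point_in_N[OF \<mu>\<nu>(1), of y]
        have Uy: "y \<in> U (add_point \<mu> y) \<longleftrightarrow> y \<in> U \<mu>" "y \<notin> U \<mu> \<Longrightarrow> U (add_point \<mu> y) = U \<mu>"
          and Vy: "y \<in> V (add_point \<mu> y) \<longleftrightarrow> y \<in> V \<mu>" "y \<notin> V \<mu> \<Longrightarrow> V (add_point \<mu> y) = V \<mu>"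
          using stops_add_point[OF U \<mu>\<nu>(1), of y] stops_add_point[OF V \<mu>\<nu>(1), of y] by auto
        \<comment> \<open>Exactly one of the two terms survives. For y in
          \<open>U \<mu> - V \<mu>\<close> the point enters through \<mu>: it leaves
          \<open>V\<close> alone but may change \<open>U\<close>. Otherwise it enters through \<nu>,
          which the sets do not depend on, and \<open>\<sigma> U y \<mu>\<close> is
          \<open>U \<mu>\<close>.\<close>
        show "?k1 (add_point \<mu> y) \<nu> y + ?k2 \<mu> (add_point \<nu> y) y =
            indicator (V \<mu>) x * h (add_point (glue (\<sigma> U y \<mu> - V \<mu>) \<mu> \<nu>) y) y"
        proof (cases "y \<in> U \<mu> - V \<mu>")
          case True
          then have eq: "\<sigma> U y \<mu> = U (add_point \<mu> y)" "V (add_point \<mu> y) = V \<mu>" using Vy by (auto simp: \<sigma>_def)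
          have "y \<in> U (add_point \<mu> y) - V (add_point \<mu> y)" using True Uy Vy by auto
          then have "?g (add_point \<mu> y) \<nu> = add_point (glue (\<sigma> U y \<mu> - V \<mu>) \<mu> \<nu>) y"
            using glue_add_point(1)[OF \<mu>\<nu> S[OF \<mu>y]] eq by simp
          then show ?thesis using True y eq Uy Vy by simp
        next
          case False
          then have eq: "\<sigma> U y \<mu> = U \<mu>" using Uy VU[OF \<mu>\<nu>(1)] by (auto simp: \<sigma>_def)
          have "y \<notin> U (add_point \<mu> y) - V (add_point \<mu> y)" using False Uy Vy by auto
          moreover have "?g \<mu> (add_point \<nu> y) = add_point (glue (\<sigma> U y \<mu> - V \<mu>) \<mu> \<nu>) y"
            using glue_add_point(3)[OF \<mu>\<nu> S[OF \<mu>\<nu>(1)] False] eq by simp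
          ultimately show ?thesis using False y by simp
        qed
      qed
      also have "\<dots> = (\<integral>\<^sup>+y. \<integral>\<^sup>+\<mu>. h (add_point \<mu> y) y \<partial>m (\<sigma> U y) \<partial>\<Lambda>)"
      proof (rule nn_integral_cong)
        fix y assume "y \<in> space \<Lambda>"
        then have y [measurable]: "y \<in> space M" by simp
        have "\<sigma> U y \<in> I"
          using stops_switch[OF V _ _ y, of U] UI unfolding I_def \<sigma>_def by simp
        moreover have pm: "(\<lambda>\<mu>. (add_point \<mu> y, y)) \<in> measurable N (N \<Otimes>\<^sub>M M)"
          by measurable
        then have "(\<lambda>\<mu>. h (add_point \<mu> y) y) \<in> borel_measurable N"
          using measurable_compose[OF pm h0] by simp
        ultimately show "EE (\<lambda>\<mu> \<nu>. indicator (V \<mu>) x * h (add_point (glue (\<sigma> U y \<mu> - V \<mu>) \<mu> \<nu>) y) y) =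
            (\<integral>\<^sup>+\<mu>. h (add_point \<mu> y) y \<partial>m (\<sigma> U y))"
          by (rule nn_m[symmetric])
      qed
      finally show "(\<integral>\<^sup>+\<mu>. \<integral>\<^sup>+y. h \<mu> y \<partial>\<mu> \<partial>m U) = (\<integral>\<^sup>+y. \<integral>\<^sup>+\<mu>. h (add_point \<mu> y) y \<partial>m (\<sigma> U y) \<partial>\<Lambda>)" .
    qed
    then show "emeasure (m U) (cyl \<C> n) = emeasure (scale_measure (ennreal c) Q) (cyl \<C> n)"
      using Q_cyl[OF \<C>] by simp
  qed (simp_all add: m_def)
  moreover have "U \<in> I" using U VU by (simp add: I_def)
  ultimately show ?thesis
    using nn_m[OF \<open>U \<in> I\<close> F] F c by (simp add: nn_integral_scale_measure)
qed

end

section \<open>Exploration times\<close>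

locale ctdt_space = poisson_space M B \<Lambda> Q
  for M :: "'a measure" and B \<Lambda> Q +
  fixes Z :: "real \<Rightarrow> 'a measure \<Rightarrow> 'a set"
  assumes Z_stops: "\<And>t. 0 \<le> t \<Longrightarrow> stops (Z t)"
    and Z_local: "\<And>t \<mu>. 0 \<le> t \<Longrightarrow> \<mu> \<in> space (counting_space M B) \<Longrightarrow> Z t \<mu> \<in> local_sets M B"
    and Z_mono: "\<And>\<mu> s t. \<mu> \<in> space (counting_space M B) \<Longrightarrow> 0 \<le> s \<Longrightarrow> s \<le> t \<Longrightarrow> Z s \<mu> \<subseteq> Z t \<mu>"
    and Z_right: "\<And>\<mu> t. \<mu> \<in> space (counting_space M B) \<Longrightarrow> 0 \<le> t \<Longrightarrow> Z t \<mu> = (\<Inter>s\<in>{t<..}. Z s \<mu>)"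
    and Z_null: "\<And>\<mu> t. \<mu> \<in> space (counting_space M B) \<Longrightarrow> 0 \<le> t \<Longrightarrow> emeasure \<Lambda> (Z t \<mu> - left_lim Z t \<mu>) = 0"
begin

text \<open>The infimum of the empty set is \<open>\<infinity>\<close>, so \<open>T \<mu> x = \<infinity>\<close> if \<open>x\<close> is never explored.\<close>

definition T :: "'a measure \<Rightarrow> 'a \<Rightarrow> ennreal" where
  "T \<mu> x = (INF t\<in>{t. 0 \<le> t \<and> x \<in> Z t \<mu>}. ennreal t)"

abbreviation Zi :: "'a measure \<Rightarrow> 'a set" where "Zi \<equiv> Z_infty Z"

lemma Z_sets: "0 \<le> t \<Longrightarrow> \<mu> \<in> space N \<Longrightarrow> Z t \<mu> \<in> sets M"
  by (rule stops_sets[OF Z_stops])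

lemma T_less_iff: "0 \<le> t \<Longrightarrow> T \<mu> x < ennreal t \<longleftrightarrow> x \<in> left_lim Z t \<mu>"
  by (auto simp: T_def INF_less_iff left_lim_def ennreal_less_iff)

text \<open>Right continuity of the exploration makes the infimum a minimum: what is found by every
  time after t is found by time t.\<close>

lemma T_le_iff:
  assumes \<mu>: "\<mu> \<in> space N" and t: "0 \<le> t"
  shows "T \<mu> x \<le> ennreal t \<longleftrightarrow> x \<in> Z t \<mu>"
proof
  assume "x \<in> Z t \<mu>"
  then show "T \<mu> x \<le> ennreal t" unfolding T_def using t by (intro INF_lower) simp
next
  assume le: "T \<mu> x \<le> ennreal t"
  have "x \<in> Z s \<mu>" if s: "t < s" for s
  proof -
    have "ennreal t < ennreal s" using s t by (simp add: ennreal_less_iff)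
    with le have "T \<mu> x < ennreal s" by (rule le_less_trans)
    then obtain r where "0 \<le> r" "x \<in> Z r \<mu>" "r < s"
      using s t T_less_iff[of s \<mu> x] by (auto simp: left_lim_def)
    then show ?thesis using Z_mono[OF \<mu>, of r s] by auto
  qed
  then show "x \<in> Z t \<mu>" using Z_right[OF \<mu> t] by auto
qed

lemma T_finite_iff: "T \<mu> x < \<infinity> \<longleftrightarrow> x \<in> Zi \<mu>"
  by (auto simp: T_def INF_less_iff Z_infty_def)

lemma Zi_subset: "\<mu> \<in> space N \<Longrightarrow> Zi \<mu> \<subseteq> space M"
  using Z_sets sets.sets_into_space by (fastforce simp: Z_infty_def)

lemma measurable_T0: "(\<lambda>z. T (fst z) (snd z)) \<in> borel_measurable (N \<Otimes>\<^sub>M M)"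
proof (rule borel_measurableI_le)
  fix y :: ennreal
  show "{z \<in> space (N \<Otimes>\<^sub>M M). T (fst z) (snd z) \<le> y} \<in> sets (N \<Otimes>\<^sub>M M)"
  proof (cases y)
    case (real t)
    note [measurable (raw)] = stops_pred[OF Z_stops[OF real(1)]]
    have "{z \<in> space (N \<Otimes>\<^sub>M M). T (fst z) (snd z) \<le> y} = {z \<in> space (N \<Otimes>\<^sub>M M). snd z \<in> Z t (fst z)}"
      using real by (auto simp: space_pair_measure T_le_iff)
    also have "\<dots> \<in> sets (N \<Otimes>\<^sub>M M)" by measurable
    finally show ?thesis .
  qed simp
qed

lemma measurable_T [measurable (raw)]:
  assumes "f \<in> measurable \<Omega> N" "g \<in> measurable \<Omega> M"
  shows "(\<lambda>\<omega>. T (f \<omega>) (g \<omega>)) \<in> borel_measurable \<Omega>"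
  using measurable_compose[OF measurable_Pair[OF assms] measurable_T0] by simp

text \<open>The region explored when x is found. The finiteness condition matters if x is never
  found: the region is then \<open>Zi \<mu>\<close> and not the whole space.\<close>

definition V :: "'a \<Rightarrow> 'a measure \<Rightarrow> 'a set" where
  "V x \<mu> = {y\<in>space M. T \<mu> y \<le> T \<mu> x \<and> T \<mu> y < \<infinity>}"

text \<open>The left limit of the exploration at the time x is found. By (3) it differs from
  \<open>V x \<mu>\<close> by a null set, and the two coincide if x is never found.\<close>

definition W :: "'a \<Rightarrow> 'a measure \<Rightarrow> 'a set" where
  "W x \<mu> = {y\<in>space M. T \<mu> y < T \<mu> x}"

lemma Zi_eq: "\<mu> \<in> space N \<Longrightarrow> Zi \<mu> = {y\<in>space M. T \<mu> y < \<infinity>}"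
  using Zi_subset[of \<mu>] T_finite_iff by auto

lemma V_sets: "\<mu> \<in> space N \<Longrightarrow> x \<in> space M \<Longrightarrow> V x \<mu> \<in> sets M"
  and W_sets: "\<mu> \<in> space N \<Longrightarrow> x \<in> space M \<Longrightarrow> W x \<mu> \<in> sets M"
  and Zi_sets: "\<mu> \<in> space N \<Longrightarrow> Zi \<mu> \<in> sets M"
  unfolding Zi_eq V_def W_def by measurable

lemma left_lim_eq: "\<mu> \<in> space N \<Longrightarrow> 0 \<le> t \<Longrightarrow> left_lim Z t \<mu> = {y\<in>space M. T \<mu> y < ennreal t}"
  using Z_sets sets.sets_into_space T_less_iff[of t] by (fastforce simp: left_lim_def)

lemma left_lim_sets: "\<mu> \<in> space N \<Longrightarrow> 0 \<le> t \<Longrightarrow> left_lim Z t \<mu> \<in> sets M"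
  by (simp add: left_lim_eq)

lemma V_eq_Z: "\<mu> \<in> space N \<Longrightarrow> 0 \<le> t \<Longrightarrow> T \<mu> x = ennreal t \<Longrightarrow> V x \<mu> = Z t \<mu>"
  using Z_sets[of t \<mu>] sets.sets_into_space[of "Z t \<mu>" M] T_le_iff[of \<mu> t]
  by (auto simp: V_def intro: le_less_trans[OF _ ennreal_less_top])

lemma V_eq_Zi: "\<mu> \<in> space N \<Longrightarrow> T \<mu> x = \<infinity> \<Longrightarrow> V x \<mu> = Zi \<mu>"
  by (auto simp: V_def Zi_eq)

lemma W_eq_left_lim: "\<mu> \<in> space N \<Longrightarrow> 0 \<le> t \<Longrightarrow> T \<mu> x = ennreal t \<Longrightarrow> W x \<mu> = left_lim Z t \<mu>"
  by (auto simp: W_def left_lim_eq)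

lemma V_subset_Zi: "\<mu> \<in> space N \<Longrightarrow> V x \<mu> \<subseteq> Zi \<mu>"
  by (auto simp: V_def Zi_eq)

lemma mem_V_self: "x \<in> space M \<Longrightarrow> x \<in> V x \<mu> \<longleftrightarrow> x \<in> Zi \<mu>"
  by (auto simp: V_def T_finite_iff[symmetric])

lemma indicator_V_self: "x \<in> space M \<Longrightarrow> indicator (V x \<mu>) x = indicator (Zi \<mu>) x"
  by (simp add: indicator_def mem_V_self)

lemma not_mem_W_self: "x \<notin> W x \<mu>"
  by (simp add: W_def)

lemma V_minus_W_null: "\<mu> \<in> space N \<Longrightarrow> emeasure \<Lambda> (V x \<mu> - W x \<mu>) = 0"
proof (cases "T \<mu> x")
  case (real t)
  then show "\<mu> \<in> space N \<Longrightarrow> ?thesis" by (simp add: V_eq_Z W_eq_left_lim Z_null)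
next
  case top
  then have "V x \<mu> - W x \<mu> = {}" by (auto simp: V_def W_def)
  then show ?thesis by (simp only: emeasure_empty)
qed

lemma stops_Zi: "stops Zi"
proof (rule stopsI)
  show "Zi \<mu> \<in> sets M" if "\<mu> \<in> space N" for \<mu> using that by (rule Zi_sets)
  have "Measurable.pred (N \<Otimes>\<^sub>M M) (\<lambda>z. T (fst z) (snd z) < \<infinity>)" by measurable
  then show "Measurable.pred (N \<Otimes>\<^sub>M M) (\<lambda>z. snd z \<in> Zi (fst z))"
    unfolding T_finite_iff .
  fix \<mu> \<nu> assume \<mu>\<nu>: "\<mu> \<in> space N" "\<nu> \<in> space N" and a: "agree \<mu> \<nu> (Zi \<mu>)"
  have "Z t \<nu> = Z t \<mu>" if "0 \<le> t" for t
  proof (rule stops_agree[OF Z_stops[OF that] \<mu>\<nu>])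
    show "agree \<mu> \<nu> (Z t \<mu>)"
      using a by (rule agree_mono) (use that in \<open>auto simp: Z_infty_def\<close>)
  qed
  then show "Zi \<nu> = Zi \<mu>" by (simp add: Z_infty_def)
qed

text \<open>The exploration stopped at the discovery of \<open>x\<close>: whether \<open>x\<close> is found by time \<open>t\<close> only
  depends on what has been explored by then.\<close>

lemma stops_V:
  assumes x: "x \<in> space M" shows "stops (V x)"
proof (rule stopsI)
  show "V x \<mu> \<in> sets M" if "\<mu> \<in> space N" for \<mu> using that x by (rule V_sets)
  note [measurable] = x
  have "Measurable.pred (N \<Otimes>\<^sub>M M) (\<lambda>z. T (fst z) (snd z) \<le> T (fst z) x \<and> T (fst z) (snd z) < \<infinity>)"
    by measurable
  then show "Measurable.pred (N \<Otimes>\<^sub>M M) (\<lambda>z. snd z \<in> V x (fst z))"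
    by (rule measurable_cong[THEN iffD1, rotated]) (auto simp: V_def space_pair_measure)
  fix \<mu> \<nu> assume \<mu>\<nu>: "\<mu> \<in> space N" "\<nu> \<in> space N" and a: "agree \<mu> \<nu> (V x \<mu>)"
  have Z_eq: "Z r \<nu> = Z r \<mu>" if "0 \<le> r" "Z r \<mu> \<subseteq> V x \<mu>" for r
    by (rule stops_agree[OF Z_stops[OF that(1)] \<mu>\<nu> agree_mono[OF a that(2)]])
  show "V x \<nu> = V x \<mu>"
  proof (cases "T \<mu> x")
    case (real t)
    have Vt: "V x \<mu> = Z t \<mu>" using \<mu>\<nu>(1) real by (rule V_eq_Z)
    have Zr: "Z r \<nu> = Z r \<mu>" if "0 \<le> r" "r \<le> t" for r
      using Z_eq[OF that(1)] Z_mono[OF \<mu>\<nu>(1) that] Vt by simp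
    \<comment> \<open>The explorations of \<mu> and \<nu> coincide up to time t, so x is found by
      time t in \<nu> as well; since the left limits are equal, it is not found earlier.\<close>
    have "T \<nu> x = ennreal t"
    proof (rule antisym)
      have "x \<in> Z t \<mu>" using T_le_iff[OF \<mu>\<nu>(1) real(1), of x] real(2) by simp
      then show "T \<nu> x \<le> ennreal t" using T_le_iff[OF \<mu>\<nu>(2) real(1)] Zr[OF real(1)] by simp
      have "left_lim Z t \<nu> = left_lim Z t \<mu>" using Zr by (auto simp: left_lim_def)
      then show "ennreal t \<le> T \<nu> x"
        using T_less_iff[OF real(1), of \<nu> x] T_less_iff[OF real(1), of \<mu> x] real(2) by (simp add: not_less[symmetric])
    qed
    then have "V x \<nu> = Z t \<nu>" using \<mu>\<nu>(2) real(1) by (intro V_eq_Z)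
    then show ?thesis using Vt Zr[OF real(1)] by simp
  next
    case top
    then have Vi: "V x \<mu> = Zi \<mu>" using \<mu>\<nu>(1) by (intro V_eq_Zi) simp_all
    have Zr: "Z r \<nu> = Z r \<mu>" if "0 \<le> r" for r
      using Z_eq[OF that] Vi that by (auto simp: Z_infty_def)
    then have "T \<nu> y = T \<mu> y" for y unfolding T_def by (metis (mono_tags, lifting) Collect_cong)
    then show ?thesis by (simp add: V_def)
  qed
qed

text \<open>The resampled configuration at the discovery of \<open>x\<close>, without the points of \<open>\<mu>\<close> and of \<open>\<nu>\<close>
  discovered at that very moment, in particular without \<open>x\<close>. The removed set is \<open>\<Lambda>\<close>-null.\<close>

definition A :: "'a \<Rightarrow> 'a measure \<Rightarrow> 'a measure \<Rightarrow> 'a measure" where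
  "A x \<mu> \<nu> = glue (Zi \<mu> - V x \<mu>) \<mu> (restr \<nu> (space M - (V x \<mu> - W x \<mu>)))"

lemma A_in_N: "\<mu> \<in> space N \<Longrightarrow> \<nu> \<in> space N \<Longrightarrow> x \<in> space M \<Longrightarrow> A x \<mu> \<nu> \<in> space N"
  unfolding A_def by (intro glue_in_N restr_in_N sets.Diff V_sets W_sets Zi_sets) auto

lemma measurable_A0: "(\<lambda>z. A (snd z) (fst (fst z)) (snd (fst z))) \<in> measurable ((N \<Otimes>\<^sub>M N) \<Otimes>\<^sub>M M) N"
  unfolding A_def
proof (intro measurable_glue measurable_restr)
  let ?\<Omega> = "((N \<Otimes>\<^sub>M N) \<Otimes>\<^sub>M M) \<Otimes>\<^sub>M M"
  have "Measurable.pred ?\<Omega> (\<lambda>z. \<not> (T (fst (fst (fst z))) (snd z) \<le> T (fst (fst (fst z))) (snd (fst z)) \<and>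
      T (fst (fst (fst z))) (snd z) < \<infinity> \<and> \<not> T (fst (fst (fst z))) (snd z) < T (fst (fst (fst z))) (snd (fst z))))"
    by measurable
  then show "Measurable.pred ?\<Omega> (\<lambda>(\<omega>, x). x \<in> space M - (V (snd \<omega>) (fst (fst \<omega>)) - W (snd \<omega>) (fst (fst \<omega>))))"
    by (rule measurable_cong[THEN iffD1, rotated]) (auto simp: space_pair_measure V_def W_def)
  have "Measurable.pred ?\<Omega> (\<lambda>z. T (fst (fst (fst z))) (snd z) < \<infinity> \<and>
      \<not> (T (fst (fst (fst z))) (snd z) \<le> T (fst (fst (fst z))) (snd (fst z)) \<and> T (fst (fst (fst z))) (snd z) < \<infinity>))"
    by measurable
  then show "Measurable.pred ?\<Omega> (\<lambda>z. snd z \<in> Zi (fst (fst (fst z))) - V (snd (fst z)) (fst (fst (fst z))))"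
    by (rule measurable_cong[THEN iffD1, rotated]) (auto simp: space_pair_measure V_def T_finite_iff[symmetric])
qed (auto simp: space_pair_measure intro!: sets.Diff V_sets W_sets Zi_sets)

lemma measurable_A [measurable (raw)]:
  assumes "f \<in> measurable \<Omega> N" "g \<in> measurable \<Omega> N" "h \<in> measurable \<Omega> M"
  shows "(\<lambda>\<omega>. A (h \<omega>) (f \<omega>) (g \<omega>)) \<in> measurable \<Omega> N"
  using measurable_compose[OF measurable_Pair[OF measurable_Pair[OF assms(1,2)] assms(3)] measurable_A0] by simp

text \<open>By the Mecke equation the mean mass of a set is its intensity. The lemma is applied to
  null sets that are determined by an independent configuration.\<close>

lemma AE_null:
  assumes "S \<in> sets M" "emeasure \<Lambda> S = 0"
  shows "AE \<nu> in Q. emeasure \<nu> S = 0"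
proof -
  note [measurable] = assms(1)
  have "(\<integral>\<^sup>+\<nu>. emeasure \<nu> S \<partial>Q) = (\<integral>\<^sup>+\<nu>. \<integral>\<^sup>+x. indicator S x \<partial>\<nu> \<partial>Q)"
    using assms by (intro nn_integral_cong) simp
  also have "\<dots> = (\<integral>\<^sup>+x. \<integral>\<^sup>+\<nu>. indicator S x \<partial>Q \<partial>\<Lambda>)"
    by (rule mecke_Q) measurable
  also have "\<dots> = 0" using assms by simp
  finally show ?thesis by (subst (asm) nn_integral_0_iff_AE) simp_all
qed

lemma restr_null:
  assumes "\<nu> \<in> space N" "S \<in> sets M" "emeasure \<nu> S = 0"
  shows "restr \<nu> (space M - S) = \<nu>"
proof (rule N_eqI)
  fix C assume C: "C \<in> sets M"
  have "S \<in> null_sets \<nu>" using assms by (simp add: null_sets_def)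
  then have "emeasure \<nu> (C - S) = emeasure \<nu> C" using C assms by (intro emeasure_Diff_null_set) auto
  moreover have "C \<inter> (space M - S) = C - S" using sets.sets_into_space[OF C] by auto
  ultimately show "emeasure (restr \<nu> (space M - S)) C = emeasure \<nu> C"
    using C assms by (simp add: emeasure_restr)
qed (use assms in \<open>auto intro: restr_in_N\<close>)

text \<open>Given \<mu>, the deleted region is a fixed null set, which an independent \<nu> avoids
  almost surely. The deletion is thus invisible in law, while pathwise it produces the configuration
  to which x is added at a jump.\<close>

lemma AE_A_eq_glue:
  assumes "\<mu> \<in> space N" "x \<in> space M"
  shows "AE \<nu> in Q. A x \<mu> \<nu> = glue (Zi \<mu> - V x \<mu>) \<mu> \<nu>"
proof -
  have S: "V x \<mu> - W x \<mu> \<in> sets M" using V_sets W_sets assms by auto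
  have "AE \<nu> in Q. \<nu> \<in> space N" by (rule AE_I2) simp
  with AE_null[OF S V_minus_W_null[OF assms(1)]] show ?thesis
  proof eventually_elim
    case (elim \<nu>)
    then show ?case by (simp add: A_def restr_null[OF _ S])
  qed
qed

text \<open>The point x belongs to the deleted region itself, and this region depends on \<mu>
  alone.\<close>

lemma A_add_point_snd:
  assumes "\<mu> \<in> space N" "\<nu> \<in> space N" "x \<in> space M" "x \<in> Zi \<mu>"
  shows "A x \<mu> (add_point \<nu> x) = A x \<mu> \<nu>"
proof -
  have S: "V x \<mu> - W x \<mu> \<in> sets M" using V_sets W_sets assms by auto
  have x: "x \<notin> space M - (V x \<mu> - W x \<mu>)" using assms mem_V_self not_mem_W_self by auto
  have "restr (add_point \<nu> x) (space M - (V x \<mu> - W x \<mu>)) = restr \<nu> (space M - (V x \<mu> - W x \<mu>))"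
    using assms S x
    by (intro N_eqI restr_in_N add_point_in_N) (auto simp: emeasure_restr emeasure_add_point add_point_in_N)
  then show ?thesis by (simp add: A_def)
qed

end

section \<open>Integrals over the explored points\<close>

context localized_space
begin

abbreviation adiff :: "('a measure \<Rightarrow> real) \<Rightarrow> 'a \<Rightarrow> 'a measure \<Rightarrow> ennreal" where
  "adiff f x \<mu> \<equiv> ennreal \<bar>diff_op M x f \<mu>\<bar>"

lemma measurable_diff_op:
  assumes "f \<in> borel_measurable N" "K \<in> measurable \<Omega> N" "g \<in> measurable \<Omega> M"
  shows "(\<lambda>\<omega>. ennreal \<bar>diff_op M (g \<omega>) f (K \<omega>)\<bar>) \<in> borel_measurable \<Omega>"
proof -
  note [measurable] = assms
  show ?thesis unfolding diff_op_def by measurable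
qed

lemma sigma_finite_N: "\<mu> \<in> space N \<Longrightarrow> sigma_finite_measure \<mu>"
proof
  assume \<mu>: "\<mu> \<in> space N"
  show "\<exists>A. countable A \<and> A \<subseteq> sets \<mu> \<and> \<Union>A = space \<mu> \<and> (\<forall>a\<in>A. emeasure \<mu> a \<noteq> \<infinity>)"
    using \<mu> UN_B N_finite[OF \<mu> B_in_L] by (intro exI[of _ "range B"]) (auto simp: less_top)
qed

end

context ctdt_space
begin

lemma measurable_VW:
  assumes "f \<in> measurable \<Omega> N" "K \<in> measurable \<Omega> N" "g \<in> measurable \<Omega> M"
  shows "(\<lambda>\<omega>. emeasure (K \<omega>) (V (g \<omega>) (f \<omega>) - W (g \<omega>) (f \<omega>))) \<in> borel_measurable \<Omega>"
proof -
  note [measurable] = assms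
  have "Measurable.pred (\<Omega> \<Otimes>\<^sub>M M) (\<lambda>z. T (f (fst z)) (snd z) \<le> T (f (fst z)) (g (fst z)) \<and>
      T (f (fst z)) (snd z) < \<infinity> \<and> \<not> T (f (fst z)) (snd z) < T (f (fst z)) (g (fst z)))"
    by measurable
  then have "Measurable.pred (\<Omega> \<Otimes>\<^sub>M M) (\<lambda>z. snd z \<in> V (g (fst z)) (f (fst z)) - W (g (fst z)) (f (fst z)))"
    by (rule measurable_cong[THEN iffD1, rotated]) (auto simp: space_pair_measure V_def W_def)
  then have "(\<lambda>(\<omega>, y). indicator (V (g \<omega>) (f \<omega>) - W (g \<omega>) (f \<omega>)) y :: ennreal) \<in> borel_measurable (\<Omega> \<Otimes>\<^sub>M M)"
    unfolding case_prod_beta' by (intro borel_measurable_indicator') (simp add: pred_def)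
  from measurable_nn_integral_kernel[OF this assms(2)]
  show ?thesis
  proof (rule measurable_cong[THEN iffD1, rotated])
    fix \<omega> assume "\<omega> \<in> space \<Omega>"
    then have "f \<omega> \<in> space N" "g \<omega> \<in> space M" "K \<omega> \<in> space N" using assms[THEN measurable_space] by auto
    then show "(\<integral>\<^sup>+y. indicator (V (g \<omega>) (f \<omega>) - W (g \<omega>) (f \<omega>)) y \<partial>K \<omega>) = emeasure (K \<omega>) (V (g \<omega>) (f \<omega>) - W (g \<omega>) (f \<omega>))"
      by (intro nn_integral_indicator) (auto intro!: sets.Diff V_sets W_sets)
  qed
qed

definition influence :: "('a measure \<Rightarrow> real) \<Rightarrow> ennreal" where
  "influence f = (\<integral>\<^sup>+x. emeasure Q {\<mu>\<in>space N. x \<in> Zi \<mu>} * (\<integral>\<^sup>+\<mu>. adiff f x \<mu> \<partial>Q) \<partial>\<Lambda>)"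

context
  fixes f :: "'a measure \<Rightarrow> real"
  assumes f: "f \<in> borel_measurable N"
begin

lemma integrand_measurable:
  "(\<lambda>z. indicator (Zi (fst (fst z))) (snd z) * adiff f (snd z) (A (snd z) (fst (fst z)) (snd (fst z))))
    \<in> borel_measurable ((N \<Otimes>\<^sub>M N) \<Otimes>\<^sub>M M)"
proof -
  note [measurable (raw)] = stops_pred[OF stops_Zi] measurable_diff_op[OF f]
  have [measurable]: "(\<lambda>z. indicator (Zi (fst (fst z))) (snd z) :: ennreal) \<in> borel_measurable ((N \<Otimes>\<^sub>M N) \<Otimes>\<^sub>M M)"
    by (rule borel_measurable_indicator') measurable
  show ?thesis by measurable
qed

text \<open>The factorisation of \<open>glue_law\<close> for the difference operator at x. The
  integrand \<open>K\<close> may differ from the glued expression on null sets, and the nested pair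
  is left open because points of \<mu> and of \<nu> lead to different pairs.\<close>

lemma EE_adiff:
  assumes "stops V'" "stops U'" "\<And>\<mu>. \<mu> \<in> space N \<Longrightarrow> V' \<mu> \<subseteq> U' \<mu>" and x [measurable]: "x \<in> space M"
    and V': "\<And>\<mu>. \<mu> \<in> space N \<Longrightarrow> x \<in> V' \<mu> \<longleftrightarrow> x \<in> Zi \<mu>"
    and K: "\<And>\<mu>. \<mu> \<in> space N \<Longrightarrow> x \<in> V' \<mu> \<Longrightarrow> AE \<nu> in Q. \<nu> \<in> space N \<longrightarrow> K \<mu> \<nu> = adiff f x (glue (U' \<mu> - V' \<mu>) \<mu> \<nu>)"
  shows "EE (\<lambda>\<mu> \<nu>. indicator (V' \<mu>) x * K \<mu> \<nu>) = emeasure Q {\<mu>\<in>space N. x \<in> Zi \<mu>} * (\<integral>\<^sup>+\<mu>. adiff f x \<mu> \<partial>Q)"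
proof -
  have "adiff f x \<in> borel_measurable N" by (rule measurable_diff_op[OF f]) measurable
  note law = glue_law[OF assms(1-4) this]
  have "EE (\<lambda>\<mu> \<nu>. indicator (V' \<mu>) x * K \<mu> \<nu>) = EE (\<lambda>\<mu> \<nu>. indicator (V' \<mu>) x * adiff f x (glue (U' \<mu> - V' \<mu>) \<mu> \<nu>))"
  proof (rule nn_integral_cong, rule nn_integral_cong_AE)
    fix \<mu> assume "\<mu> \<in> space Q"
    show "AE \<nu> in Q. indicator (V' \<mu>) x * K \<mu> \<nu> = indicator (V' \<mu>) x * adiff f x (glue (U' \<mu> - V' \<mu>) \<mu> \<nu>)"
    proof (cases "x \<in> V' \<mu>")
      case True
      with \<open>\<mu> \<in> space Q\<close> have "AE \<nu> in Q. \<nu> \<in> space N \<longrightarrow> K \<mu> \<nu> = adiff f x (glue (U' \<mu> - V' \<mu>) \<mu> \<nu>)"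
        by (intro K) simp_all
      with AE_space show ?thesis by eventually_elim simp
    qed simp
  qed
  also have "{\<mu>\<in>space N. x \<in> Zi \<mu>} = {\<mu>\<in>space N. x \<in> V' \<mu>}" using V' by auto
  ultimately show ?thesis using law by simp
qed

lemma integral_points_snd: "EE (\<lambda>\<mu> \<nu>. \<integral>\<^sup>+x. indicator (Zi \<mu>) x * adiff f x (A x \<mu> \<nu>) \<partial>\<nu>) = influence f"
  unfolding mecke_snd[OF integrand_measurable] influence_def
proof (rule nn_integral_cong)
  fix x assume "x \<in> space \<Lambda>"
  then have x: "x \<in> space M" by simp
  show "EE (\<lambda>\<mu> \<nu>. indicator (Zi \<mu>) x * adiff f x (A x \<mu> (add_point \<nu> x))) =
      emeasure Q {\<mu>\<in>space N. x \<in> Zi \<mu>} * (\<integral>\<^sup>+\<mu>. adiff f x \<mu> \<partial>Q)"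
    unfolding indicator_V_self[OF x, symmetric]
  proof (rule EE_adiff[OF stops_V[OF x] stops_Zi V_subset_Zi x mem_V_self[OF x]])
    fix \<mu> assume \<mu>: "\<mu> \<in> space N" "x \<in> V x \<mu>"
    show "AE \<nu> in Q. \<nu> \<in> space N \<longrightarrow> adiff f x (A x \<mu> (add_point \<nu> x)) = adiff f x (glue (Zi \<mu> - V x \<mu>) \<mu> \<nu>)"
      using AE_A_eq_glue[OF \<mu>(1) x] by eventually_elim (use \<mu> x in \<open>simp add: A_add_point_snd mem_V_self\<close>)
  qed
qed

text \<open>A point x of \<mu> alters the exploration, so both stopping sets are taken at \<mu> with
  x added. The event is still that x is in \<open>Zi \<mu>\<close>. The glued configuration ignores
  the extra point, since inside \<open>V\<close> it is filled from \<nu>.\<close>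

lemma integral_points_fst: "EE (\<lambda>\<mu> \<nu>. \<integral>\<^sup>+x. indicator (Zi \<mu>) x * adiff f x (A x \<mu> \<nu>) \<partial>\<mu>) = influence f"
  unfolding mecke_fst[OF integrand_measurable] influence_def
proof (rule nn_integral_cong)
  fix x assume "x \<in> space \<Lambda>"
  then have x: "x \<in> space M" by simp
  let ?V = "\<lambda>\<mu>. V x (add_point \<mu> x)" and ?U = "\<lambda>\<mu>. Zi (add_point \<mu> x)"
  show "EE (\<lambda>\<mu> \<nu>. indicator (?U \<mu>) x * adiff f x (A x (add_point \<mu> x) \<nu>)) =
      emeasure Q {\<mu>\<in>space N. x \<in> Zi \<mu>} * (\<integral>\<^sup>+\<mu>. adiff f x \<mu> \<partial>Q)"
    unfolding indicator_V_self[OF x, symmetric]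
  proof (rule EE_adiff[OF stops_shift[OF stops_V[OF x] x] stops_shift[OF stops_Zi x] V_subset_Zi[OF add_point_in_N] x])
    fix \<mu> assume \<mu>: "\<mu> \<in> space N"
    note \<mu>x = add_point_in_N[OF \<mu>, of x]
    show "x \<in> ?V \<mu> \<longleftrightarrow> x \<in> Zi \<mu>"
      using mem_V_self[OF x] stops_add_point(2)[OF stops_Zi \<mu>] by simp
    assume "x \<in> ?V \<mu>"
    moreover have "?U \<mu> - ?V \<mu> \<in> sets M" using V_sets[OF \<mu>x x] Zi_sets[OF \<mu>x] by auto
    ultimately show "AE \<nu> in Q. \<nu> \<in> space N \<longrightarrow> adiff f x (A x (add_point \<mu> x) \<nu>) = adiff f x (glue (?U \<mu> - ?V \<mu>) \<mu> \<nu>)"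
      using AE_A_eq_glue[OF \<mu>x x] by (auto elim!: eventually_mono simp: glue_add_point(2)[OF \<mu>])
  qed
qed

end

text \<open>Being found at the same finite time is a symmetric relation, so Fubini may exchange
  \<Lambda> and \<mu>: for each fixed y, the points found together with y form a \<Lambda>-null
  set.\<close>

lemma AE_no_simultaneous_fst:
  assumes \<mu>: "\<mu> \<in> space N"
  shows "AE x in \<Lambda>. x \<in> Zi \<mu> \<longrightarrow> emeasure \<mu> (V x \<mu> - W x \<mu>) = 0"
proof -
  interpret \<mu>: sigma_finite_measure \<mu> using \<mu> by (rule sigma_finite_N)
  interpret pair_sigma_finite \<Lambda> \<mu> ..
  have [measurable_cong]: "sets \<mu> = sets M" using \<mu> by simp
  note [measurable] = \<mu>
  define E where "E x y = (if T \<mu> x = T \<mu> y \<and> T \<mu> y < \<infinity> then 1 else 0 :: ennreal)" for x y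
  have [measurable]: "T \<mu> \<in> borel_measurable M"
    using measurable_T[of "\<lambda>_. \<mu>" M "\<lambda>x. x"] \<mu> by simp
  have [measurable]: "(\<lambda>(x, y). E x y) \<in> borel_measurable (\<Lambda> \<Otimes>\<^sub>M \<mu>)"
    unfolding E_def by measurable
  have VW: "E x y = indicator (V x \<mu> - W x \<mu>) y" if "y \<in> space M" for x y
    using that by (auto simp: E_def V_def W_def indicator_def)
  have E_sym: "E x y = E y x" for x y by (auto simp: E_def)
  have "(\<integral>\<^sup>+x. \<integral>\<^sup>+y. E x y \<partial>\<mu> \<partial>\<Lambda>) = (\<integral>\<^sup>+y. \<integral>\<^sup>+x. E x y \<partial>\<Lambda> \<partial>\<mu>)"
    by (rule Fubini'[symmetric]) measurable
  also have "\<dots> = (\<integral>\<^sup>+y. 0 \<partial>\<mu>)"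
  proof (rule nn_integral_cong)
    fix y assume "y \<in> space \<mu>"
    then have y: "y \<in> space M" using \<mu> by simp
    have "(\<integral>\<^sup>+x. E x y \<partial>\<Lambda>) = (\<integral>\<^sup>+x. indicator (V y \<mu> - W y \<mu>) x \<partial>\<Lambda>)"
      by (rule nn_integral_cong) (simp add: E_sym[of _ y] VW)
    also have "\<dots> = 0"
      using V_minus_W_null[OF \<mu>] V_sets[OF \<mu> y] W_sets[OF \<mu> y] by simp
    finally show "(\<integral>\<^sup>+x. E x y \<partial>\<Lambda>) = 0" .
  qed
  finally have "(\<integral>\<^sup>+x. \<integral>\<^sup>+y. E x y \<partial>\<mu> \<partial>\<Lambda>) = 0" by simp
  moreover have "(\<lambda>x. \<integral>\<^sup>+y. E x y \<partial>\<mu>) \<in> borel_measurable \<Lambda>" by measurable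
  ultimately have "AE x in \<Lambda>. (\<integral>\<^sup>+y. E x y \<partial>\<mu>) = 0"
    by (simp only: nn_integral_0_iff_AE)
  moreover have "(\<integral>\<^sup>+y. E x y \<partial>\<mu>) = emeasure \<mu> (V x \<mu> - W x \<mu>)" if "x \<in> space \<Lambda>" for x
  proof -
    have "(\<integral>\<^sup>+y. E x y \<partial>\<mu>) = (\<integral>\<^sup>+y. indicator (V x \<mu> - W x \<mu>) y \<partial>\<mu>)"
      using \<mu> by (intro nn_integral_cong) (simp add: VW)
    then show ?thesis using that V_sets[OF \<mu>, of x] W_sets[OF \<mu>, of x] \<mu> by simp
  qed
  ultimately show ?thesis by auto
qed

text \<open>The threshold is 1 because x counts itself after the Mecke shift. Other points of \<nu>
  avoid the null region almost surely, and points of \<mu> are excluded for almost every x. Thus no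
  point of \<nu> is found together with another point of either process.\<close>

lemma no_simultaneous_points:
  "EE (\<lambda>\<mu> \<nu>. \<integral>\<^sup>+x. indicator {x. x \<in> Zi \<mu> \<and> 1 < emeasure (add_measure \<mu> \<nu>) (V x \<mu> - W x \<mu>)} x \<partial>\<nu>) = 0"
proof -
  note [measurable (raw)] = stops_pred[OF stops_Zi] measurable_VW
  let ?k = "\<lambda>\<mu> \<nu> x. indicator {x. x \<in> Zi \<mu> \<and> 1 < emeasure (add_measure \<mu> \<nu>) (V x \<mu> - W x \<mu>)} x :: ennreal"
  let ?E = "\<lambda>\<mu> x. indicator {x. x \<in> Zi \<mu> \<and> 0 < emeasure \<mu> (V x \<mu> - W x \<mu>)} x :: ennreal"
  have "(\<lambda>z. ?k (fst (fst z)) (snd (fst z)) (snd z)) \<in> borel_measurable ((N \<Otimes>\<^sub>M N) \<Otimes>\<^sub>M M)"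
    by (rule borel_measurable_indicator') (unfold mem_Collect_eq, measurable)
  then have "EE (\<lambda>\<mu> \<nu>. \<integral>\<^sup>+x. ?k \<mu> \<nu> x \<partial>\<nu>) = (\<integral>\<^sup>+x. EE (\<lambda>\<mu> \<nu>. ?k \<mu> (add_point \<nu> x) x) \<partial>\<Lambda>)"
    by (rule mecke_snd)
  also have "\<dots> = (\<integral>\<^sup>+x. \<integral>\<^sup>+\<mu>. ?E \<mu> x \<partial>Q \<partial>\<Lambda>)"
  proof (intro nn_integral_cong)
    fix x \<mu> assume "x \<in> space \<Lambda>" "\<mu> \<in> space Q"
    then have x: "x \<in> space M" and \<mu>: "\<mu> \<in> space N" by auto
    have S: "V x \<mu> - W x \<mu> \<in> sets M" using V_sets[OF \<mu> x] W_sets[OF \<mu> x] by auto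
    have "AE \<nu> in Q. \<nu> \<in> space N" by (rule AE_I2) simp
    with AE_null[OF S V_minus_W_null[OF \<mu>]] have "AE \<nu> in Q. ?k \<mu> (add_point \<nu> x) x = ?E \<mu> x"
    proof eventually_elim
      case (elim \<nu>)
      have "emeasure (add_measure \<mu> (add_point \<nu> x)) (V x \<mu> - W x \<mu>) = emeasure \<mu> (V x \<mu> - W x \<mu>) + 1"
        if "x \<in> Zi \<mu>"
        using that elim \<mu> S mem_V_self[OF x] not_mem_W_self
        by (simp add: emeasure_add_measure emeasure_add_point[OF _ S])
      moreover have "1 < e + 1 \<longleftrightarrow> 0 < e" for e :: ennreal
        by (cases e) (auto simp: ennreal_less_iff simp flip: ennreal_1 ennreal_plus ennreal_0)
      ultimately show ?case by (auto simp: indicator_def)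
    qed
    then have "(\<integral>\<^sup>+\<nu>. ?k \<mu> (add_point \<nu> x) x \<partial>Q) = (\<integral>\<^sup>+\<nu>. ?E \<mu> x \<partial>Q)"
      by (rule nn_integral_cong_AE)
    then show "(\<integral>\<^sup>+\<nu>. ?k \<mu> (add_point \<nu> x) x \<partial>Q) = ?E \<mu> x" by simp
  qed
  also have "\<dots> = (\<integral>\<^sup>+\<mu>. \<integral>\<^sup>+x. ?E \<mu> x \<partial>\<Lambda> \<partial>Q)"
  proof (rule \<Lambda>Q.Fubini'[symmetric])
    have "(\<lambda>z. ?E (snd z) (fst z)) \<in> borel_measurable (\<Lambda> \<Otimes>\<^sub>M Q)"
      by (rule borel_measurable_indicator') (unfold mem_Collect_eq, measurable)
    then show "(\<lambda>(x, \<mu>). ?E \<mu> x) \<in> borel_measurable (\<Lambda> \<Otimes>\<^sub>M Q)" by (simp add: case_prod_beta')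
  qed
  also have "\<dots> = (\<integral>\<^sup>+\<mu>. 0 \<partial>Q)"
  proof (rule nn_integral_cong)
    fix \<mu> assume "\<mu> \<in> space Q"
    then have "AE x in \<Lambda>. ?E \<mu> x = 0"
      using AE_no_simultaneous_fst[of \<mu>] by (auto simp: indicator_def)
    then have "(\<integral>\<^sup>+x. ?E \<mu> x \<partial>\<Lambda>) = (\<integral>\<^sup>+x. 0 \<partial>\<Lambda>)" by (rule nn_integral_cong_AE)
    then show "(\<integral>\<^sup>+x. ?E \<mu> x \<partial>\<Lambda>) = 0" by simp
  qed
  finally show ?thesis by simp
qed

end

section \<open>Jumps of the resampled configuration\<close>

text \<open>Split \<open>D\<close> at a rational level of the Borel isomorphism: the two masses are
  natural numbers with sum 1, so one half is null. Removing a null half for every rational leaves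
  mass 1 on a set whose points no rational separates, hence on a single point.\<close>

lemma (in localized_space) unit_mass_concentrated:
  assumes borel: "is_borel_space M" and \<kappa>: "\<kappa> \<in> space N" and D: "D \<in> L" "emeasure \<kappa> D = 1"
  obtains x where "x \<in> D" "{x} \<in> sets M" "emeasure \<kappa> {x} = 1" "emeasure \<kappa> (D - {x}) = 0"
proof -
  obtain S :: "real set" and \<phi> g where S: "S \<in> sets borel"
    and \<phi>: "\<phi> \<in> measurable M (restrict_space borel S)" and g: "\<And>x. x \<in> space M \<Longrightarrow> g (\<phi> x) = x"
    using borel unfolding is_borel_space_def by blast
  have \<phi>b [measurable]: "\<phi> \<in> borel_measurable M"
    using measurable_restrict_space2_iff[THEN iffD1, OF \<phi>] by simp
  have DM [measurable]: "D \<in> sets M" using D L_sets by simp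
  have sp: "D \<subseteq> space M" using sets.sets_into_space[OF DM] .
  have [measurable_cong]: "sets \<kappa> = sets M" using \<kappa> by simp
  define lo up where "lo q = {x\<in>D. \<phi> x \<le> q}" and "up q = {x\<in>D. q < \<phi> x}" for q
  have lu [measurable]: "lo q \<in> sets M" "up q \<in> sets M" for q
  proof -
    have "lo q = D \<inter> {x\<in>space M. \<phi> x \<le> q}" "up q = D \<inter> {x\<in>space M. q < \<phi> x}"
      using sp by (auto simp: lo_def up_def)
    then show "lo q \<in> sets M" "up q \<in> sets M" by simp_all
  qed
  define X where "X q = (if emeasure \<kappa> (lo q) = 0 then lo q else up q)" for q
  have X: "X q \<in> null_sets \<kappa>" for q
  proof -
    have "lo q \<in> L" "up q \<in> L" using lu by (auto intro!: L_subset[OF D(1)] simp: lo_def up_def)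
    then obtain k l :: nat where kl: "emeasure \<kappa> (lo q) = of_nat k" "emeasure \<kappa> (up q) = of_nat l"
      using N_nat[OF \<kappa>] by metis
    have "emeasure \<kappa> (lo q) + emeasure \<kappa> (up q) = emeasure \<kappa> (lo q \<union> up q)"
      by (intro plus_emeasure) (use lu \<kappa> in \<open>auto simp: lo_def up_def\<close>)
    also have "lo q \<union> up q = D" by (auto simp: lo_def up_def)
    finally have "(of_nat (k + l) :: ennreal) = of_nat 1" using D(2) kl by simp
    then have "k + l = 1" by (simp only: of_nat_eq_iff)
    then have "k = 0 \<or> l = 0" by auto
    then have "emeasure \<kappa> (X q) = 0" using kl by (auto simp: X_def)
    moreover have "X q \<in> sets \<kappa>" using lu \<kappa> by (simp add: X_def)
    ultimately show ?thesis by (simp add: null_sets_def)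
  qed
  define E where "E = D - (\<Union>q\<in>\<rat>. X q)"
  have U: "(\<Union>q\<in>\<rat>. X q) \<in> null_sets \<kappa>"
    by (intro null_sets_UN' X countable_rat)
  have E1: "emeasure \<kappa> E = 1"
    unfolding E_def using emeasure_Diff_null_set[OF U] D \<kappa> by simp
  have EM: "E \<in> sets M" unfolding E_def using U \<kappa> by auto
  obtain x where x: "x \<in> E"
    using E1 by (cases "E = {}") auto
  have uniq: "y = x" if y: "y \<in> E" for y
  proof (rule ccontr)
    assume "y \<noteq> x"
    have le: "\<not> \<phi> a < \<phi> b" if ab: "a \<in> E" "b \<in> E" for a b
    proof
      assume "\<phi> a < \<phi> b"
      then obtain q where q: "q \<in> \<rat>" "\<phi> a < q" "q < \<phi> b" using Rats_dense_in_real by blast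
      then have "a \<in> lo q" "b \<in> up q" using ab by (auto simp: E_def lo_def up_def)
      then have "a \<in> X q \<or> b \<in> X q" by (auto simp: X_def)
      then show False using ab q(1) by (auto simp: E_def)
    qed
    have "x \<in> space M" "y \<in> space M" using x y sp by (auto simp: E_def)
    then have "\<phi> x \<noteq> \<phi> y" using g \<open>y \<noteq> x\<close> by metis
    then show False using le[OF x y] le[OF y x] by auto
  qed
  have Ex: "E = {x}" using x by (intro equalityI subsetI) (simp_all add: uniq)
  show thesis
  proof
    show "x \<in> D" using x by (simp add: E_def)
    show "{x} \<in> sets M" "emeasure \<kappa> {x} = 1" using EM E1 unfolding Ex by simp_all
    have "D - E = D \<inter> (\<Union>q\<in>\<rat>. X q)" by (simp add: E_def Diff_Diff_Int)
    moreover have "D \<inter> (\<Union>q\<in>\<rat>. X q) \<in> null_sets \<kappa>"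
      using U by (rule null_set_Int1) (simp add: DM \<kappa>)
    ultimately show "emeasure \<kappa> (D - {x}) = 0" by (simp only: Ex null_setsD1)
  qed
qed

context ctdt_space
begin

lemma Z_subset_Zi: "0 \<le> t \<Longrightarrow> Z t \<mu> \<subseteq> Zi \<mu>"
  by (auto simp: Z_infty_def)

lemma Z_subset_left_lim: "0 \<le> s \<Longrightarrow> s < t \<Longrightarrow> Z s \<mu> \<subseteq> left_lim Z t \<mu>"
  by (auto simp: left_lim_def)

lemma left_lim_subset_Z: "\<mu> \<in> space N \<Longrightarrow> 0 \<le> t \<Longrightarrow> left_lim Z t \<mu> \<subseteq> Z t \<mu>"
proof
  fix y assume "\<mu> \<in> space N" "y \<in> left_lim Z t \<mu>"
  then obtain q where "0 \<le> q" "q < t" "y \<in> Z q \<mu>" by (auto simp: left_lim_def)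
  then show "y \<in> Z t \<mu>" using Z_mono[OF \<open>\<mu> \<in> space N\<close>, of q t] by auto
qed

text \<open>The time is the infimum of those at which new mass has appeared. It is attained because
  the masses of the decreasing regions \<open>Z (u k) \<mu> - Z s \<mu>\<close> are natural numbers:
  if they tended to 0, one of them would vanish, against the choice of the infimum.\<close>

lemma first_discovery:
  assumes \<mu>: "\<mu> \<in> space N" and \<kappa>: "\<kappa> \<in> space N" and s: "0 \<le> s" "s \<le> t"
    and pos: "emeasure \<kappa> (Z t \<mu> - Z s \<mu>) \<noteq> 0"
  obtains r where "s < r" "r \<le> t" "emeasure \<kappa> (Z r \<mu> - Z s \<mu>) \<noteq> 0" "emeasure \<kappa> (left_lim Z r \<mu> - Z s \<mu>) = 0"
proof -
  define R where "R = {r. s \<le> r \<and> r \<le> t \<and> emeasure \<kappa> (Z r \<mu> - Z s \<mu>) \<noteq> 0}"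
  define r where "r = Inf R"
  have t: "t \<in> R" using pos s by (simp add: R_def)
  have bdd: "bdd_below R" by (auto simp: R_def bdd_below_def)
  have sr: "s \<le> r" unfolding r_def using t by (intro cInf_greatest) (auto simp: R_def)
  have rt: "r \<le> t" unfolding r_def using t bdd by (rule cInf_lower)
  have diffL: "Z q \<mu> - Z s \<mu> \<in> L" if "0 \<le> q" for q
    by (rule L_subset[OF Z_local[OF that \<mu>] sets.Diff[OF Z_sets[OF that \<mu>] Z_sets[OF s(1) \<mu>]] Diff_subset])
  have below: "emeasure \<kappa> (Z q \<mu> - Z s \<mu>) = 0" if "s \<le> q" "q < r" for q
  proof (rule ccontr)
    assume "emeasure \<kappa> (Z q \<mu> - Z s \<mu>) \<noteq> 0"
    then have "q \<in> R" using that rt by (simp add: R_def)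
    then have "r \<le> q" unfolding r_def using bdd by (rule cInf_lower)
    then show False using that by simp
  qed
  have nz: "emeasure \<kappa> (Z r \<mu> - Z s \<mu>) \<noteq> 0"
  proof
    assume zero: "emeasure \<kappa> (Z r \<mu> - Z s \<mu>) = 0"
    define u where "u k = r + 1 / real (Suc k)" for k
    have u: "r < u k" "0 \<le> u k" for k
    proof -
      show "r < u k" by (simp add: u_def)
      then show "0 \<le> u k" using sr s by simp
    qed
    have anti: "u l \<le> u k" if "k \<le> l" for k l
      using that by (simp add: u_def frac_le)
    have dec: "decseq (\<lambda>k. Z (u k) \<mu> - Z s \<mu>)"
      unfolding decseq_def using Z_mono[OF \<mu> u(2) anti] by blast
    have "(\<Inter>k. Z (u k) \<mu> - Z s \<mu>) = Z r \<mu> - Z s \<mu>"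
    proof
      show "Z r \<mu> - Z s \<mu> \<subseteq> (\<Inter>k. Z (u k) \<mu> - Z s \<mu>)"
        using Z_mono[OF \<mu>, of r "u _"] u(1) sr s by (auto simp: less_imp_le)
      show "(\<Inter>k. Z (u k) \<mu> - Z s \<mu>) \<subseteq> Z r \<mu> - Z s \<mu>"
      proof
        fix y assume y: "y \<in> (\<Inter>k. Z (u k) \<mu> - Z s \<mu>)"
        have "y \<in> Z q \<mu>" if q: "r < q" for q
        proof -
          obtain k where "inverse (real (Suc k)) < q - r" using reals_Archimedean[of "q - r"] q by auto
          then have "u k \<le> q" by (simp add: u_def inverse_eq_divide)
          then show ?thesis using y Z_mono[OF \<mu> u(2)] by blast
        qed
        then show "y \<in> Z r \<mu> - Z s \<mu>" using y Z_right[OF \<mu>, of r] sr s by auto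
      qed
    qed
    moreover have "(INF k. emeasure \<kappa> (Z (u k) \<mu> - Z s \<mu>)) = emeasure \<kappa> (\<Inter>k. Z (u k) \<mu> - Z s \<mu>)"
      using dec diffL[OF u(2)] \<kappa> N_finite[OF \<kappa> diffL[OF u(2)]]
      by (intro INF_emeasure_decseq) (auto simp: L_sets less_top)
    ultimately have "(INF k. emeasure \<kappa> (Z (u k) \<mu> - Z s \<mu>)) < 1" using zero by simp
    then obtain k where k: "emeasure \<kappa> (Z (u k) \<mu> - Z s \<mu>) < 1" by (auto simp: INF_less_iff)
    obtain l :: nat where l: "emeasure \<kappa> (Z (u k) \<mu> - Z s \<mu>) = of_nat l" using N_nat[OF \<kappa> diffL[OF u(2)]] by blast
    have "l = 0"
      using k l by (cases l) auto
    then have uk0: "emeasure \<kappa> (Z (u k) \<mu> - Z s \<mu>) = 0" using l by simp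
    have "R \<noteq> {}" "Inf R < u k" using t u(1) by (auto simp: r_def)
    from cInf_lessD[OF this] obtain q where q: "q \<in> R" "q < u k" by blast
    have q0: "0 \<le> q" using q(1) s by (simp add: R_def)
    have "emeasure \<kappa> (Z q \<mu> - Z s \<mu>) \<le> emeasure \<kappa> (Z (u k) \<mu> - Z s \<mu>)"
      using Z_mono[OF \<mu> q0 less_imp_le[OF q(2)]] diffL[OF u(2)[of k]] \<kappa> by (intro emeasure_mono) (auto simp: L_sets)
    then show False using uk0 q(1) by (simp add: R_def)
  qed
  have "r \<noteq> s"
  proof
    assume "r = s"
    then show False using nz by simp
  qed
  then have "s < r" using sr by simp
  \<comment> \<open>Countably many times exhaust the left limit. The maximum with s keeps them in
    the range covered by \<open>below\<close>.\<close>
  have sub: "left_lim Z r \<mu> - Z s \<mu> \<subseteq> (\<Union>k. Z (max s (r - 1 / real (Suc k))) \<mu> - Z s \<mu>)"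
  proof
    fix y assume y: "y \<in> left_lim Z r \<mu> - Z s \<mu>"
    then obtain q where q: "0 \<le> q" "q < r" "y \<in> Z q \<mu>" by (auto simp: left_lim_def)
    obtain k where "inverse (real (Suc k)) < r - q" using reals_Archimedean[of "r - q"] q by auto
    then have "q \<le> max s (r - 1 / real (Suc k))" by (simp add: inverse_eq_divide)
    then have "y \<in> Z (max s (r - 1 / real (Suc k))) \<mu>" using Z_mono[OF \<mu> q(1)] q(3) by blast
    with y show "y \<in> (\<Union>k. Z (max s (r - 1 / real (Suc k))) \<mu> - Z s \<mu>)" by auto
  qed
  have nul: "(\<Union>k. Z (max s (r - 1 / real (Suc k))) \<mu> - Z s \<mu>) \<in> null_sets \<kappa>"
  proof (intro null_sets_UN)
    fix k
    have "emeasure \<kappa> (Z (max s (r - 1 / real (Suc k))) \<mu> - Z s \<mu>) = 0"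
      using \<open>s < r\<close> by (intro below) auto
    moreover have "Z (max s (r - 1 / real (Suc k))) \<mu> - Z s \<mu> \<in> sets M"
      using s by (intro L_sets diffL) auto
    ultimately show "Z (max s (r - 1 / real (Suc k))) \<mu> - Z s \<mu> \<in> null_sets \<kappa>"
      using \<kappa> by (simp add: null_sets_def)
  qed
  have "left_lim Z r \<mu> \<in> sets M" using \<mu> sr s(1) by (intro left_lim_sets) simp_all
  then have "left_lim Z r \<mu> - Z s \<mu> \<in> sets \<kappa>"
    using Z_sets[OF s(1) \<mu>] by (simp add: N_sets[OF \<kappa>] sets.Diff)
  from null_sets_subset[OF nul this sub] have "emeasure \<kappa> (left_lim Z r \<mu> - Z s \<mu>) = 0"
    by (rule null_setsD1)
  with \<open>s < r\<close> rt nz show thesis by (rule that)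
qed

lemma glue_eqI:
  assumes \<mu>\<nu>: "\<mu> \<in> space N" "\<nu> \<in> space N" and S: "S \<in> sets M" "S' \<in> sets M"
    and \<kappa>: "emeasure \<mu> ((S - S') \<union> (S' - S)) = 0" "emeasure \<nu> ((S - S') \<union> (S' - S)) = 0"
  shows "glue S \<mu> \<nu> = glue S' \<mu> \<nu>"
proof (rule N_eqI)
  have *: "AE y in \<rho>. y \<notin> (S - S') \<union> (S' - S)"
    if "\<rho> \<in> space N" "emeasure \<rho> ((S - S') \<union> (S' - S)) = 0" for \<rho>
    using that S by (intro AE_not_in) (auto simp: null_sets_def)
  fix C assume C: "C \<in> sets M"
  have "emeasure \<mu> (C \<inter> S) = emeasure \<mu> (C \<inter> S')"
    using *[OF \<mu>\<nu>(1) \<kappa>(1)] by (intro emeasure_eq_AE) (use C S \<mu>\<nu> in auto)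
  moreover have "emeasure \<nu> (C - S) = emeasure \<nu> (C - S')"
    using *[OF \<mu>\<nu>(2) \<kappa>(2)] by (intro emeasure_eq_AE) (use C S \<mu>\<nu> in auto)
  ultimately show "emeasure (glue S \<mu> \<nu>) C = emeasure (glue S' \<mu> \<nu>) C"
    using C S \<mu>\<nu> by (simp add: emeasure_glue)
qed (use \<mu>\<nu> S in \<open>auto intro: glue_in_N\<close>)

text \<open>At a time \<open>r\<close> at which exactly one point \<open>x\<close> of \<open>\<mu> + \<nu>\<close> is explored, the resampled
  configuration loses \<open>x\<close> if \<open>x\<close> belongs to \<open>\<mu>\<close> and gains it if \<open>x\<close> belongs to \<open>\<nu>\<close>.\<close>

lemma jump:
  assumes \<mu>: "\<mu> \<in> space N" and \<nu>: "\<nu> \<in> space N" and sr: "0 \<le> s" "s < r"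
    and x: "x \<in> Z r \<mu> - left_lim Z r \<mu>" "{x} \<in> sets M"
    and one: "emeasure (add_measure \<mu> \<nu>) {x} = 1"
    and null: "emeasure (add_measure \<mu> \<nu>) (Z r \<mu> - left_lim Z r \<mu> - {x}) = 0"
      "emeasure (add_measure \<mu> \<nu>) (left_lim Z r \<mu> - Z s \<mu>) = 0"
  shows "\<bar>f (glue (Zi \<mu> - Z s \<mu>) \<mu> \<nu>) - f (glue (Zi \<mu> - Z r \<mu>) \<mu> \<nu>)\<bar> = \<bar>diff_op M x f (A x \<mu> \<nu>)\<bar>"
proof -
  have r0: "0 \<le> r" using sr by simp
  have xM: "x \<in> space M" using x(1) sets.sets_into_space[OF Z_sets[OF r0 \<mu>]] by auto
  let ?D = "Z r \<mu> - left_lim Z r \<mu>" and ?n2 = "left_lim Z r \<mu> - Z s \<mu>"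
  let ?Sr = "Zi \<mu> - Z r \<mu>" and ?Ss = "Zi \<mu> - Z s \<mu>" and ?n = "(?D - {x}) \<union> ?n2"
  have T: "T \<mu> x = ennreal r"
    using x(1) T_le_iff[OF \<mu> r0, of x] T_less_iff[OF r0, of \<mu> x] by (auto simp: not_less intro: antisym)
  have VW: "V x \<mu> = Z r \<mu>" "W x \<mu> = left_lim Z r \<mu>"
    using V_eq_Z[OF \<mu> r0 T] W_eq_left_lim[OF \<mu> r0 T] by auto
  note Zs = Z_sets[OF sr(1) \<mu>] and Zr = Z_sets[OF r0 \<mu>] and l = left_lim_sets[OF \<mu> r0] and i = Zi_sets[OF \<mu>]
  note sub = Z_subset_left_lim[OF sr, of \<mu>] left_lim_subset_Z[OF \<mu> r0] Z_subset_Zi[OF r0, of \<mu>]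
  have D: "?D \<in> sets M" using Zr l by (rule sets.Diff)
  have S: "?Sr \<in> sets M" "?Ss \<in> sets M" using i Zr Zs by auto
  have DL: "{x} \<in> L" by (rule L_subset[OF Z_local[OF r0 \<mu>] x(2)]) (use x(1) in simp)
  have sum: "emeasure \<mu> C + emeasure \<nu> C = emeasure (add_measure \<mu> \<nu>) C" for C
    using \<mu> \<nu> by (simp add: emeasure_add_measure)
  have n1: "emeasure \<mu> (?D - {x}) = 0" "emeasure \<nu> (?D - {x}) = 0"
    and n2: "emeasure \<mu> ?n2 = 0" "emeasure \<nu> ?n2 = 0"
    using sum[of "?D - {x}"] sum[of "?n2"] null by simp_all
  obtain k k' :: nat where k: "emeasure \<mu> {x} = of_nat k" "emeasure \<nu> {x} = of_nat k'"
    using N_nat[OF \<mu> DL] N_nat[OF \<nu> DL] by blast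
  \<comment> \<open>Here k and k' count x in \<mu> and in \<nu>, so exactly one of the processes
    owns x.\<close>
  have "of_nat (k + k') = (of_nat 1 :: ennreal)" using sum[of "{x}"] one k by simp
  then have kk: "k + k' = 1" by (simp only: of_nat_eq_iff)
  have AEs: "AE y in \<rho>. y \<in> S \<longleftrightarrow> y \<in> S'" if "\<rho> \<in> space N" "n \<in> sets M" "emeasure \<rho> n = 0" "(S - S') \<union> (S' - S) \<subseteq> n" for \<rho> n S S'
  proof -
    have "AE y in \<rho>. y \<notin> n" using that by (intro AE_not_in) (auto simp: null_sets_def)
    then show ?thesis using that(4) by (auto elim!: eventually_mono)
  qed
  have n12: "emeasure \<rho> ?n = 0" "?n \<in> sets M"
    if "\<rho> \<in> space N" "emeasure \<rho> (?D - {x}) = 0" "emeasure \<rho> ?n2 = 0" for \<rho>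
  proof -
    show *: "?n \<in> sets M"
      using D x(2) l Zs Zr by (intro sets.Un sets.Diff)
    show "emeasure \<rho> ?n = 0"
      using emeasure_subadditive[of "?D - {x}" \<rho> "?n2"] D x(2) l Zs that
      by (simp add: sets.Diff)
  qed
  note nm = n12[OF \<mu> n1(1) n2(1)] and nn = n12[OF \<nu> n1(2) n2(2)]
  have A: "emeasure (A x \<mu> \<nu>) C = emeasure \<mu> (C \<inter> ?Sr) + emeasure \<nu> (C - ?Sr - ?D)"
    if C: "C \<in> sets M" for C
  proof -
    have "(C - ?Sr) \<inter> (space M - ?D) = C - ?Sr - ?D"
      using sets.sets_into_space[OF C] by auto
    then show ?thesis
      using C S D \<mu> \<nu> unfolding A_def VW by (simp add: emeasure_glue emeasure_restr restr_in_N sets.Diff)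
  qed
  \<comment> \<open>At time s the region found until r is still filled from \<mu>, so x occurs k
    times; at time r it is filled from \<nu>, so x occurs k' times. The remaining differences from
    \<open>A x \<mu> \<nu>\<close> lie in regions that are null for both processes.\<close>
  have s_eq: "emeasure (glue ?Ss \<mu> \<nu>) C = emeasure (A x \<mu> \<nu>) C + of_nat k * indicator C x"
    if C: "C \<in> sets M" for C
  proof -
    have "emeasure \<mu> (C \<inter> ?Ss) = emeasure \<mu> ((C \<inter> ?Sr) \<union> (C \<inter> {x}))"
      by (intro emeasure_eq_AE AEs[OF \<mu> nm(2,1)]) (use C S x \<mu> sub in auto)
    also have "\<dots> = emeasure \<mu> (C \<inter> ?Sr) + emeasure \<mu> (C \<inter> {x})"
      by (intro plus_emeasure[symmetric]) (use C S x \<mu> in auto)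
    also have "emeasure \<mu> (C \<inter> {x}) = of_nat k * indicator C x"
      by (cases "x \<in> C") (simp_all add: k)
    finally have "emeasure \<mu> (C \<inter> ?Ss) = emeasure \<mu> (C \<inter> ?Sr) + of_nat k * indicator C x" .
    moreover have "emeasure \<nu> (C - ?Ss) = emeasure \<nu> (C - ?Sr - ?D)"
      by (intro emeasure_eq_AE AEs[OF \<nu> nn(2,1)]) (use C S D x \<nu> sub in auto)
    ultimately show ?thesis
      using C S \<mu> \<nu> by (simp add: emeasure_glue A ac_simps)
  qed
  have r_eq: "emeasure (glue ?Sr \<mu> \<nu>) C = emeasure (A x \<mu> \<nu>) C + of_nat k' * indicator C x"
    if C: "C \<in> sets M" for C
  proof -
    have "emeasure \<nu> (C - ?Sr) = emeasure \<nu> ((C - ?Sr - ?D) \<union> (C \<inter> {x}))"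
      by (intro emeasure_eq_AE AEs[OF \<nu> nn(2,1)]) (use C S D x \<nu> sub in auto)
    also have "\<dots> = emeasure \<nu> (C - ?Sr - ?D) + emeasure \<nu> (C \<inter> {x})"
      by (intro plus_emeasure[symmetric]) (use C S D x \<nu> in auto)
    also have "emeasure \<nu> (C \<inter> {x}) = of_nat k' * indicator C x"
      by (cases "x \<in> C") (simp_all add: k)
    finally show ?thesis
      using C S \<mu> \<nu> by (simp add: emeasure_glue A ac_simps)
  qed
  have AN: "A x \<mu> \<nu> \<in> space N" using \<mu> \<nu> xM by (rule A_in_N)
  have eqs: "glue (Zi \<mu> - Z q \<mu>) \<mu> \<nu> = (if j = 0 then A x \<mu> \<nu> else add_point (A x \<mu> \<nu>) x)"
    if q: "Zi \<mu> - Z q \<mu> \<in> sets M" "j \<le> 1"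
      "\<And>C. C \<in> sets M \<Longrightarrow> emeasure (glue (Zi \<mu> - Z q \<mu>) \<mu> \<nu>) C = emeasure (A x \<mu> \<nu>) C + of_nat j * indicator C x" for q and j :: nat
  proof (rule N_eqI[OF glue_in_N[OF \<mu> \<nu> q(1)]])
    show "(if j = 0 then A x \<mu> \<nu> else add_point (A x \<mu> \<nu>) x) \<in> space N" using AN add_point_in_N by simp
    fix C assume "C \<in> sets M"
    with q(2) show "emeasure (glue (Zi \<mu> - Z q \<mu>) \<mu> \<nu>) C = emeasure (if j = 0 then A x \<mu> \<nu> else add_point (A x \<mu> \<nu>) x) C"
      using q(3)[of C] AN by (cases "j = 0") (simp_all add: emeasure_add_point le_Suc_eq)
  qed
  have "glue ?Ss \<mu> \<nu> = (if k = 0 then A x \<mu> \<nu> else add_point (A x \<mu> \<nu>) x)"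
    "glue ?Sr \<mu> \<nu> = (if k' = 0 then A x \<mu> \<nu> else add_point (A x \<mu> \<nu>) x)"
    using kk by (intro eqs S s_eq r_eq; simp)+
  moreover have "k = 0 \<and> k' = 1 \<or> k = 1 \<and> k' = 0" using kk by auto
  ultimately show ?thesis by (auto simp: diff_op_def)
qed

end

section \<open>Comparison along the exploration\<close>

text \<open>Truncation makes convergence in probability sufficient: off a small event the limit is
  close to \<open>X' t\<close>, and on this event the truncated difference costs at most n times its
  probability. Monotone convergence removes the truncation.\<close>

lemma nn_integral_le_of_tendsto_in_prob:
  fixes X Y :: "'w \<Rightarrow> real" and X' :: "real \<Rightarrow> 'w \<Rightarrow> real"
  assumes P: "prob_space P"
    and X: "X \<in> borel_measurable P" and Y: "Y \<in> borel_measurable P"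
    and X': "\<And>t. 0 \<le> t \<Longrightarrow> X' t \<in> borel_measurable P"
    and lim: "tendsto_in_prob P X' Y"
    and bound: "\<And>t. 0 \<le> t \<Longrightarrow> (\<integral>\<^sup>+\<omega>. ennreal \<bar>X \<omega> - X' t \<omega>\<bar> \<partial>P) \<le> C"
  shows "(\<integral>\<^sup>+\<omega>. ennreal \<bar>X \<omega> - Y \<omega>\<bar> \<partial>P) \<le> C"
proof -
  interpret P: prob_space P by fact
  note [measurable] = X Y
  have trunc: "(\<integral>\<^sup>+\<omega>. ennreal (min \<bar>X \<omega> - Y \<omega>\<bar> (real n)) \<partial>P) \<le> C" for n :: nat
  proof (rule ennreal_le_epsilon)
    fix e :: real assume e: "0 < e"
    have "((\<lambda>t. measure P {\<omega>\<in>space P. e / 2 < \<bar>X' t \<omega> - Y \<omega>\<bar>}) \<longlongrightarrow> 0) at_top"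
      by (rule lim[unfolded tendsto_in_prob_def, rule_format]) (use e in simp)
    \<comment> \<open>Chosen so that n times the exceptional probability is at most e / 2; the
      summand 1 covers n = 0.\<close>
    moreover have "0 < e / (2 * (real n + 1))" using e by simp
    ultimately have "\<forall>\<^sub>F t in at_top. measure P {\<omega>\<in>space P. e / 2 < \<bar>X' t \<omega> - Y \<omega>\<bar>} < e / (2 * (real n + 1))"
      by (rule order_tendstoD(2))
    then have "\<forall>\<^sub>F t in at_top. 0 \<le> t \<and> measure P {\<omega>\<in>space P. e / 2 < \<bar>X' t \<omega> - Y \<omega>\<bar>} < e / (2 * (real n + 1))"
      using eventually_ge_at_top[of "0::real"] by (rule eventually_conj[rotated])
    then obtain t where t: "0 \<le> t" and mt: "measure P {\<omega>\<in>space P. e / 2 < \<bar>X' t \<omega> - Y \<omega>\<bar>} < e / (2 * (real n + 1))"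
      by (auto dest!: eventually_happens)
    note [measurable] = X'[OF t]
    let ?E = "{\<omega>\<in>space P. e / 2 < \<bar>X' t \<omega> - Y \<omega>\<bar>}"
    have "(\<integral>\<^sup>+\<omega>. ennreal (min \<bar>X \<omega> - Y \<omega>\<bar> (real n)) \<partial>P) \<le>
        (\<integral>\<^sup>+\<omega>. ennreal \<bar>X \<omega> - X' t \<omega>\<bar> + (ennreal (e / 2) + ennreal (real n) * indicator ?E \<omega>) \<partial>P)"
    proof (rule nn_integral_mono)
      fix \<omega> assume \<omega>: "\<omega> \<in> space P"
      have "min \<bar>X \<omega> - Y \<omega>\<bar> (real n) \<le> \<bar>X \<omega> - X' t \<omega>\<bar> + (e / 2 + real n * indicator ?E \<omega>)"
      proof (cases "\<omega> \<in> ?E")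
        case False
        have "\<bar>X \<omega> - Y \<omega>\<bar> \<le> \<bar>X \<omega> - X' t \<omega>\<bar> + \<bar>X' t \<omega> - Y \<omega>\<bar>" by simp
        also have "\<bar>X' t \<omega> - Y \<omega>\<bar> \<le> e / 2" using False \<omega> by simp
        finally show ?thesis using False by (simp add: min.coboundedI1)
      qed (use e in simp)
      then have "ennreal (min \<bar>X \<omega> - Y \<omega>\<bar> (real n)) \<le> ennreal (\<bar>X \<omega> - X' t \<omega>\<bar> + (e / 2 + real n * indicator ?E \<omega>))"
        by (rule ennreal_leI)
      also have "\<dots> = ennreal \<bar>X \<omega> - X' t \<omega>\<bar> + (ennreal (e / 2) + ennreal (real n) * indicator ?E \<omega>)"
        using e by (simp add: ennreal_plus ennreal_mult' ennreal_indicator)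
      finally show "ennreal (min \<bar>X \<omega> - Y \<omega>\<bar> (real n)) \<le>
          ennreal \<bar>X \<omega> - X' t \<omega>\<bar> + (ennreal (e / 2) + ennreal (real n) * indicator ?E \<omega>)" .
    qed
    also have "\<dots> = (\<integral>\<^sup>+\<omega>. ennreal \<bar>X \<omega> - X' t \<omega>\<bar> \<partial>P) + (ennreal (e / 2) + ennreal (real n) * emeasure P ?E)"
      by (simp add: nn_integral_add nn_integral_cmult P.emeasure_space_1)
    also have "\<dots> \<le> C + ennreal e"
    proof (rule add_mono[OF bound[OF t]])
      have "real n * measure P ?E \<le> (real n + 1) * (e / (2 * (real n + 1)))"
        using mt by (intro mult_mono) auto
      also have "\<dots> = e / 2" by (simp add: field_simps)
      finally have "e / 2 + real n * measure P ?E \<le> e" by simp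
      then have "ennreal (e / 2 + real n * measure P ?E) \<le> ennreal e" by (rule ennreal_leI)
      then show "ennreal (e / 2) + ennreal (real n) * emeasure P ?E \<le> ennreal e"
        using e by (simp add: P.emeasure_eq_measure ennreal_plus ennreal_mult')
    qed
    finally show "(\<integral>\<^sup>+\<omega>. ennreal (min \<bar>X \<omega> - Y \<omega>\<bar> (real n)) \<partial>P) \<le> C + ennreal e" .
  qed
  have "(\<integral>\<^sup>+\<omega>. ennreal \<bar>X \<omega> - Y \<omega>\<bar> \<partial>P) = (\<integral>\<^sup>+\<omega>. (SUP n. ennreal (min \<bar>X \<omega> - Y \<omega>\<bar> (real n))) \<partial>P)"
  proof (rule nn_integral_cong)
    fix \<omega>
    obtain n :: nat where "\<bar>X \<omega> - Y \<omega>\<bar> \<le> real n" using real_arch_simple by blast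
    then show "ennreal \<bar>X \<omega> - Y \<omega>\<bar> = (SUP n. ennreal (min \<bar>X \<omega> - Y \<omega>\<bar> (real n)))"
      by (intro antisym SUP_least SUP_upper2[of n]) (auto intro!: ennreal_leI)
  qed
  also have "\<dots> = (SUP n. \<integral>\<^sup>+\<omega>. ennreal (min \<bar>X \<omega> - Y \<omega>\<bar> (real n)) \<partial>P)"
    by (intro nn_integral_monotone_convergence_SUP) (auto simp: incseq_def le_fun_def intro!: ennreal_leI)
  also have "\<dots> \<le> C" by (rule SUP_least) (rule trunc)
  finally show ?thesis .
qed

context ctdt_space
begin

text \<open>Strong induction on the number of points in \<open>Z t \<mu> - Z s \<mu>\<close>, which
  is finite because the region is local. The first discovery splits off one jump, accounted for by
  its own stretch of the integral, and strictly fewer points remain; the triangle inequality joins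
  both bounds. Without points the configuration stays the same.\<close>

lemma path_bound:
  assumes borel: "is_borel_space M" and f: "f \<in> borel_measurable N" and \<mu>: "\<mu> \<in> space N" and \<nu>: "\<nu> \<in> space N"
    and st: "0 \<le> s" "s \<le> t"
    and single: "\<And>r. 0 \<le> r \<Longrightarrow> emeasure (add_measure \<mu> \<nu>) (Z r \<mu> - left_lim Z r \<mu>) \<le> 1"
  shows "ennreal \<bar>f (glue (Zi \<mu> - Z s \<mu>) \<mu> \<nu>) - f (glue (Zi \<mu> - Z t \<mu>) \<mu> \<nu>)\<bar>
    \<le> (\<integral>\<^sup>+x. indicator (Z t \<mu> - Z s \<mu>) x * adiff f x (A x \<mu> \<nu>) \<partial>add_measure \<mu> \<nu>)"
proof -
  let ?\<kappa> = "add_measure \<mu> \<nu>"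
  let ?F = "\<lambda>s. f (glue (Zi \<mu> - Z s \<mu>) \<mu> \<nu>)"
  let ?D = "\<lambda>x. adiff f x (A x \<mu> \<nu>)"
  let ?I = "\<lambda>s t. \<integral>\<^sup>+x. indicator (Z t \<mu> - Z s \<mu>) x * ?D x \<partial>?\<kappa>"
  have \<kappa>: "?\<kappa> \<in> space N" using \<mu> \<nu> by (rule add_in_N)
  have [measurable_cong]: "sets ?\<kappa> = sets M" using \<mu> by simp
  note [measurable] = \<mu> \<nu>
  have D [measurable]: "?D \<in> borel_measurable M"
    by (rule measurable_diff_op[OF f]) measurable
  have t0: "0 \<le> t" using st by simp
  have "ennreal \<bar>?F s - ?F t\<bar> \<le> ?I s t"
    if "emeasure ?\<kappa> (Z t \<mu> - Z s \<mu>) = of_nat n" for n :: nat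
    using st that
  proof (induction n arbitrary: s rule: less_induct)
    case (less n)
    note s = less.prems(1,2)
    note Zs [measurable] = Z_sets[OF s(1) \<mu>] and Zt [measurable] = Z_sets[OF t0 \<mu>]
    show ?case
    proof (cases "n = 0")
      case True
      then have 0: "emeasure ?\<kappa> (Z t \<mu> - Z s \<mu>) = 0" using less.prems(3) by simp
      have "(Zi \<mu> - Z s \<mu> - (Zi \<mu> - Z t \<mu>)) \<union> (Zi \<mu> - Z t \<mu> - (Zi \<mu> - Z s \<mu>)) = Z t \<mu> - Z s \<mu>"
        using Z_mono[OF \<mu> s] Z_subset_Zi[OF t0, of \<mu>] by auto
      then have "glue (Zi \<mu> - Z s \<mu>) \<mu> \<nu> = glue (Zi \<mu> - Z t \<mu>) \<mu> \<nu>"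
        using 0 \<mu> \<nu> Zi_sets[OF \<mu>] Zs Zt by (intro glue_eqI) (auto simp: emeasure_add_measure)
      then show ?thesis by simp
    next
      case False
      then have nz: "emeasure ?\<kappa> (Z t \<mu> - Z s \<mu>) \<noteq> 0" using less.prems(3) by simp
      obtain r where r: "s < r" "r \<le> t" "emeasure ?\<kappa> (Z r \<mu> - Z s \<mu>) \<noteq> 0" "emeasure ?\<kappa> (left_lim Z r \<mu> - Z s \<mu>) = 0"
        using first_discovery[OF \<mu> \<kappa> s nz] .
      have r0: "0 \<le> r" using s r by simp
      note Zr [measurable] = Z_sets[OF r0 \<mu>] and l [measurable] = left_lim_sets[OF \<mu> r0]
      let ?J = "Z r \<mu> - left_lim Z r \<mu>"
      have J: "?J \<in> L" by (rule L_subset[OF Z_local[OF r0 \<mu>]]) (use Zr l in auto)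
      have Zsl: "Z s \<mu> \<subseteq> left_lim Z r \<mu>" using s r by (intro Z_subset_left_lim)
      have "emeasure ?\<kappa> (Z r \<mu> - Z s \<mu>) \<le> emeasure ?\<kappa> (?J \<union> (left_lim Z r \<mu> - Z s \<mu>))"
        using \<mu> Zr Zs l by (intro emeasure_mono) auto
      also have "\<dots> \<le> emeasure ?\<kappa> ?J + emeasure ?\<kappa> (left_lim Z r \<mu> - Z s \<mu>)"
        using \<mu> Zr Zs l by (intro emeasure_subadditive) auto
      finally have Jnz: "emeasure ?\<kappa> ?J \<noteq> 0" using r(3,4) by auto
      obtain j :: nat where j: "emeasure ?\<kappa> ?J = of_nat j" using N_nat[OF \<kappa> J] by blast
      have "j \<noteq> 0" using Jnz j by auto
      moreover have "j \<le> 1"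
      proof -
        have "(of_nat j :: ennreal) \<le> of_nat 1" using single[OF r0] j by simp
        then show ?thesis by (simp only: of_nat_le_iff)
      qed
      ultimately have J1: "emeasure ?\<kappa> ?J = 1" using j by (simp add: le_Suc_eq)
      obtain x where x: "x \<in> ?J" "{x} \<in> sets M" "emeasure ?\<kappa> {x} = 1" "emeasure ?\<kappa> (?J - {x}) = 0"
        using unit_mass_concentrated[OF borel \<kappa> J J1] .
      note [measurable] = x(2)
      have "ennreal \<bar>?F s - ?F r\<bar> = ?D x"
        using jump[OF \<mu> \<nu> s(1) r(1) x r(4)] by simp
      also have "\<dots> = (\<integral>\<^sup>+y. ?D x * indicator {x} y \<partial>?\<kappa>)"
        using x(2,3) \<mu> by (subst nn_integral_cmult_indicator) simp_all
      also have "\<dots> \<le> ?I s r"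
        using x(1) Zsl by (intro nn_integral_mono) (auto simp: indicator_def)
      finally have first: "ennreal \<bar>?F s - ?F r\<bar> \<le> ?I s r" .
      have sub: "Z s \<mu> \<subseteq> Z r \<mu>" "Z r \<mu> \<subseteq> Z t \<mu>" using Z_mono[OF \<mu>] s r r0 by auto
      have tr: "Z t \<mu> - Z r \<mu> \<in> L" "Z r \<mu> - Z s \<mu> \<in> L"
        by (rule L_subset[OF Z_local[OF t0 \<mu>]], use Zr Zt in auto, rule L_subset[OF Z_local[OF r0 \<mu>]], use Zr Zs in auto)
      obtain a b :: nat where ab: "emeasure ?\<kappa> (Z t \<mu> - Z r \<mu>) = of_nat a" "emeasure ?\<kappa> (Z r \<mu> - Z s \<mu>) = of_nat b"
        using N_nat[OF \<kappa> tr(1)] N_nat[OF \<kappa> tr(2)] by blast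
      have "emeasure ?\<kappa> (Z t \<mu> - Z r \<mu>) + emeasure ?\<kappa> (Z r \<mu> - Z s \<mu>) = emeasure ?\<kappa> ((Z t \<mu> - Z r \<mu>) \<union> (Z r \<mu> - Z s \<mu>))"
        using \<mu> Zr Zs Zt by (intro plus_emeasure) auto
      also have "(Z t \<mu> - Z r \<mu>) \<union> (Z r \<mu> - Z s \<mu>) = Z t \<mu> - Z s \<mu>" using sub by auto
      finally have "(of_nat (a + b) :: ennreal) = of_nat n" using ab less.prems(3) by simp
      then have "a + b = n" by (simp only: of_nat_eq_iff)
      moreover have "b \<noteq> 0" using r(3) ab by auto
      ultimately have "a < n" by simp
      from less.IH[OF this r0 r(2) ab(1)]
      have second: "ennreal \<bar>?F r - ?F t\<bar> \<le> ?I r t" .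
      have "ennreal \<bar>?F s - ?F t\<bar> \<le> ennreal (\<bar>?F s - ?F r\<bar> + \<bar>?F r - ?F t\<bar>)"
        by (rule ennreal_leI) simp
      also have "\<dots> = ennreal \<bar>?F s - ?F r\<bar> + ennreal \<bar>?F r - ?F t\<bar>"
        by (simp add: ennreal_plus)
      also have "\<dots> \<le> ?I s r + ?I r t"
        by (rule add_mono[OF first second])
      also have "\<dots> = (\<integral>\<^sup>+y. indicator (Z r \<mu> - Z s \<mu>) y * ?D y + indicator (Z t \<mu> - Z r \<mu>) y * ?D y \<partial>?\<kappa>)"
        by (rule nn_integral_add[symmetric]) measurable
      also have "\<dots> = ?I s t"
        using sub by (intro nn_integral_cong) (auto simp: indicator_def)
      finally show ?thesis .
    qed
  qed
  moreover have "Z t \<mu> - Z s \<mu> \<in> L"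
    by (rule L_subset[OF Z_local[OF t0 \<mu>]]) (use Z_sets[OF st(1) \<mu>] Z_sets[OF t0 \<mu>] in auto)
  then obtain n :: nat where "emeasure ?\<kappa> (Z t \<mu> - Z s \<mu>) = of_nat n" using N_nat[OF \<kappa>] by blast
  ultimately show ?thesis .
qed

text \<open>If the region held more than one point, every point of \<nu> in it would be counted by
  the vanishing integral. So \<nu> would have none there, against the bound for \<mu>.\<close>

lemma single_discoveries:
  assumes \<mu>: "\<mu> \<in> space N" and \<nu>: "\<nu> \<in> space N"
    and zero: "(\<integral>\<^sup>+x. indicator {x. x \<in> Zi \<mu> \<and> 1 < emeasure (add_measure \<mu> \<nu>) (V x \<mu> - W x \<mu>)} x \<partial>\<nu>) = 0"
    and single: "emeasure \<mu> (Z r \<mu> - left_lim Z r \<mu>) \<le> 1" and r: "0 \<le> r"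
  shows "emeasure (add_measure \<mu> \<nu>) (Z r \<mu> - left_lim Z r \<mu>) \<le> 1"
proof (rule ccontr)
  let ?J = "Z r \<mu> - left_lim Z r \<mu>"
  assume "\<not> emeasure (add_measure \<mu> \<nu>) ?J \<le> 1"
  then have big: "1 < emeasure (add_measure \<mu> \<nu>) ?J" by simp
  have J: "?J \<in> sets M" using Z_sets[OF r \<mu>] left_lim_sets[OF \<mu> r] by auto
  have "emeasure \<nu> ?J = (\<integral>\<^sup>+x. indicator ?J x \<partial>\<nu>)" using J \<nu> by simp
  also have "\<dots> \<le> (\<integral>\<^sup>+x. indicator {x. x \<in> Zi \<mu> \<and> 1 < emeasure (add_measure \<mu> \<nu>) (V x \<mu> - W x \<mu>)} x \<partial>\<nu>)"
  proof (rule nn_integral_mono)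
    fix x
    show "indicator ?J x \<le> (indicator {x. x \<in> Zi \<mu> \<and> 1 < emeasure (add_measure \<mu> \<nu>) (V x \<mu> - W x \<mu>)} x :: ennreal)"
    proof (cases "x \<in> ?J")
      case True
      have T: "T \<mu> x = ennreal r"
        using True T_le_iff[OF \<mu> r, of x] T_less_iff[OF r, of \<mu> x] by (auto simp: not_less intro: antisym)
      have "V x \<mu> - W x \<mu> = ?J" using V_eq_Z[OF \<mu> r T] W_eq_left_lim[OF \<mu> r T] by simp
      then show ?thesis using True big Z_subset_Zi[OF r, of \<mu>] by (auto simp: indicator_def)
    qed simp
  qed
  finally have "emeasure \<nu> ?J = 0" using zero by simp
  then show False using big single \<mu> \<nu> by (simp add: emeasure_add_measure)
qed

section \<open>The path at time 0 and its identification with \<open>zeta\<close>\<close>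

lemma measurable_emeasure_stops:
  assumes U: "stops U" and f: "f \<in> measurable \<Omega> N" "K \<in> measurable \<Omega> N"
  shows "(\<lambda>\<omega>. emeasure (K \<omega>) (U (f \<omega>))) \<in> borel_measurable \<Omega>"
proof -
  note [measurable (raw)] = stops_pred[OF U] and [measurable] = f
  have "(\<lambda>(\<omega>, y). indicator (U (f \<omega>)) y :: ennreal) \<in> borel_measurable (\<Omega> \<Otimes>\<^sub>M M)"
    unfolding case_prod_beta' by (rule borel_measurable_indicator') measurable
  from measurable_nn_integral_kernel[OF this f(2)]
  show ?thesis
  proof (rule measurable_cong[THEN iffD1, rotated])
    fix \<omega> assume "\<omega> \<in> space \<Omega>"
    then have "f \<omega> \<in> space N" "K \<omega> \<in> space N" using f[THEN measurable_space] by auto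
    then show "(\<integral>\<^sup>+y. indicator (U (f \<omega>)) y \<partial>K \<omega>) = emeasure (K \<omega>) (U (f \<omega>))"
      using stops_sets[OF U] by (intro nn_integral_indicator) simp
  qed
qed

text \<open>The left limit at time 0 is empty, so (3) at time 0 concerns all of
  \<open>Z 0 \<mu>\<close>.\<close>

lemma \<Lambda>_Z0: "\<mu> \<in> space N \<Longrightarrow> emeasure \<Lambda> (Z 0 \<mu>) = 0"
  using Z_null[of \<mu> 0] by (simp add: left_lim_def)

text \<open>For \<nu> independence suffices. For \<mu>, adding x does not change whether x is in
  \<open>Z 0\<close>, so the Mecke equation reduces the mean number of points to the mean
  \<Lambda>-mass of \<open>Z 0 \<mu>\<close>.\<close>

lemma AE_Z0: "AE z in Q \<Otimes>\<^sub>M Q. emeasure (fst z) (Z 0 (fst z)) = 0 \<and> emeasure (snd z) (Z 0 (fst z)) = 0"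
proof (rule QQ.AE_pair_measure)
  have Z0: "stops (Z 0)" by (rule Z_stops) simp
  note [measurable (raw)] = measurable_emeasure_stops[OF Z0] stops_pred[OF Z0]
  show "{z \<in> space (Q \<Otimes>\<^sub>M Q). emeasure (fst z) (Z 0 (fst z)) = 0 \<and> emeasure (snd z) (Z 0 (fst z)) = 0} \<in> sets (Q \<Otimes>\<^sub>M Q)"
    by measurable
  have ind: "(\<lambda>z. indicator (Z 0 (fst z)) (snd z) :: ennreal) \<in> borel_measurable (N \<Otimes>\<^sub>M M)"
    by (rule borel_measurable_indicator') measurable
  have ind': "(\<lambda>z. indicator (Z 0 (snd z)) (fst z) :: ennreal) \<in> borel_measurable (\<Lambda> \<Otimes>\<^sub>M Q)"
    by (rule borel_measurable_indicator') measurable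
  have "(\<integral>\<^sup>+\<mu>. emeasure \<mu> (Z 0 \<mu>) \<partial>Q) = (\<integral>\<^sup>+\<mu>. \<integral>\<^sup>+x. indicator (Z 0 \<mu>) x \<partial>\<mu> \<partial>Q)"
    using stops_sets[OF Z0] by (intro nn_integral_cong) simp
  also have "\<dots> = (\<integral>\<^sup>+x. \<integral>\<^sup>+\<mu>. indicator (Z 0 (add_point \<mu> x)) x \<partial>Q \<partial>\<Lambda>)"
    by (rule mecke_Q[OF ind])
  also have "\<dots> = (\<integral>\<^sup>+x. \<integral>\<^sup>+\<mu>. indicator (Z 0 \<mu>) x \<partial>Q \<partial>\<Lambda>)"
    using stops_add_point(2)[OF Z0] by (intro nn_integral_cong) (simp add: indicator_def)
  also have "\<dots> = (\<integral>\<^sup>+\<mu>. \<integral>\<^sup>+x. indicator (Z 0 \<mu>) x \<partial>\<Lambda> \<partial>Q)"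
    using ind' by (intro \<Lambda>Q.Fubini'[symmetric]) (simp add: case_prod_beta')
  also have "\<dots> = (\<integral>\<^sup>+\<mu>. 0 \<partial>Q)"
    using stops_sets[OF Z0] \<Lambda>_Z0 by (intro nn_integral_cong) simp
  finally have "(\<integral>\<^sup>+\<mu>. emeasure \<mu> (Z 0 \<mu>) \<partial>Q) = 0" by simp
  moreover have "(\<lambda>\<mu>. emeasure \<mu> (Z 0 \<mu>)) \<in> borel_measurable Q" by measurable
  ultimately have "AE \<mu> in Q. emeasure \<mu> (Z 0 \<mu>) = 0"
    by (simp only: nn_integral_0_iff_AE)
  moreover have "AE \<mu> in Q. \<mu> \<in> space N" by (rule AE_I2) simp
  ultimately show "AE \<mu> in Q. AE \<nu> in Q. emeasure (fst (\<mu>, \<nu>)) (Z 0 (fst (\<mu>, \<nu>))) = 0 \<and> emeasure (snd (\<mu>, \<nu>)) (Z 0 (fst (\<mu>, \<nu>))) = 0"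
  proof eventually_elim
    case (elim \<mu>)
    then show ?case using AE_null[OF stops_sets[OF Z0] \<Lambda>_Z0, of \<mu>] by simp
  qed
qed

text \<open>The two parts filled from \<nu> are disjoint and together form the complement of
  \<open>Zi \<mu> - Z t \<mu>\<close>.\<close>

lemma zeta_eq_glue:
  assumes \<mu>: "\<mu> \<in> space N" and \<nu>: "\<nu> \<in> space N" and t: "0 \<le> t"
  shows "zeta M Z t \<mu> \<nu> = glue (Zi \<mu> - Z t \<mu>) \<mu> \<nu>"
proof (rule N_eqI)
  note S = Z_sets[OF t \<mu>] Zi_sets[OF \<mu>]
  show "zeta M Z t \<mu> \<nu> \<in> space N"
    unfolding zeta_def using \<mu> \<nu> S by (intro add_in_N restr_in_N) auto
  show "glue (Zi \<mu> - Z t \<mu>) \<mu> \<nu> \<in> space N"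
    using \<mu> \<nu> S by (intro glue_in_N) auto
  fix C assume C: "C \<in> sets M"
  have "emeasure \<nu> (C \<inter> Z t \<mu>) + emeasure \<nu> (C \<inter> (space M - Zi \<mu>)) = emeasure \<nu> ((C \<inter> Z t \<mu>) \<union> (C \<inter> (space M - Zi \<mu>)))"
    using C S \<nu> Z_subset_Zi[OF t, of \<mu>] by (intro plus_emeasure) auto
  also have "(C \<inter> Z t \<mu>) \<union> (C \<inter> (space M - Zi \<mu>)) = C - (Zi \<mu> - Z t \<mu>)"
    using sets.sets_into_space[OF C] Z_subset_Zi[OF t, of \<mu>] by auto
  finally show "emeasure (zeta M Z t \<mu> \<nu>) C = emeasure (glue (Zi \<mu> - Z t \<mu>) \<mu> \<nu>) C"
    using C S \<mu> \<nu> unfolding zeta_def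
    by (simp add: emeasure_glue emeasure_add_measure emeasure_restr sets.Diff add.assoc)
qed

text \<open>Up to null sets the path starts with \<mu> inside \<open>Zi \<mu>\<close> and \<nu>
  outside. The hypothesis on \<open>f\<close> restricts each argument to its own explored set, and
  the stopping property shows that these two sets are equal.\<close>

lemma glue_Z0:
  assumes \<mu>: "\<mu> \<in> space N" and \<nu>: "\<nu> \<in> space N"
    and null: "emeasure \<mu> (Z 0 \<mu>) = 0" "emeasure \<nu> (Z 0 \<mu>) = 0"
    and f: "\<And>\<mu>. \<mu> \<in> space N \<Longrightarrow> f \<mu> = f (restr \<mu> (Zi \<mu>))"
  shows "f (glue (Zi \<mu> - Z 0 \<mu>) \<mu> \<nu>) = f \<mu>"
proof -
  let ?\<xi> = "glue (Zi \<mu>) \<mu> \<nu>"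
  note i = Zi_sets[OF \<mu>]
  have \<xi>: "?\<xi> \<in> space N" using \<mu> \<nu> i by (rule glue_in_N)
  have "(Zi \<mu> - Z 0 \<mu> - Zi \<mu>) \<union> (Zi \<mu> - (Zi \<mu> - Z 0 \<mu>)) = Z 0 \<mu>"
    using Z_subset_Zi[of 0 \<mu>] by auto
  then have eq: "glue (Zi \<mu> - Z 0 \<mu>) \<mu> \<nu> = ?\<xi>"
    using null \<mu> \<nu> i Z_sets[of 0 \<mu>] by (intro glue_eqI) auto
  have agr: "emeasure ?\<xi> C = emeasure \<mu> C" if "C \<in> sets M" "C \<subseteq> Zi \<mu>" for C
  proof -
    have "C \<inter> Zi \<mu> = C" "C - Zi \<mu> = {}" using that(2) by auto
    then show ?thesis using emeasure_glue[OF \<mu> \<nu> i that(1)] by (simp only: emeasure_empty add_0_right)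
  qed
  then have "agree \<mu> ?\<xi> (Zi \<mu>)" by (simp add: agree_def)
  then have Z\<xi>: "Zi ?\<xi> = Zi \<mu>" by (rule stops_agree[OF stops_Zi \<mu> \<xi>])
  have "restr ?\<xi> (Zi \<mu>) = restr \<mu> (Zi \<mu>)"
    using \<mu> \<xi> i agr by (intro N_eqI restr_in_N) (simp_all add: emeasure_restr)
  then show ?thesis using f[OF \<xi>] f[OF \<mu>] Z\<xi> eq by simp
qed

end

section \<open>Transfer to the given probability space and passage to the limit\<close>

theorem theorem3p2:
  fixes M :: "'a measure" and B :: "nat \<Rightarrow> 'a set" and \<Lambda> :: "'a measure"
    and P :: "'w measure" and \<eta> \<eta>' :: "'w \<Rightarrow> 'a measure"
    and Z :: "real \<Rightarrow> 'a measure \<Rightarrow> 'a set" and f :: "'a measure \<Rightarrow> real"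
  assumes "is_borel_space M" and "localizing_seq M B"
    and "locally_finite M B \<Lambda>" and "diffuse \<Lambda>"
    and "prob_space P"
    and "poisson_process P M B \<Lambda> \<eta>" and "poisson_process P M B \<Lambda> \<eta>'"
    and "prob_space.indep_var P (counting_space M B) \<eta> (counting_space M B) \<eta>'"
    and "ctdt P M B \<Lambda> \<eta> Z"
    and "f \<in> borel_measurable (counting_space M B)"
    and "integrable P (\<lambda>\<omega>. f (\<eta> \<omega>))"
    and "\<And>\<mu>. \<mu> \<in> counting_measures M B \<Longrightarrow> f \<mu> = f (restr \<mu> (Z_infty Z \<mu>))"
    and "tendsto_in_prob P (\<lambda>t \<omega>. f (zeta M Z t (\<eta> \<omega>) (\<eta>' \<omega>))) (\<lambda>\<omega>. f (\<eta>' \<omega>))"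
    and "\<And>\<mu> t. \<mu> \<in> counting_measures M B \<Longrightarrow> 0 \<le> t \<Longrightarrow>
           emeasure \<Lambda> (Z t \<mu> - left_lim Z t \<mu>) = 0"
    and "AE \<omega> in P. \<forall>t\<ge>0. emeasure (\<eta> \<omega>) (Z t (\<eta> \<omega>) - left_lim Z t (\<eta> \<omega>)) \<le> 1"
  shows "(\<integral>\<^sup>+\<omega>. ennreal \<bar>f (\<eta> \<omega>) - f (\<eta>' \<omega>)\<bar> \<partial>P)
    \<le> 2 * (\<integral>\<^sup>+x. emeasure P {\<omega>\<in>space P. x \<in> Z_infty Z (\<eta> \<omega>)}
               * (\<integral>\<^sup>+\<omega>. ennreal \<bar>diff_op M x f (\<eta> \<omega>)\<bar> \<partial>P) \<partial>\<Lambda>)"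
proof -
  interpret P: prob_space P by fact
  interpret intensity_space M B \<Lambda> by standard fact+
  note f = \<open>f \<in> borel_measurable N\<close>
  have \<eta> [measurable]: "\<eta> \<in> measurable P N" and \<eta>' [measurable]: "\<eta>' \<in> measurable P N"
    using \<open>poisson_process P M B \<Lambda> \<eta>\<close> \<open>poisson_process P M B \<Lambda> \<eta>'\<close> by (auto simp: poisson_process_def)
  define Q where "Q = distr P N \<eta>"
  \<comment> \<open>The cylinder probabilities depend on \<Lambda> only, so both processes have the
    same law.\<close>
  have Q': "distr P N \<eta>' = Q"
  proof (rule counting_measure_eqI[where A = "{}"])
    show "emeasure (distr P N \<eta>') (space N) < \<infinity>"
      by (simp add: emeasure_distr less_top[symmetric])
    show "emeasure (distr P N \<eta>') (cyl \<C> n) = emeasure Q (cyl \<C> n)"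
      if "finite \<C>" "\<C> \<subseteq> L" "disjoint \<C>" for \<C> n
      unfolding Q_def using that assms(5-7) by (simp only: prob_poisson_process_cyl)
  qed (simp_all add: Q_def mem_L_iff)
  interpret ctdt_space M B \<Lambda> Q Z
  proof (intro ctdt_space.intro poisson_space.intro poisson_space_axioms.intro ctdt_space_axioms.intro)
    show "intensity_space M B \<Lambda>" by (rule intensity_space_axioms)
    show "prob_space Q" unfolding Q_def by (rule P.prob_space_distr[OF \<eta>])
    show "sets Q = sets N" by (simp add: Q_def)
    show "emeasure Q (cyl \<C> n) = pois_cyl \<C> n" if "finite \<C>" "\<C> \<subseteq> L" "disjoint \<C>" for \<C> n
      unfolding Q_def using that assms(5,6) by (simp only: prob_poisson_process_cyl)
    show "stops (Z t)" if "0 \<le> t" for t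
      using \<open>ctdt P M B \<Lambda> \<eta> Z\<close> that by (intro stops_of_stopping_set) (simp add: ctdt_def)
    show "Z t \<mu> \<in> L" if "0 \<le> t" "\<mu> \<in> space N" for t \<mu>
      using \<open>ctdt P M B \<Lambda> \<eta> Z\<close> that unfolding ctdt_def space_counting_space by blast
    show "Z s \<mu> \<subseteq> Z t \<mu>" if "\<mu> \<in> space N" "0 \<le> s" "s \<le> t" for s t \<mu>
      using \<open>ctdt P M B \<Lambda> \<eta> Z\<close> that unfolding ctdt_def space_counting_space by blast
    show "Z t \<mu> = (\<Inter>s\<in>{t<..}. Z s \<mu>)" if "\<mu> \<in> space N" "0 \<le> t" for t \<mu>
      using \<open>ctdt P M B \<Lambda> \<eta> Z\<close> that unfolding ctdt_def space_counting_space by blast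
    show "emeasure \<Lambda> (Z t \<mu> - left_lim Z t \<mu>) = 0" if "\<mu> \<in> space N" "0 \<le> t" for t \<mu>
      using assms(14) that by (simp add: space_counting_space)
  qed
  let ?F = "\<lambda>t \<omega>. f (glue (Zi (\<eta> \<omega>) - Z t (\<eta> \<omega>)) (\<eta> \<omega>) (\<eta>' \<omega>))"
  have R: "influence f = (\<integral>\<^sup>+x. emeasure P {\<omega>\<in>space P. x \<in> Zi (\<eta> \<omega>)} * (\<integral>\<^sup>+\<omega>. adiff f x (\<eta> \<omega>) \<partial>P) \<partial>\<Lambda>)"
    unfolding influence_def
  proof (rule nn_integral_cong)
    fix x assume "x \<in> space \<Lambda>"
    then have x [measurable]: "x \<in> space M" by simp
    note [measurable (raw)] = stops_pred[OF stops_Zi]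
    have "adiff f x \<in> borel_measurable N" by (rule measurable_diff_op[OF f]) measurable
    then have "(\<integral>\<^sup>+\<mu>. adiff f x \<mu> \<partial>Q) = (\<integral>\<^sup>+\<omega>. adiff f x (\<eta> \<omega>) \<partial>P)"
      unfolding Q_def by (intro nn_integral_distr) simp_all
    moreover have "\<eta> -` {\<mu>\<in>space N. x \<in> Zi \<mu>} \<inter> space P = {\<omega>\<in>space P. x \<in> Zi (\<eta> \<omega>)}"
      using measurable_space[OF \<eta>] by auto
    then have "emeasure Q {\<mu>\<in>space N. x \<in> Zi \<mu>} = emeasure P {\<omega>\<in>space P. x \<in> Zi (\<eta> \<omega>)}"
      unfolding Q_def by (subst emeasure_distr) simp_all
    ultimately show "emeasure Q {\<mu>\<in>space N. x \<in> Zi \<mu>} * (\<integral>\<^sup>+\<mu>. adiff f x \<mu> \<partial>Q) =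
        emeasure P {\<omega>\<in>space P. x \<in> Zi (\<eta> \<omega>)} * (\<integral>\<^sup>+\<omega>. adiff f x (\<eta> \<omega>) \<partial>P)" by simp
  qed
  \<comment> \<open>Independence enters here: the pair has the product law, on which the iterated
    integrals were computed.\<close>
  have joint: "distr P (N \<Otimes>\<^sub>M N) (\<lambda>\<omega>. (\<eta> \<omega>, \<eta>' \<omega>)) = Q \<Otimes>\<^sub>M Q"
    using assms(8) Q' by (simp add: P.indep_var_distribution_eq Q_def)
  have transfer: "(\<integral>\<^sup>+\<omega>. h (\<eta> \<omega>) (\<eta>' \<omega>) \<partial>P) = EE (\<lambda>\<mu> \<nu>. h \<mu> \<nu>)"
    if h: "(\<lambda>z. h (fst z) (snd z)) \<in> borel_measurable (N \<Otimes>\<^sub>M N)" for h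
  proof -
    have "EE (\<lambda>\<mu> \<nu>. h \<mu> \<nu>) = (\<integral>\<^sup>+z. h (fst z) (snd z) \<partial>(Q \<Otimes>\<^sub>M Q))"
      using Q.nn_integral_fst[of "\<lambda>z. h (fst z) (snd z)" Q] h by (simp cong: measurable_cong_sets)
    also have "\<dots> = (\<integral>\<^sup>+\<omega>. h (\<eta> \<omega>) (\<eta>' \<omega>) \<partial>P)"
      unfolding joint[symmetric] using h by (subst nn_integral_distr) simp_all
    finally show ?thesis ..
  qed
  let ?k = "\<lambda>\<mu> \<nu> x. indicator (Zi \<mu>) x * adiff f x (A x \<mu> \<nu>)"
  note k = integrand_measurable[OF f]
  have kernels: "(\<lambda>z. \<integral>\<^sup>+x. ?k (fst z) (snd z) x \<partial>fst z) \<in> borel_measurable (N \<Otimes>\<^sub>M N)"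
    "(\<lambda>z. \<integral>\<^sup>+x. ?k (fst z) (snd z) x \<partial>snd z) \<in> borel_measurable (N \<Otimes>\<^sub>M N)"
    using measurable_nn_integral_kernel[of "\<lambda>z x. ?k (fst z) (snd z) x" "N \<Otimes>\<^sub>M N" fst]
      measurable_nn_integral_kernel[of "\<lambda>z x. ?k (fst z) (snd z) x" "N \<Otimes>\<^sub>M N" snd] k
    by (simp_all add: case_prod_beta')
  have total: "(\<integral>\<^sup>+\<omega>. (\<integral>\<^sup>+x. ?k (\<eta> \<omega>) (\<eta>' \<omega>) x \<partial>\<eta> \<omega>) + (\<integral>\<^sup>+x. ?k (\<eta> \<omega>) (\<eta>' \<omega>) x \<partial>\<eta>' \<omega>) \<partial>P) = 2 * influence f"
  proof -
    have "(\<integral>\<^sup>+\<omega>. (\<integral>\<^sup>+x. ?k (\<eta> \<omega>) (\<eta>' \<omega>) x \<partial>\<eta> \<omega>) + (\<integral>\<^sup>+x. ?k (\<eta> \<omega>) (\<eta>' \<omega>) x \<partial>\<eta>' \<omega>) \<partial>P) =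
        EE (\<lambda>\<mu> \<nu>. (\<integral>\<^sup>+x. ?k \<mu> \<nu> x \<partial>\<mu>) + (\<integral>\<^sup>+x. ?k \<mu> \<nu> x \<partial>\<nu>))"
      using kernels by (intro transfer borel_measurable_add)
    also have "\<dots> = influence f + influence f"
      using nn_integral_kernels_add[OF k k] integral_points_fst[OF f] integral_points_snd[OF f]
      by simp
    finally show ?thesis by (simp add: mult_2)
  qed
  \<comment> \<open>The hypothesis covers pairs of points of \<eta>, and pairs involving a point of
    \<eta>' were excluded above. That exclusion holds for all times at once, since a single integral
    over the points of \<eta>' encodes it.\<close>
  have single: "AE \<omega> in P. \<forall>r\<ge>0. emeasure (add_measure (\<eta> \<omega>) (\<eta>' \<omega>)) (Z r (\<eta> \<omega>) - left_lim Z r (\<eta> \<omega>)) \<le> 1"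
  proof -
    let ?s = "\<lambda>\<mu> \<nu> x. indicator {x. x \<in> Zi \<mu> \<and> 1 < emeasure (add_measure \<mu> \<nu>) (V x \<mu> - W x \<mu>)} x :: ennreal"
    note [measurable (raw)] = stops_pred[OF stops_Zi] measurable_VW
    have s: "(\<lambda>z. ?s (fst (fst z)) (snd (fst z)) (snd z)) \<in> borel_measurable ((N \<Otimes>\<^sub>M N) \<Otimes>\<^sub>M M)"
      by (rule borel_measurable_indicator') (unfold mem_Collect_eq, measurable)
    have "(\<lambda>z. \<integral>\<^sup>+x. ?s (fst z) (snd z) x \<partial>snd z) \<in> borel_measurable (N \<Otimes>\<^sub>M N)"
      using measurable_nn_integral_kernel[of "\<lambda>z x. ?s (fst z) (snd z) x" "N \<Otimes>\<^sub>M N" snd] s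
      by (simp add: case_prod_beta')
    note m = this measurable_compose[OF measurable_Pair[OF \<eta> \<eta>'] this]
    have "(\<integral>\<^sup>+\<omega>. \<integral>\<^sup>+x. ?s (\<eta> \<omega>) (\<eta>' \<omega>) x \<partial>\<eta>' \<omega> \<partial>P) = 0"
      using transfer[OF m(1)] no_simultaneous_points by simp
    then have "AE \<omega> in P. (\<integral>\<^sup>+x. ?s (\<eta> \<omega>) (\<eta>' \<omega>) x \<partial>\<eta>' \<omega>) = 0"
      using m(2) by (simp add: nn_integral_0_iff_AE)
    moreover have "AE \<omega> in P. \<omega> \<in> space P" by (rule AE_I2)
    ultimately show ?thesis
      using assms(15)
    proof eventually_elim
      case (elim \<omega>)
      then show ?case
        using single_discoveries[OF measurable_space[OF \<eta>] measurable_space[OF \<eta>']] by blast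
    qed
  qed
  have Z0: "AE \<omega> in P. emeasure (\<eta> \<omega>) (Z 0 (\<eta> \<omega>)) = 0 \<and> emeasure (\<eta>' \<omega>) (Z 0 (\<eta> \<omega>)) = 0"
  proof -
    have "AE z in distr P (N \<Otimes>\<^sub>M N) (\<lambda>\<omega>. (\<eta> \<omega>, \<eta>' \<omega>)). emeasure (fst z) (Z 0 (fst z)) = 0 \<and> emeasure (snd z) (Z 0 (fst z)) = 0"
      unfolding joint by (rule AE_Z0)
    from AE_distrD[OF _ this] show ?thesis by simp
  qed
  \<comment> \<open>Uniformity in t comes from enlarging the range of integration from
    \<open>Z t - Z 0\<close> to the whole explored set.\<close>
  have bound: "(\<integral>\<^sup>+\<omega>. ennreal \<bar>f (\<eta> \<omega>) - ?F t \<omega>\<bar> \<partial>P) \<le> 2 * influence f" if t: "0 \<le> t" for t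
  proof -
    have "AE \<omega> in P. \<omega> \<in> space P" by (rule AE_I2)
    with single Z0 have "AE \<omega> in P. ennreal \<bar>f (\<eta> \<omega>) - ?F t \<omega>\<bar> \<le>
        (\<integral>\<^sup>+x. ?k (\<eta> \<omega>) (\<eta>' \<omega>) x \<partial>\<eta> \<omega>) + (\<integral>\<^sup>+x. ?k (\<eta> \<omega>) (\<eta>' \<omega>) x \<partial>\<eta>' \<omega>)"
    proof eventually_elim
      case (elim \<omega>)
      have \<mu>\<nu>: "\<eta> \<omega> \<in> space N" "\<eta>' \<omega> \<in> space N"
        using elim(3) measurable_space[OF \<eta>] measurable_space[OF \<eta>'] by auto
      have "f (\<eta> \<omega>) = ?F 0 \<omega>"
        using glue_Z0[OF \<mu>\<nu>, of f] elim(2) assms(12) by (simp add: space_counting_space)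
      then have "ennreal \<bar>f (\<eta> \<omega>) - ?F t \<omega>\<bar> \<le>
          (\<integral>\<^sup>+x. indicator (Z t (\<eta> \<omega>) - Z 0 (\<eta> \<omega>)) x * adiff f x (A x (\<eta> \<omega>) (\<eta>' \<omega>)) \<partial>add_measure (\<eta> \<omega>) (\<eta>' \<omega>))"
        using path_bound[OF assms(1) f \<mu>\<nu> order_refl t] elim(1) by simp
      also have "\<dots> \<le> (\<integral>\<^sup>+x. ?k (\<eta> \<omega>) (\<eta>' \<omega>) x \<partial>add_measure (\<eta> \<omega>) (\<eta>' \<omega>))"
        using Z_subset_Zi[OF t, of "\<eta> \<omega>"] by (intro nn_integral_mono mult_right_mono) (auto simp: indicator_def)
      also have "\<dots> = (\<integral>\<^sup>+x. ?k (\<eta> \<omega>) (\<eta>' \<omega>) x \<partial>\<eta> \<omega>) + (\<integral>\<^sup>+x. ?k (\<eta> \<omega>) (\<eta>' \<omega>) x \<partial>\<eta>' \<omega>)"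
      proof (rule nn_integral_add_measure)
        have "(\<lambda>x. ((\<eta> \<omega>, \<eta>' \<omega>), x)) \<in> measurable M ((N \<Otimes>\<^sub>M N) \<Otimes>\<^sub>M M)"
          using \<mu>\<nu> by (intro measurable_Pair measurable_const measurable_ident_sets refl)
        from measurable_compose[OF this k] show "?k (\<eta> \<omega>) (\<eta>' \<omega>) \<in> borel_measurable M" by simp
      qed (use \<mu>\<nu> in simp_all)
      finally show ?case .
    qed
    then have "(\<integral>\<^sup>+\<omega>. ennreal \<bar>f (\<eta> \<omega>) - ?F t \<omega>\<bar> \<partial>P) \<le>
        (\<integral>\<^sup>+\<omega>. (\<integral>\<^sup>+x. ?k (\<eta> \<omega>) (\<eta>' \<omega>) x \<partial>\<eta> \<omega>) + (\<integral>\<^sup>+x. ?k (\<eta> \<omega>) (\<eta>' \<omega>) x \<partial>\<eta>' \<omega>) \<partial>P)"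
      by (rule nn_integral_mono_AE)
    then show ?thesis using total by simp
  qed
  have F: "?F t \<in> borel_measurable P" if t: "0 \<le> t" for t
  proof (rule measurable_compose[OF _ f], rule measurable_glue)
    note [measurable (raw)] = stops_pred[OF stops_Zi] stops_pred[OF Z_stops[OF t]]
    show "Measurable.pred (P \<Otimes>\<^sub>M M) (\<lambda>z. snd z \<in> Zi (\<eta> (fst z)) - Z t (\<eta> (fst z)))"
      unfolding Diff_iff by measurable
    show "Zi (\<eta> \<omega>) - Z t (\<eta> \<omega>) \<in> sets M" if "\<omega> \<in> space P" for \<omega>
      using measurable_space[OF \<eta> that] by (intro sets.Diff Zi_sets Z_sets[OF t])
  qed measurable
  have lim: "tendsto_in_prob P ?F (\<lambda>\<omega>. f (\<eta>' \<omega>))"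
    unfolding tendsto_in_prob_def
  proof (intro allI impI)
    fix e :: real assume "0 < e"
    then have "((\<lambda>t. measure P {\<omega>\<in>space P. e < \<bar>f (zeta M Z t (\<eta> \<omega>) (\<eta>' \<omega>)) - f (\<eta>' \<omega>)\<bar>}) \<longlongrightarrow> 0) at_top"
      using assms(13) by (simp add: tendsto_in_prob_def)
    \<comment> \<open>\<open>zeta\<close> and the glued configuration are identified at nonnegative
      times, which is enough for a limit at infinity.\<close>
    moreover have eq: "{\<omega>\<in>space P. e < \<bar>f (zeta M Z t (\<eta> \<omega>) (\<eta>' \<omega>)) - f (\<eta>' \<omega>)\<bar>} = {\<omega>\<in>space P. e < \<bar>?F t \<omega> - f (\<eta>' \<omega>)\<bar>}"
      if "0 \<le> t" for t
      using zeta_eq_glue[OF measurable_space[OF \<eta>] measurable_space[OF \<eta>'] that] by auto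
    have "\<forall>\<^sub>F t in at_top. measure P {\<omega>\<in>space P. e < \<bar>f (zeta M Z t (\<eta> \<omega>) (\<eta>' \<omega>)) - f (\<eta>' \<omega>)\<bar>} =
        measure P {\<omega>\<in>space P. e < \<bar>?F t \<omega> - f (\<eta>' \<omega>)\<bar>}"
      by (rule eventually_mono[OF eventually_ge_at_top[of 0]]) (simp only: eq)
    ultimately show "((\<lambda>t. measure P {\<omega>\<in>space P. e < \<bar>?F t \<omega> - f (\<eta>' \<omega>)\<bar>}) \<longlongrightarrow> 0) at_top"
      by (rule Lim_transform_eventually)
  qed
  have "(\<integral>\<^sup>+\<omega>. ennreal \<bar>f (\<eta> \<omega>) - f (\<eta>' \<omega>)\<bar> \<partial>P) \<le> 2 * influence f"
  proof (rule nn_integral_le_of_tendsto_in_prob[OF \<open>prob_space P\<close> _ _ _ lim])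
    show "(\<lambda>\<omega>. f (\<eta> \<omega>)) \<in> borel_measurable P" "(\<lambda>\<omega>. f (\<eta>' \<omega>)) \<in> borel_measurable P"
      by (rule measurable_compose[OF \<eta> f], rule measurable_compose[OF \<eta>' f])
  qed (fact F bound)+
  then show ?thesis unfolding R .
qed

end
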